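(* Let $n,\ell$ be two positive integers. There exists an explicit signed bijection between hook involutions of size $n$ and length $\ell$ (a signed set with sign $\varepsilon(I)$) and ribbon tableaux of size $n$ and length $\ell$ (a signed set with sign $\varepsilon(P)$).
   Context: Partitions are identified with their Ferrers diagrams; $|\lambda|$ is the number of cells. For $\lambda\subseteq\mu$, the skew shape $\mu/\lambda$ is identified with the set of cells $\mu\setminus\lambda$, and its size is its number of cells. A ribbon is a connected skew shape (any two cells are joined by a sequence of its cells in which consecutive cells share a side) containing no $2\times 2$ square of cells. The height $h(r)$ of a nonempty ribbon $r$ is the number of rows it occupies minus one, and its sign is $\varepsilon(r)=(-1)^{h(r)}$. A ribbon tableau of shape $\lambda$ and length $\ell$ is a sequence of partitions $\emptyset=\lambda^0\subset\lambda^1\subset\cdots\subset\lambda^\ell=\lambda$ such that each $r_i=\lambda^{i+1}/\lambda^i$ ($0\le i<\ell$) is a nonempty ribbon. Its size is $|\lambda|$ and its sign $\varepsilon(P)$ is the product of the signs of the ribbons $r_i$. A hook is a nonempty partition of the form $(k,1,\ldots,1)$; it is characterized by its size $s\ge 1$ and its height $h\in\{0,\ldots,s-1\}$ (number of rows minus one), and its sign is $(-1)^h$. A hook permutation of length $\ell$ is a pair $(H,\sigma)$ where $H=(H_1,\ldots,H_\ell)$ is a sequence of $\ell$ hooks and $\sigma$ is a permutation of $\{1,\ldots,\ell\}$; its size is $\sum_i|H_i|$. A hook involution is a hook permutation $I=(H,\sigma)$ such that $\sigma$ is an involution ($\sigma^2=\mathrm{id}$) and $H_i=H_j$ whenever $j=\sigma(i)$;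 its sign is $\varepsilon(I)=\prod_{i:\sigma(i)=i}\varepsilon(H_i)$. A signed set is a finite set together with a function to $\{1,-1\}$ (its sign). A signed bijection between signed sets $A$ and $B$ is a triple $(i_A,i_B,\phi)$ where $i_A$ (resp. $i_B$) is an involution on $A$ (resp. $B$) that is sign reversing outside its fixed point set, and $\phi$ is a sign preserving bijection from $\mathrm{Fix}(i_A)$ to $\mathrm{Fix}(i_B)$. "Explicit" means that the three maps are given by a concrete algorithmic construction (growth diagrams on a half grid with local rules on ribbons, combined with the Garsia–Milne involution principle), and not merely deduced from the equality of signed cardinals. *)

theory Defs
  imports "HOL-Combinatorics.Permutations"
begin

section \<open>Signed sets and signed bijections\<close>

definition signed_set :: "'a set \<Rightarrow> ('a \<Rightarrow> int) \<Rightarrow> bool" where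
  "signed_set A sA \<longleftrightarrow> finite A \<and> (\<forall>a\<in>A. sA a \<in> {1, -1})"

definition fixed_points :: "'a set \<Rightarrow> ('a \<Rightarrow> 'a) \<Rightarrow> 'a set" where
  "fixed_points A f = {a \<in> A. f a = a}"

definition sign_reversing_involution ::
    "'a set \<Rightarrow> ('a \<Rightarrow> int) \<Rightarrow> ('a \<Rightarrow> 'a) \<Rightarrow> bool" where
  "sign_reversing_involution A sA f \<longleftrightarrow>
     (\<forall>a\<in>A. f a \<in> A \<and> f (f a) = a \<and> (f a \<noteq> a \<longrightarrow> sA (f a) = - sA a))"

definition signed_bijection ::
    "'a set \<Rightarrow> ('a \<Rightarrow> int) \<Rightarrow> 'b set \<Rightarrow> ('b \<Rightarrow> int) \<Rightarrow>
     ('a \<Rightarrow> 'a) \<times> ('b \<Rightarrow> 'b) \<times> ('a \<Rightarrow> 'b) \<Rightarrow> bool" where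
  "signed_bijection A sA B sB = (\<lambda>(iA, iB, \<phi>).
     signed_set A sA \<and> signed_set B sB \<and>
     sign_reversing_involution A sA iA \<and> sign_reversing_involution B sB iB \<and>
     bij_betw \<phi> (fixed_points A iA) (fixed_points B iB) \<and>
     (\<forall>a \<in> fixed_points A iA. sB (\<phi> a) = sA a))"


section \<open>Partitions, ribbons and ribbon tableaux\<close>

text \<open>Rows and columns are numbered from 0; row 0 is the longest one.\<close>

type_synonym partition = "nat list"

definition is_partition :: "partition \<Rightarrow> bool" where
  "is_partition p \<longleftrightarrow> sorted_wrt (\<ge>) p \<and> 0 \<notin> set p"

definition cells :: "partition \<Rightarrow> (nat \<times> nat) set" where
  "cells p = {(i, j). i < length p \<and> j < p ! i}"

definition skew :: "partition \<Rightarrow> partition \<Rightarrow> (nat \<times> nat) set" where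
  "skew \<mu> \<nu> = cells \<mu> - cells \<nu>"

definition share_side :: "nat \<times> nat \<Rightarrow> nat \<times> nat \<Rightarrow> bool" where
  "share_side c d \<longleftrightarrow>
     fst c = fst d \<and> (snd d = Suc (snd c) \<or> snd c = Suc (snd d)) \<or>
     snd c = snd d \<and> (fst d = Suc (fst c) \<or> fst c = Suc (fst d))"

definition cells_connected :: "(nat \<times> nat) set \<Rightarrow> bool" where
  "cells_connected S \<longleftrightarrow>
     (\<forall>c\<in>S. \<forall>d\<in>S. (c, d) \<in> {(x, y). x \<in> S \<and> y \<in> S \<and> share_side x y}\<^sup>*)"

definition has_square :: "(nat \<times> nat) set \<Rightarrow> bool" where
  "has_square S \<longleftrightarrow>
     (\<exists>i j. {(i, j), (i, Suc j), (Suc i, j), (Suc i, Suc j)} \<subseteq> S)"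

definition is_ribbon :: "partition \<Rightarrow> partition \<Rightarrow> bool" where
  "is_ribbon \<mu> \<nu> \<longleftrightarrow>
     is_partition \<mu> \<and> is_partition \<nu> \<and> cells \<nu> \<subseteq> cells \<mu> \<and>
     cells_connected (skew \<mu> \<nu>) \<and> \<not> has_square (skew \<mu> \<nu>)"

definition ribbon_height :: "partition \<Rightarrow> partition \<Rightarrow> nat" where
  "ribbon_height \<mu> \<nu> = card (fst ` skew \<mu> \<nu>) - 1"

definition ribbon_sign :: "partition \<Rightarrow> partition \<Rightarrow> int" where
  "ribbon_sign \<mu> \<nu> = (-1) ^ ribbon_height \<mu> \<nu>"

definition ribbon_tableaux :: "nat \<Rightarrow> nat \<Rightarrow> partition list set" where
  "ribbon_tableaux n l =
     {P. length P = Suc l \<and> P ! 0 = [] \<and>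
         (\<forall>i<l. is_ribbon (P ! Suc i) (P ! i) \<and> skew (P ! Suc i) (P ! i) \<noteq> {}) \<and>
         card (cells (P ! l)) = n}"

definition tableau_sign :: "partition list \<Rightarrow> int" where
  "tableau_sign P = (\<Prod>i<length P - 1. ribbon_sign (P ! Suc i) (P ! i))"


section \<open>Hook involutions\<close>

definition hook :: "nat \<Rightarrow> nat \<Rightarrow> partition" where
  "hook s h = (s - h) # replicate h 1"

definition is_hook :: "partition \<Rightarrow> bool" where
  "is_hook H \<longleftrightarrow> (\<exists>s h. h < s \<and> H = hook s h)"

definition hook_size :: "partition \<Rightarrow> nat" where
  "hook_size H = card (cells H)"

definition hook_height :: "partition \<Rightarrow> nat" where
  "hook_height H = length H - 1"

definition hook_sign :: "partition \<Rightarrow> int" where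
  "hook_sign H = (-1) ^ hook_height H"

text \<open>The \<open>l\<close> positions are numbered from 0 to \<open>l - 1\<close>.\<close>

type_synonym hook_perm = "partition list \<times> (nat \<Rightarrow> nat)"

definition hook_permutations :: "nat \<Rightarrow> nat \<Rightarrow> hook_perm set" where
  "hook_permutations n l =
     {(H, \<sigma>). length H = l \<and> (\<forall>i<l. is_hook (H ! i)) \<and> \<sigma> permutes {..<l} \<and>
              (\<Sum>i<l. hook_size (H ! i)) = n}"

definition hook_involutions :: "nat \<Rightarrow> nat \<Rightarrow> hook_perm set" where
  "hook_involutions n l =
     {(H, \<sigma>) \<in> hook_permutations n l. \<sigma> \<circ> \<sigma> = id \<and> (\<forall>i<l. H ! i = H ! \<sigma> i)}"

definition involution_sign :: "hook_perm \<Rightarrow> int" where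
  "involution_sign = (\<lambda>(H, \<sigma>). \<Prod>i \<in> {i. i < length H \<and> \<sigma> i = i}. hook_sign (H ! i))"


section \<open>Composition of signed bijections: the involution principle\<close>

text \<open>
  For the construction, a signed bijection \<open>(iA, iB, \<phi>)\<close> between \<open>A\<close> and \<open>B\<close> is coded as one
  involution \<open>t\<close> of the disjoint sum: \<open>t\<close> exchanges \<open>Inl a\<close> with \<open>Inr (\<phi> a)\<close> if \<open>a\<close> is a fixed
  point of \<open>iA\<close>, it sends \<open>Inl a\<close> to \<open>Inl (iA a)\<close> for the other \<open>a\<close> in \<open>A\<close>, and it sends
  \<open>Inr b\<close> to \<open>Inr (iB b)\<close> if \<open>b\<close> is not a fixed point of \<open>iB\<close>.
\<close>

type_synonym ('a, 'b) matching = "'a + 'b \<Rightarrow> 'a + 'b"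

partial_function (tailrec) zigzag ::
    "('a, 'b) matching \<Rightarrow> ('b, 'c) matching \<Rightarrow> 'b \<Rightarrow> 'a + 'c" where
  "zigzag t u b =
     (case u (Inl b) of
        Inr c \<Rightarrow> Inr c
      | Inl b' \<Rightarrow>
          (case t (Inr b') of
             Inl a \<Rightarrow> Inl a
           | Inr b'' \<Rightarrow> zigzag t u b''))"

text \<open>
  Garsia and Milne: apply \<open>t\<close> and \<open>u\<close> alternately until the intermediate set is left.
\<close>

fun compose :: "('a, 'b) matching \<Rightarrow> ('b, 'c) matching \<Rightarrow> ('a, 'c) matching" where
  "compose t u (Inl a) =
     (case t (Inl a) of
        Inl a' \<Rightarrow> Inl a'
      | Inr b \<Rightarrow> zigzag t u b)"
| "compose t u (Inr c) =
     (case u (Inr c) of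
        Inr c' \<Rightarrow> Inr c'
      | Inl b \<Rightarrow>
          (case t (Inr b) of
             Inl a \<Rightarrow> Inl a
           | Inr b' \<Rightarrow> zigzag t u b'))"

fun trivial_matching :: "('a, 'a) matching" where
  "trivial_matching (Inl a) = Inr a"
| "trivial_matching (Inr a) = Inl a"


section \<open>Ribbons as bead moves\<close>

text \<open>
  A partition is coded by its infinite set of beads \<open>p\<^sub>i - i\<close>, where \<open>p\<^sub>i = 0\<close> for
  \<open>i \<ge> length p\<close>. Adding a ribbon of size \<open>s\<close> is moving a bead from \<open>x\<close> to the gap \<open>x + s\<close>; the
  height of the ribbon is the number of beads strictly between \<open>x\<close> and \<open>x + s\<close>. The part
  attached to a bead is the number of gaps below it.
\<close>

definition beads :: "partition \<Rightarrow> int set" where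
  "beads p = {int (if i < length p then p ! i else 0) - int i | i. True}"

definition of_beads :: "int set \<Rightarrow> partition" where
  "of_beads S =
     map (\<lambda>x. card {y. y < x \<and> y \<notin> S}) (rev (sorted_list_of_set {x \<in> S. \<exists>y<x. y \<notin> S}))"

definition beads_between :: "int set \<Rightarrow> int \<Rightarrow> int \<Rightarrow> nat" where
  "beads_between S x y = card (S \<inter> {x<..<y})"

text \<open>Lower ends of the ribbons of size \<open>s\<close> and height \<open>h\<close> that can be added, resp. removed.\<close>

definition addable :: "int set \<Rightarrow> nat \<Rightarrow> nat \<Rightarrow> int set" where
  "addable S s h = {x. x \<in> S \<and> x + int s \<notin> S \<and> beads_between S x (x + int s) = h}"

definition removable :: "int set \<Rightarrow> nat \<Rightarrow> nat \<Rightarrow> int set" where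
  "removable S s h = {x. x \<notin> S \<and> x + int s \<in> S \<and> beads_between S x (x + int s) = h}"

definition add_at :: "int set \<Rightarrow> nat \<Rightarrow> int \<Rightarrow> partition" where
  "add_at S s x = of_beads (insert (x + int s) (S - {x}))"

definition remove_at :: "int set \<Rightarrow> nat \<Rightarrow> int \<Rightarrow> partition" where
  "remove_at S s x = of_beads (insert x (S - {x + int s}))"


section \<open>Local rules\<close>

text \<open>
  A cell of the growth diagram has four corners: \<open>\<rho>\<close> (lower left), \<open>\<kappa>\<close> (upper left), \<open>\<nu>\<close>
  (lower right) and \<open>\<mu>\<close> (upper right). Each of \<open>\<kappa>/\<rho>\<close>, \<open>\<nu>/\<rho>\<close>, \<open>\<mu>/\<kappa>\<close>, \<open>\<mu>/\<nu>\<close> is empty or a ribbon,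
  and opposite sides have equal size.
\<close>

text \<open>
  Corners \<open>\<kappa> = \<nu>\<close>. As in Robinson-Schensted, a hook is turned into the topmost addable ribbon
  of the same size and height, and a ribbon removable from \<open>\<kappa>\<close> into the next addable
  ribbon of the same size and height below it. Larger bead positions are higher in the diagram.
\<close>

definition insert_hook :: "partition \<Rightarrow> partition \<Rightarrow> partition" where
  "insert_hook \<kappa> H =
     (let L = beads \<kappa>; s = hook_size H
      in add_at L s (Max (addable L s (hook_height H))))"

definition bump :: "partition \<Rightarrow> partition \<Rightarrow> partition" where
  "bump \<kappa> \<rho> =
     (let L = beads \<kappa>;
          x = the_elem (beads \<rho> - L);
          s = card (skew \<kappa> \<rho>);
          h = ribbon_height \<kappa> \<rho>
      in add_at L s (Max {y \<in> addable L s h. y < x}))"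

text \<open>The inverse rule; \<open>Inl H\<close> means that the hook \<open>H\<close> is put back into the cell.\<close>

definition unbump :: "partition \<Rightarrow> partition \<Rightarrow> partition + partition" where
  "unbump \<kappa> \<mu> =
     (let L = beads \<kappa>;
          x = the_elem (L - beads \<mu>);
          s = card (skew \<mu> \<kappa>);
          h = ribbon_height \<mu> \<kappa>;
          Y = {y \<in> removable L s h. x < y}
      in if Y = {} then Inl (hook s h) else Inr (remove_at L s (Min Y)))"

text \<open>
  Corners \<open>\<kappa> \<noteq> \<nu>\<close>, all sides nonempty: \<open>\<kappa>\<close> is obtained from \<open>\<rho>\<close> by moving a bead from
  \<open>x\<close> to \<open>t\<close>, and \<open>\<nu>\<close> by moving one from \<open>y\<close> to \<open>u\<close>. The result is \<open>Inr \<mu>\<close> if the cell is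
  completed by \<open>\<mu>\<close>, and \<open>Inl \<rho>'\<close> if \<open>\<rho>\<close> is cancelled by another lower left corner \<open>\<rho>'\<close>.
\<close>

definition bead_rule :: "int set \<Rightarrow> int set \<Rightarrow> int set \<Rightarrow> int set + int set" where
  "bead_rule L N R =
     (let x = the_elem (R - L); t = the_elem (L - R);
          y = the_elem (R - N); u = the_elem (N - R)
      in if x \<noteq> y \<and> t \<noteq> u then Inr ((R - {x, y}) \<union> {t, u})
         else if x = y then
           (let w = t + u - x
            in if w \<in> R then Inl ((R - {x, w}) \<union> {t, u}) else Inr (insert w (R - {x})))
         else
           (let z = x + y - t
            in if z \<in> R then Inr (insert t (R - {z})) else Inl ((R - {x, y}) \<union> {z, t})))"

definition commute_up :: "partition \<Rightarrow> partition \<Rightarrow> partition \<Rightarrow> partition + partition" where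
  "commute_up \<kappa> \<nu> \<rho> = map_sum of_beads of_beads (bead_rule (beads \<kappa>) (beads \<nu>) (beads \<rho>))"

text \<open>
  Exchanging beads and gaps exchanges adding and removing ribbons, so that the reverse rule is
  the same rule applied to the complements. Here \<open>Inl \<rho>\<close> is a completion of the cell, and
  \<open>Inr \<mu>'\<close> is the corner cancelling \<open>\<mu>\<close>.
\<close>

definition commute_down :: "partition \<Rightarrow> partition \<Rightarrow> partition \<Rightarrow> partition + partition" where
  "commute_down \<kappa> \<nu> \<mu> =
     (case bead_rule (- beads \<kappa>) (- beads \<nu>) (- beads \<mu>) of
        Inl M \<Rightarrow> Inr (of_beads (- M))
      | Inr R \<Rightarrow> Inl (of_beads (- R)))"


section \<open>Growth diagrams on the half grid\<close>

text \<open>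
  The half grid has the cells \<open>(i, j)\<close> with \<open>i \<le> j < l\<close> (column \<open>i\<close>, row \<open>j\<close>, rows numbered from
  bottom to top). It is swept row by row from the bottom, each row from left to right. A
  configuration consists of the partitions along the border between the treated and the remaining
  cells, read from the upper left corner of the half grid to the diagonal, and of the hooks in
  the remaining cells, in the form of a partial hook involution: there is a hook in cell
  \<open>(i, j)\<close> iff position \<open>i\<close> holds one and \<open>\<sigma> i = j\<close>, and then position \<open>j\<close> holds the same hook.
  A position without hook holds \<open>[]\<close> and is fixed by \<open>\<sigma>\<close>.
\<close>

type_synonym config = "partition list \<times> hook_perm"

definition take_hook :: "nat \<Rightarrow> nat \<Rightarrow> hook_perm \<Rightarrow> hook_perm" where
  "take_hook i j = (\<lambda>(H, \<sigma>). (H[i := [], j := []], \<sigma>(i := i, j := j)))"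

definition put_hook :: "nat \<Rightarrow> nat \<Rightarrow> partition \<Rightarrow> hook_perm \<Rightarrow> hook_perm" where
  "put_hook i j K = (\<lambda>(H, \<sigma>). (H[i := K, j := K], \<sigma>(i := j, j := i)))"

text \<open>
  The parameter \<open>p\<close> is the index of the corner to be replaced in the list of border partitions.
\<close>

fun inner_cell :: "nat \<Rightarrow> nat \<Rightarrow> nat \<Rightarrow> (config, config) matching" where
  "inner_cell p i j (Inl (w, H, \<sigma>)) =
     (let \<kappa> = w ! (p - 1); \<rho> = w ! p; \<nu> = w ! (p + 1)
      in if \<sigma> i = j then Inr (w[p := insert_hook \<kappa> (H ! i)], take_hook i j (H, \<sigma>))
         else if \<rho> = \<kappa> then Inr (w[p := \<nu>], H, \<sigma>)
         else if \<rho> = \<nu> then Inr (w[p := \<kappa>], H, \<sigma>)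
         else if \<kappa> = \<nu> then Inr (w[p := bump \<kappa> \<rho>], H, \<sigma>)
         else map_sum (\<lambda>\<rho>'. (w[p := \<rho>'], H, \<sigma>)) (\<lambda>\<mu>. (w[p := \<mu>], H, \<sigma>)) (commute_up \<kappa> \<nu> \<rho>))"
| "inner_cell p i j (Inr (w, H, \<sigma>)) =
     (let \<kappa> = w ! (p - 1); \<mu> = w ! p; \<nu> = w ! (p + 1)
      in if \<mu> = \<nu> then Inl (w[p := \<kappa>], H, \<sigma>)
         else if \<mu> = \<kappa> then Inl (w[p := \<nu>], H, \<sigma>)
         else if \<kappa> = \<nu> then
           (case unbump \<kappa> \<mu> of
              Inl K \<Rightarrow> Inl (w[p := \<kappa>], put_hook i j K (H, \<sigma>))
            | Inr \<rho> \<Rightarrow> Inl (w[p := \<rho>], H, \<sigma>))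
         else map_sum (\<lambda>\<rho>. (w[p := \<rho>], H, \<sigma>)) (\<lambda>\<mu>'. (w[p := \<mu>'], H, \<sigma>)) (commute_down \<kappa> \<nu> \<mu>))"

text \<open>
  A diagonal cell \<open>(j, j)\<close> is its own mirror image, so that its corner \<open>\<nu>\<close> is equal to \<open>\<kappa>\<close>.
\<close>

fun diagonal_cell :: "nat \<Rightarrow> nat \<Rightarrow> (config, config) matching" where
  "diagonal_cell p j (Inl (w, H, \<sigma>)) =
     (let \<kappa> = w ! (p - 1); \<rho> = w ! p
      in if \<sigma> j = j \<and> H ! j \<noteq> [] then Inr (w[p := insert_hook \<kappa> (H ! j)], take_hook j j (H, \<sigma>))
         else if \<rho> = \<kappa> then Inr (w, H, \<sigma>)
         else Inr (w[p := bump \<kappa> \<rho>], H, \<sigma>))"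
| "diagonal_cell p j (Inr (w, H, \<sigma>)) =
     (let \<kappa> = w ! (p - 1); \<mu> = w ! p
      in if \<mu> = \<kappa> then Inl (w, H, \<sigma>)
         else
           (case unbump \<kappa> \<mu> of
              Inl K \<Rightarrow> Inl (w[p := \<kappa>], put_hook j j K (H, \<sigma>))
            | Inr \<rho> \<Rightarrow> Inl (w[p := \<rho>], H, \<sigma>)))"

definition cell_rule :: "nat \<Rightarrow> nat \<times> nat \<Rightarrow> (config, config) matching" where
  "cell_rule l = (\<lambda>(i, j). if i = j then diagonal_cell l j else inner_cell (l - j + i) i j)"

definition half_grid :: "nat \<Rightarrow> (nat \<times> nat) list" where
  "half_grid l = concat (map (\<lambda>j. map (\<lambda>i. (i, j)) [0..<Suc j]) [0..<l])"

definition growth :: "nat \<Rightarrow> (config, config) matching" where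
  "growth l = foldr (\<lambda>c t. compose (cell_rule l c) t) (half_grid l) trivial_matching"

text \<open>
  At the beginning all border partitions are empty; at the end all hooks are used up and the
  border is the upper side of the half grid, along which the ribbon tableau is read. The
  involutions fix the elements that \<open>growth\<close> matches with the other side; \<open>growth_tableau\<close> has the
  dummy value \<open>[]\<close> outside the fixed points.
\<close>

definition initial_config :: "hook_perm \<Rightarrow> config" where
  "initial_config I = (replicate (Suc (length (fst I))) [], I)"

definition final_config :: "partition list \<Rightarrow> config" where
  "final_config P = (P, replicate (length P - 1) [], id)"

definition growth_involution_hooks :: "nat \<Rightarrow> hook_perm \<Rightarrow> hook_perm" where
  "growth_involution_hooks l I =
     (case growth l (Inl (initial_config I)) of Inl (w, I') \<Rightarrow> I' | Inr _ \<Rightarrow> I)"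

definition growth_involution_tableaux :: "nat \<Rightarrow> partition list \<Rightarrow> partition list" where
  "growth_involution_tableaux l P =
     (case growth l (Inr (final_config P)) of Inl _ \<Rightarrow> P | Inr (P', I) \<Rightarrow> P')"

definition growth_tableau :: "nat \<Rightarrow> hook_perm \<Rightarrow> partition list" where
  "growth_tableau l I =
     (case growth l (Inl (initial_config I)) of Inl _ \<Rightarrow> [] | Inr (P, I') \<Rightarrow> P)"

definition growth_signed_bijection ::
    "nat \<Rightarrow> (hook_perm \<Rightarrow> hook_perm) \<times> (partition list \<Rightarrow> partition list) \<times>
            (hook_perm \<Rightarrow> partition list)" where
  "growth_signed_bijection l =
     (growth_involution_hooks l, growth_involution_tableaux l, growth_tableau l)"

end

theory Submission
  imports Defs
begin

text \<open>
  A signed bijection is coded as an involution of the disjoint sum \<open>A <+> B\<close> that reverses the sign,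
  the sign on \<open>B\<close> being negated. Such involutions compose along a finite intermediate set, so it
  suffices to treat a single cell of the half grid. In terms of beads, adding a ribbon of height
  \<open>h\<close> moves a bead over \<open>h\<close> others. When both neighbours of a corner agree, the removable ribbons
  of given size and height interlace with the addable ones, with one more addable ribbon at the
  top, which takes the hook. When they differ, two bead moves from a common configuration either
  commute or can be exchanged for two moves with the same targets and opposite sign; the downward
  rule is the upward one with beads and gaps exchanged. Fixing the sizes \<open>m i\<close> of the \<open>l\<close> lines
  makes all sets of configurations finite.
\<close>

section \<open>Sign-reversing matchings\<close>

text \<open>Walking back and forth between two matchings need not stop in an infinite set, and the
  set of all configurations is infinite. This is why each line (row \<open>j\<close> together with
  column \<open>j\<close>) gets a prescribed ribbon size. The local rules preserve these sizes
  without consulting them, so the one map \<open>growth l\<close> serves every \<open>m\<close>, and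
  \<open>m\<close> is read off from the hooks or the tableau at hand. The distinction between fixed
  points and 2-cycles in \<open>involution_sign\<close> comes from the mirror symmetry of the grid.
  A hook in an inner cell creates two edges of equal height, whose signs cancel; a hook in a
  diagonal cell creates a single edge, whose sign is that of the hook. Beads turn size and height
  into a distance and a count. The price is that every set produced by a rule must be shown to be
  the bead set of a partition; it always is, being one bead move away from the bead set of a
  neighbouring corner.\<close>

definition sign_matching ::
    "'a set \<Rightarrow> ('a \<Rightarrow> int) \<Rightarrow> 'b set \<Rightarrow> ('b \<Rightarrow> int) \<Rightarrow> ('a, 'b) matching \<Rightarrow> bool" where
  "sign_matching A sA B sB t \<longleftrightarrow>
     (\<forall>z \<in> A <+> B. t z \<in> A <+> B \<and> t (t z) = z \<and>
        case_sum sA (\<lambda>b. - sB b) (t z) = - case_sum sA (\<lambda>b. - sB b) z)"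

lemma sign_matching_trivial: "sign_matching A s A s trivial_matching"
  by (auto simp: sign_matching_def)

text \<open>Derivations are the terminating runs of \<open>zigzag\<close>. Results are proved by
  induction over a run; that runs do end is a separate claim, and the place where finiteness
  enters.\<close>

inductive zigzag_run :: "('a, 'b) matching \<Rightarrow> ('b, 'c) matching \<Rightarrow> 'b \<Rightarrow> 'a + 'c \<Rightarrow> bool"
  for t u where
  exit_right: "u (Inl b) = Inr c \<Longrightarrow> zigzag_run t u b (Inr c)"
| exit_left: "u (Inl b) = Inl b' \<Longrightarrow> t (Inr b') = Inl a \<Longrightarrow> zigzag_run t u b (Inl a)"
| continue: "u (Inl b) = Inl b' \<Longrightarrow> t (Inr b') = Inr b'' \<Longrightarrow> zigzag_run t u b'' r \<Longrightarrow>
    zigzag_run t u b r"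

lemma zigzag_run_eq: "zigzag_run t u b r \<Longrightarrow> zigzag t u b = r"
  by (induction rule: zigzag_run.induct) (subst zigzag.simps, simp)+

context
  fixes A :: "'a set" and B :: "'b set" and C :: "'c set" and sA sB sC t u
  assumes t: "sign_matching A sA B sB t" and u: "sign_matching B sB C sC u"
begin

lemma right_matching_dest:
  "b \<in> B \<Longrightarrow> u (Inl b) = Inl b' \<Longrightarrow> b' \<in> B \<and> u (Inl b') = Inl b \<and> sB b' = - sB b"
  "b \<in> B \<Longrightarrow> u (Inl b) = Inr c \<Longrightarrow> c \<in> C \<and> u (Inr c) = Inl b \<and> sC c = sB b"
  "c \<in> C \<Longrightarrow> u (Inr c) = Inr c' \<Longrightarrow> c' \<in> C \<and> u (Inr c') = Inr c \<and> sC c' = - sC c"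
  "c \<in> C \<Longrightarrow> u (Inr c) = Inl b \<Longrightarrow> b \<in> B \<and> u (Inl b) = Inr c \<and> sC c = sB b"
  using bspec[OF u[unfolded sign_matching_def], OF InlI, of b]
    bspec[OF u[unfolded sign_matching_def], OF InrI, of c] by force+

lemma left_matching_dest:
  "a \<in> A \<Longrightarrow> t (Inl a) = Inl a' \<Longrightarrow> a' \<in> A \<and> t (Inl a') = Inl a \<and> sA a' = - sA a"
  "a \<in> A \<Longrightarrow> t (Inl a) = Inr b \<Longrightarrow> b \<in> B \<and> t (Inr b) = Inl a \<and> sB b = sA a"
  "b \<in> B \<Longrightarrow> t (Inr b) = Inr b' \<Longrightarrow> b' \<in> B \<and> t (Inr b') = Inr b \<and> sB b' = - sB b"
  "b \<in> B \<Longrightarrow> t (Inr b) = Inl a \<Longrightarrow> a \<in> A \<and> t (Inl a) = Inr b \<and> sB b = sA a"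
  using bspec[OF t[unfolded sign_matching_def], OF InlI, of a]
    bspec[OF t[unfolded sign_matching_def], OF InrI, of b] by force+

lemmas matching_dest = right_matching_dest left_matching_dest

text \<open>The walk is reversible: \<open>compose\<close> started at the exit \<open>r\<close>
  retraces it back to \<open>b\<close> and then leaves \<open>b\<close> through \<open>t\<close>,
  which is what the last conjunct records.\<close>

lemma zigzag_run_result:
  assumes "zigzag_run t u b r" and "b \<in> B"
  shows "r \<in> A <+> C \<and> case_sum sA (\<lambda>c. - sC c) r = - sB b \<and>
    compose t u r = (case t (Inr b) of Inl a \<Rightarrow> Inl a | Inr b' \<Rightarrow> zigzag t u b')"
  using assms
proof (induction rule: zigzag_run.induct)
  case (exit_right b c)
  then show ?case using matching_dest(2)[of b c] by auto
next
  case (exit_left b b' a)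
  then have "b' \<in> B" "u (Inl b') = Inl b" "sB b' = - sB b"
    using matching_dest(1)[of b b'] by auto
  moreover from this exit_left have "a \<in> A" "t (Inl a) = Inr b'" "sB b' = sA a"
    using matching_dest(8)[of b' a] by auto
  ultimately show ?case by (auto simp: zigzag.simps[of t u b'])
next
  case (continue b b' b'' r)
  then have b': "b' \<in> B" "u (Inl b') = Inl b" "sB b' = - sB b"
    using matching_dest(1)[of b b'] by auto
  moreover from this continue have "b'' \<in> B" "t (Inr b'') = Inr b'" "sB b'' = - sB b'"
    using matching_dest(7)[of b' b''] by auto
  ultimately show ?case using continue by (auto simp: zigzag.simps[of t u b'])
qed

text \<open>The walk is injective, and its starting point has no predecessor in \<open>B\<close>, so that in a finite
  set it cannot go on forever.\<close>

lemma zigzag_run_exists: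
  assumes "finite B" and b: "b \<in> B"
    and start: "(\<exists>a. t (Inr b) = Inl a) \<or> (\<exists>b' c. t (Inr b) = Inr b' \<and> u (Inl b') = Inr c)"
  shows "\<exists>r. zigzag_run t u b r"
proof (rule ccontr)
  assume no_run: "\<nexists>r. zigzag_run t u b r"
  define stuck where "stuck = {x \<in> B. \<nexists>r. zigzag_run t u x r}"
  \<comment> \<open>One round of the walk, \<open>u\<close> followed by \<open>t\<close>. The
    projections are meaningful on \<open>stuck\<close>, where neither map leaves
    \<open>B\<close>.\<close>
  define g where "g x = projr (t (Inr (projl (u (Inl x)))))" for x
  have step: "\<exists>x'. u (Inl x) = Inl x' \<and> t (Inr x') = Inr (g x) \<and> g x \<in> stuck" if "x \<in> stuck" for x
  proof -
    from that have x: "x \<in> B" "\<And>r. \<not> zigzag_run t u x r" by (auto simp: stuck_def)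
    then obtain x' where x': "u (Inl x) = Inl x'" by (cases "u (Inl x)") (auto intro: exit_right)
    with x obtain x'' where x'': "t (Inr x') = Inr x''"
      by (cases "t (Inr x')") (auto intro: exit_left)
    have "x'' \<in> B" using x x' x'' matching_dest(1)[of x x'] matching_dest(7)[of x' x''] by auto
    then show ?thesis using x x' x'' by (auto simp: g_def stuck_def intro: continue)
  qed
  have "inj_on g stuck"
  proof (rule inj_onI)
    fix x y assume xy: "x \<in> stuck" "y \<in> stuck" "g x = g y"
    then obtain x' y' where "u (Inl x) = Inl x'" "t (Inr x') = Inr (g x)"
      "u (Inl y) = Inl y'" "t (Inr y') = Inr (g x)" using step by metis
    moreover have "x \<in> B" "y \<in> B" using xy by (auto simp: stuck_def)
    ultimately show "x = y" using matching_dest(1,7) by (metis sum.inject)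
  qed
  have b_not: "b \<notin> g ` stuck"
  proof
    assume "b \<in> g ` stuck"
    then obtain x where x: "x \<in> stuck" "b = g x" by blast
    then obtain x' where "x \<in> B" "u (Inl x) = Inl x'" "t (Inr x') = Inr b"
      using step[OF x(1)] by (auto simp: stuck_def)
    then have "t (Inr b) = Inr x'" "u (Inl x') = Inl x" using matching_dest(1,7) by metis+
    then show False using start by auto
  qed
  have orbit: "(g ^^ n) b \<in> stuck" for n
    using b no_run step by (induction n) (auto simp: stuck_def)
  have "(g ^^ i) b \<noteq> (g ^^ (i + Suc k)) b" for i k
  proof (induction i)
    case 0
    show ?case using b_not orbit[of k] by auto
  next
    case (Suc i)
    then show ?case using inj_onD[OF \<open>inj_on g stuck\<close> _ orbit orbit, of i "i + Suc k"] by auto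
  qed
  then have "inj (\<lambda>n. (g ^^ n) b)"
    by (intro linorder_injI) (auto dest!: less_imp_Suc_add)
  moreover have "range (\<lambda>n. (g ^^ n) b) \<subseteq> B" using orbit by (auto simp: stuck_def)
  ultimately show False using \<open>finite B\<close> finite_imageD finite_subset infinite_UNIV_nat by blast
qed

lemma sign_matching_compose:
  assumes "finite B"
  shows "sign_matching A sA C sC (compose t u)"
proof -
  \<comment> \<open>A walk started by \<open>compose\<close> enters at \<open>b\<close> either from
    \<open>A\<close> through \<open>t\<close>, or from \<open>C\<close> through \<open>u\<close> and
    then \<open>t\<close>. The second premise lists these two entrances.\<close>
  have left: "zigzag t u b \<in> A <+> C \<and> case_sum sA (\<lambda>c. - sC c) (zigzag t u b) = - sB b \<and>
      compose t u (zigzag t u b) = (case t (Inr b) of Inl a \<Rightarrow> Inl a | Inr b' \<Rightarrow> zigzag t u b')"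
    if "b \<in> B" "(\<exists>a. t (Inr b) = Inl a) \<or> (\<exists>b' c. t (Inr b) = Inr b' \<and> u (Inl b') = Inr c)" for b
    using zigzag_run_exists[OF assms that] zigzag_run_result[OF _ that(1)] zigzag_run_eq by metis
  show ?thesis unfolding sign_matching_def
  proof
    fix z assume "z \<in> A <+> C"
    then consider a where "z = Inl a" "a \<in> A" | c where "z = Inr c" "c \<in> C" by auto
    then show "compose t u z \<in> A <+> C \<and> compose t u (compose t u z) = z \<and>
        case_sum sA (\<lambda>c. - sC c) (compose t u z) = - case_sum sA (\<lambda>c. - sC c) z"
    proof cases
      case 1
      show ?thesis
      proof (cases "t (Inl a)")
        case (Inl a')
        then show ?thesis using matching_dest(5)[OF 1(2)] 1 by auto
      next
        case (Inr b)
        then have b: "b \<in> B" "t (Inr b) = Inl a" "sB b = sA a"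
          using matching_dest(6)[OF 1(2)] by auto
        then show ?thesis using left[of b] 1 Inr by auto
      qed
    next
      case 2
      show ?thesis
      proof (cases "u (Inr c)")
        case (Inr c')
        then show ?thesis using matching_dest(3)[OF 2(2)] 2 by auto
      next
        case (Inl b)
        then have b: "b \<in> B" "u (Inl b) = Inr c" "sC c = sB b"
          using matching_dest(4)[OF 2(2)] by auto
        show ?thesis
        proof (cases "t (Inr b)")
          case tl: (Inl a)
          then have "a \<in> A" "t (Inl a) = Inr b" "sB b = sA a"
            using matching_dest(8)[of b a] b by auto
          then show ?thesis using 2 Inl b tl by (auto simp: zigzag.simps[of t u b])
        next
          case tr: (Inr b')
          then have b': "b' \<in> B" "t (Inr b') = Inr b" "sB b' = - sB b"
            using matching_dest(7)[OF b(1)] by auto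
          then show ?thesis using left[of b'] 2 Inl b tr by (auto simp: zigzag.simps[of t u b])
        qed
      qed
    qed
  qed
qed

end

section \<open>Beads and ribbons\<close>

definition part :: "partition \<Rightarrow> nat \<Rightarrow> nat" where
  "part p i = (if i < length p then p ! i else 0)"

definition bead :: "partition \<Rightarrow> nat \<Rightarrow> int" where
  "bead p i = int (part p i) - int i"

lemma beads_eq_range: "beads p = range (bead p)"
  by (simp add: beads_def bead_def[abs_def] part_def full_SetCompr_eq)

lemma cells_iff: "(i, j) \<in> cells p \<longleftrightarrow> j < part p i"
  by (auto simp: cells_def part_def)

lemma part_antimono: "is_partition p \<Longrightarrow> i \<le> j \<Longrightarrow> part p j \<le> part p i"
  by (cases "i = j") (auto simp: part_def is_partition_def sorted_wrt_iff_nth_less)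

lemma part_pos_iff: "is_partition p \<Longrightarrow> 0 < part p i \<longleftrightarrow> i < length p"
  by (auto simp: part_def is_partition_def) (metis neq0_conv nth_mem)

lemma bead_strict: "is_partition p \<Longrightarrow> bead p (Suc i) < bead p i"
  using part_antimono[of p i "Suc i"] by (simp add: bead_def)

lemma part_inject:
  assumes "is_partition p" "is_partition q" "part p = part q"
  shows "p = q"
proof -
  have "\<And>i. i < length p \<longleftrightarrow> i < length q" using assms part_pos_iff by metis
  then have "length p = length q" by (metis linorder_neqE_nat less_irrefl)
  moreover have "p ! i = q ! i" if "i < length p" for i
    using fun_cong[OF assms(3), of i] that \<open>length p = length q\<close> by (simp add: part_def)
  ultimately show ?thesis by (simp add: nth_equalityI)
qed

lemma finite_cells: "finite (cells p)"
proof -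
  have "cells p = Sigma {..<length p} (\<lambda>i. {..<p ! i})" by (auto simp: cells_def)
  then show ?thesis by simp
qed

lemma antimono_from_Suc:
  fixes f :: "nat \<Rightarrow> 'a::order"
  assumes "\<And>i. f (Suc i) \<le> f i" and "i \<le> j" shows "f j \<le> f i"
  by (rule lift_Suc_antimono_le[of f, OF assms])

text \<open>Partitions are built later from a function of row lengths; cutting at the first zero row
  leaves a list with positive entries.\<close>

lemma partition_with_parts:
  assumes dec: "\<And>i. b (Suc i) \<le> b i" and zero: "b N = 0"
  shows "\<exists>p. is_partition p \<and> part p = b"
proof -
  define L where "L = (LEAST i. b i = 0)"
  have "b L = 0" unfolding L_def by (rule LeastI[of "\<lambda>i. b i = 0", OF zero])
  then have beyond: "b i = 0" if "L \<le> i" for i using antimono_from_Suc[of b, OF dec that] by simp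
  have below: "b i \<noteq> 0" if "i < L" for i using not_less_Least that unfolding L_def by blast
  have "is_partition (map b [0..<L])"
    using below antimono_from_Suc[of b, OF dec]
    by (fastforce simp: is_partition_def sorted_wrt_iff_nth_less)
  moreover have "part (map b [0..<L]) = b" using beyond by (auto simp: part_def)
  ultimately show ?thesis by blast
qed

lemma strictly_decreasing_iff:
  fixes f :: "nat \<Rightarrow> int"
  assumes "\<And>i. f (Suc i) < f i"
  shows "f i < f j \<longleftrightarrow> j < i"
proof -
  have "f i < f j" if "j < i" for i j
    using lift_Suc_mono_less[of "\<lambda>i. - f i" j i] assms that by simp
  then show ?thesis by (metis less_asym linorder_neqE_nat less_irrefl)
qed

lemma strictly_decreasing_inj:
  fixes f :: "nat \<Rightarrow> int"
  assumes "\<And>i. f (Suc i) < f i"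
  shows "f i = f j \<longleftrightarrow> i = j"
  using strictly_decreasing_iff[of f, OF assms, of i j] strictly_decreasing_iff[of f, OF assms, of j i]
  by (cases i j rule: linorder_cases) auto

text \<open>If the enumerations agree before \<open>i\<close>, then the \<open>i\<close>-th value of
  each is attained by the other at some index \<open>k\<close> with \<open>i \<le> k\<close>, hence
  is at most the \<open>i\<close>-th value of the other.\<close>

lemma strictly_decreasing_range_unique:
  fixes f g :: "nat \<Rightarrow> int"
  assumes f: "\<And>i. f (Suc i) < f i" and g: "\<And>i. g (Suc i) < g i" and "range f = range g"
  shows "f = g"
proof
  fix i show "f i = g i"
  proof (induction i rule: less_induct)
    case (less i)
    have le: "f1 i \<le> g1 i"
      if f1: "\<And>i. f1 (Suc i) < f1 i" and g1: "\<And>i. g1 (Suc i) < g1 i"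
        and "range f1 = range g1" and eq: "\<And>j. j < i \<Longrightarrow> f1 j = g1 j" for f1 g1 :: "nat \<Rightarrow> int"
    proof -
      obtain k where k: "f1 i = g1 k" using \<open>range f1 = range g1\<close> by (metis rangeE rangeI)
      have "\<not> k < i" using eq[of k] k strictly_decreasing_inj[of f1 i k, OF f1] by auto
      then show ?thesis using k strictly_decreasing_iff[of g1 k i, OF g1] by force
    qed
    show ?case using le[of f g] le[of g f] assms less by fastforce
  qed
qed

lemma beads_inject:
  assumes "is_partition p" "is_partition q" "beads p = beads q"
  shows "p = q"
proof -
  have "bead p = bead q"
    using strictly_decreasing_range_unique[of "bead p" "bead q"] bead_strict assms
    by (auto simp: beads_eq_range)
  then have "part p i = part q i" for i by (metis bead_def diff_add_cancel of_nat_eq_iff)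
  then show ?thesis using part_inject assms by blast
qed

text \<open>The empty rows put beads on all positions up to \<open>- length p\<close>, and the
  position after these is a gap. So the beads with a gap below them are those of the nonempty rows,
  and counting the gaps below a bead gives back its row length.\<close>

lemma of_beads_beads:
  assumes p: "is_partition p"
  shows "of_beads (beads p) = p"
proof -
  let ?n = "length p"
  note dec = strictly_decreasing_iff[of "bead p", OF bead_strict[OF p]]
  note inj = strictly_decreasing_inj[of "bead p", OF bead_strict[OF p]]
  have tail: "bead p i = - int i" if "?n \<le> i" for i using that by (simp add: bead_def part_def)
  have low: "1 - int ?n < bead p i" if "i < ?n" for i
  proof -
    have "\<not> bead p i < bead p (?n - 1)" using dec[of i "?n - 1"] that by linarith
    moreover have "0 < part p (?n - 1)" using part_pos_iff[OF p, of "?n - 1"] that by linarith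
    ultimately show ?thesis using that by (simp add: bead_def)
  qed
  \<comment> \<open>The last nonempty row has its bead at \<open>2 - int ?n\<close> or higher,
    whereas the empty rows start at \<open>- int ?n\<close>; the position between them is
    free.\<close>
  have gap: "1 - int ?n \<notin> beads p"
  proof
    assume "1 - int ?n \<in> beads p"
    then obtain k where k: "bead p k = 1 - int ?n" by (auto simp: beads_eq_range)
    then have "?n \<le> k" using low[of k] by linarith
    then show False using k tail[of k] by linarith
  qed
  have "{x \<in> beads p. \<exists>y<x. y \<notin> beads p} = bead p ` {..<?n}"
  proof (intro equalityI subsetI)
    fix x assume "x \<in> {x \<in> beads p. \<exists>y<x. y \<notin> beads p}"
    then obtain i y where i: "x = bead p i" "y < x" "y \<notin> beads p" by (auto simp: beads_eq_range)
    have "i < ?n"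
    proof (rule ccontr)
      assume "\<not> i < ?n"
      then have "y = bead p (nat (- y))" using i tail[of i] tail[of "nat (- y)"] by auto
      then show False using i by (auto simp: beads_eq_range)
    qed
    then show "x \<in> bead p ` {..<?n}" using i by auto
  qed (use low gap in \<open>auto simp: beads_eq_range\<close>)
  moreover have "sorted_list_of_set (bead p ` {..<?n}) = rev (map (bead p) [0..<?n])"
  proof (rule sorted_distinct_set_unique)
    show "sorted (rev (map (bead p) [0..<?n]))"
    proof -
      have "sorted_wrt (\<lambda>x y. y \<le> x) (map (bead p) [0..<?n])"
        by (auto simp: sorted_wrt_iff_nth_less dec less_imp_le)
      then show ?thesis by (simp only: sorted_wrt_rev)
    qed
    show "distinct (rev (map (bead p) [0..<?n]))" by (auto simp: distinct_map inj_on_def inj)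
  qed auto
  moreover have count: "card {y. y < bead p i \<and> y \<notin> beads p} = p ! i" if "i < ?n" for i
  proof -
    \<comment> \<open>Every gap lies above \<open>- int ?n\<close>, and between there and
      \<open>bead p i\<close> the only beads are those of the rows after \<open>i\<close>. The gap
      count is thus a difference of two known cardinalities.\<close>
    have "{y. y < bead p i \<and> y \<notin> beads p} = {- int ?n<..<bead p i} - bead p ` {i<..<?n}"
      (is "?l = ?r")
    proof (intro equalityI subsetI)
      fix y assume y: "y \<in> ?l"
      have "- int ?n < y"
      proof (rule ccontr)
        assume "\<not> - int ?n < y"
        then have "y = bead p (nat (- y))" using tail[of "nat (- y)"] by auto
        then show False using y by (auto simp: beads_eq_range)
      qed
      then show "y \<in> ?r" using y by (auto simp: beads_eq_range)
    next
      fix y assume y: "y \<in> ?r"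
      have "y \<notin> beads p"
      proof
        assume "y \<in> beads p"
        then obtain k where k: "y = bead p k" by (auto simp: beads_eq_range)
        then have "i < k" using y dec[of k i] by auto
        moreover have "k < ?n" using y k tail[of k] by (cases "k < ?n") auto
        ultimately show False using y k by auto
      qed
      then show "y \<in> ?l" using y by auto
    qed
    moreover have "bead p ` {i<..<?n} \<subseteq> {- int ?n<..<bead p i}"
      using low dec by force
    moreover have "card (bead p ` {i<..<?n}) = ?n - Suc i"
      by (subst card_image) (auto simp: inj_on_def inj)
    ultimately have "card {y. y < bead p i \<and> y \<notin> beads p} =
        nat (bead p i + int ?n - 1) - (?n - Suc i)"
      by (simp add: card_Diff_subset)
    also have "bead p i + int ?n - 1 = int (p ! i + (?n - Suc i))"
      using that by (simp add: bead_def part_def of_nat_diff)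
    finally show ?thesis by simp
  qed
  ultimately have "of_beads (beads p) = map (\<lambda>x. card {y. y < x \<and> y \<notin> beads p}) (map (bead p) [0..<?n])"
    by (simp add: of_beads_def)
  also have "\<dots> = p"
    by (rule nth_equalityI) (simp_all add: count)
  finally show ?thesis .
qed

section \<open>Ribbons by rows and by bead moves\<close>

definition bead_move :: "int set \<Rightarrow> nat \<Rightarrow> nat \<Rightarrow> int \<Rightarrow> int set \<Rightarrow> bool" where
  "bead_move S s h x S' \<longleftrightarrow>
     x \<in> S \<and> x + int s \<notin> S \<and> S' = insert (x + int s) (S - {x}) \<and>
     beads_between S x (x + int s) = h"

text \<open>The skew shape occupies rows \<open>r\<close> to \<open>q\<close>, and consecutive rows overlap in exactly one column.\<close>

definition ribbon_rows :: "nat \<Rightarrow> nat \<Rightarrow> (nat \<Rightarrow> nat) \<Rightarrow> (nat \<Rightarrow> nat) \<Rightarrow> bool" where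
  "ribbon_rows r q a b \<longleftrightarrow> r \<le> q \<and> (\<forall>i. i < r \<or> q < i \<longrightarrow> b i = a i) \<and>
     (\<forall>i. r \<le> i \<and> i < q \<longrightarrow> b (Suc i) = Suc (a i)) \<and> a q < b q"

lemma skew_iff: "(i, j) \<in> skew p q \<longleftrightarrow> part q i \<le> j \<and> j < part p i"
  by (auto simp: skew_def cells_iff)

text \<open>Connectedness forces consecutive rows to share a column, and the absence of a square
  forbids a second shared column.\<close>

lemma ribbon_rows_if_ribbon:
  assumes rib: "is_ribbon \<mu> \<nu>" and ne: "skew \<mu> \<nu> \<noteq> {}"
  shows "\<exists>r q. ribbon_rows r q (part \<nu>) (part \<mu>)"
proof -
  let ?S = "skew \<mu> \<nu>"
  let ?E = "{(x, y). x \<in> ?S \<and> y \<in> ?S \<and> share_side x y}"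
  have p: "is_partition \<mu>" "is_partition \<nu>" and sub: "cells \<nu> \<subseteq> cells \<mu>"
    and conn: "cells_connected ?S" and nosq: "\<not> has_square ?S"
    using rib by (auto simp: is_ribbon_def)
  have le: "part \<nu> i \<le> part \<mu> i" for i
    using sub cells_iff[of i _ \<nu>] cells_iff[of i _ \<mu>] by (meson not_le order.refl subsetD)
  let ?R = "fst ` ?S"
  have fin: "finite ?R" using finite_cells by (simp add: skew_def)
  have row: "i \<in> ?R \<longleftrightarrow> part \<nu> i < part \<mu> i" for i
  proof
    show "part \<nu> i < part \<mu> i \<Longrightarrow> i \<in> ?R"
      by (rule image_eqI[of _ _ "(i, part \<nu> i)"]) (auto simp: skew_iff)
  qed (auto simp: skew_iff)
  define r where "r = Min ?R"
  define q where "q = Max ?R"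
  have r: "r \<in> ?R" and q: "q \<in> ?R" using fin ne by (auto simp: r_def q_def)
  have bounds: "r \<le> i \<and> i \<le> q" if "i \<in> ?R" for i using fin that by (simp add: r_def q_def)
  \<comment> \<open>A path that passes from rows up to \<open>i\<close> to rows beyond
    \<open>i\<close> has to step from row \<open>i\<close> to row \<open>Suc i\<close>, and such a
    step stays in its column.\<close>
  have cross: "\<exists>j. (i, j) \<in> ?S \<and> (Suc i, j) \<in> ?S" if "(c, d) \<in> ?E\<^sup>*" "fst c \<le> i" "i < fst d" for c d i
    using that
  proof (induction rule: rtrancl_induct)
    case base
    then show ?case by simp
  next
    case (step y z)
    then show ?case
    proof (cases "i < fst y")
      case False
      with step have "fst y = i" "fst z = Suc i" "snd y = snd z" "y \<in> ?S" "z \<in> ?S"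
        by (auto simp: share_side_def)
      then show ?thesis by (metis prod.collapse)
    qed auto
  qed
  have step: "part \<mu> (Suc i) = Suc (part \<nu> i)" if i: "r \<le> i" "i < q" for i
  proof -
    obtain c d where "c \<in> ?S" "fst c = r" "d \<in> ?S" "fst d = q" using r q by auto
    then obtain j where j: "(i, j) \<in> ?S" "(Suc i, j) \<in> ?S"
      using cross[of c d i] conn i unfolding cells_connected_def by auto
    have "\<not> Suc (Suc (part \<nu> i)) \<le> part \<mu> (Suc i)"
    proof
      assume "Suc (Suc (part \<nu> i)) \<le> part \<mu> (Suc i)"
      then have "{(i, part \<nu> i), (i, Suc (part \<nu> i)), (Suc i, part \<nu> i), (Suc i, Suc (part \<nu> i))} \<subseteq> ?S"
        using part_antimono[OF p(1), of i "Suc i"] part_antimono[OF p(2), of i "Suc i"]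
        by (auto simp: skew_iff)
      then show False using nosq unfolding has_square_def by blast
    qed
    then show ?thesis using j by (auto simp: skew_iff)
  qed
  have "ribbon_rows r q (part \<nu>) (part \<mu>)"
    unfolding ribbon_rows_def
  proof (intro conjI allI impI)
    fix i assume "i < r \<or> q < i"
    then have "i \<notin> ?R" using bounds[of i] by linarith
    then show "part \<mu> i = part \<nu> i" using row[of i] le[of i] by simp
  qed (use bounds[OF q] q row[of q] step in auto)
  then show ?thesis by blast
qed

lemma ribbon_rows_row:
  assumes "is_partition \<mu>" and rr: "ribbon_rows r q (part \<nu>) (part \<mu>)"
  shows "part \<nu> i < part \<mu> i \<longleftrightarrow> r \<le> i \<and> i \<le> q" and "part \<nu> i \<le> part \<mu> i"
proof -
  have inside: "part \<nu> i < part \<mu> i" if "r \<le> i" "i \<le> q"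
    using rr part_antimono[OF assms(1), of i "Suc i"] that
    by (cases "i = q") (auto simp: ribbon_rows_def Suc_le_eq)
  have outside: "part \<nu> i = part \<mu> i" if "\<not> (r \<le> i \<and> i \<le> q)"
    using rr that by (auto simp: ribbon_rows_def)
  show "part \<nu> i < part \<mu> i \<longleftrightarrow> r \<le> i \<and> i \<le> q" "part \<nu> i \<le> part \<mu> i"
    using inside outside by (cases "r \<le> i \<and> i \<le> q"; auto)+
qed

text \<open>For connectedness, every cell is joined to the first cell of row \<open>q\<close>: go
  left to the first cell of the row, then down into the next row, whose last cell is in that column,
  and repeat.\<close>

lemma ribbon_if_ribbon_rows:
  assumes p: "is_partition \<mu>" "is_partition \<nu>" and rr: "ribbon_rows r q (part \<nu>) (part \<mu>)"
  shows "is_ribbon \<mu> \<nu>"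
proof -
  let ?S = "skew \<mu> \<nu>"
  let ?E = "{(x, y). x \<in> ?S \<and> y \<in> ?S \<and> share_side x y}"
  note row = ribbon_rows_row[OF p(1) rr]
  have mem: "(i, j) \<in> ?S \<longleftrightarrow> r \<le> i \<and> i \<le> q \<and> part \<nu> i \<le> j \<and> j < part \<mu> i" for i j
    using row[of i] by (auto simp: skew_iff)
  have next_row: "part \<mu> (Suc i) = Suc (part \<nu> i)" if "r \<le> i" "i < q" for i
    using rr that by (auto simp: ribbon_rows_def)
  have "\<not> has_square ?S"
  proof
    assume "has_square ?S"
    then obtain i j where ij: "(i, j) \<in> ?S" "(Suc i, Suc j) \<in> ?S" by (auto simp: has_square_def)
    then show False using next_row[of i] by (auto simp: mem)
  qed
  moreover have "cells \<nu> \<subseteq> cells \<mu>" using row(2) less_le_trans by (fastforce simp: cells_iff)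
  moreover have "cells_connected ?S"
  proof -
    have "sym ?E" by (auto simp: sym_def share_side_def)
    have left: "((i, j), (i, part \<nu> i)) \<in> ?E\<^sup>*" if "(i, j) \<in> ?S" for i j
      using that
    proof (induction j)
      case 0
      then show ?case by (simp add: mem)
    next
      case (Suc j)
      show ?case
      proof (cases "Suc j = part \<nu> i")
        case False
        then have "(i, j) \<in> ?S" using Suc(2) by (auto simp: mem)
        moreover have "((i, Suc j), (i, j)) \<in> ?E" using Suc(2) calculation by (auto simp: share_side_def)
        ultimately show ?thesis using Suc(1) by (meson converse_rtrancl_into_rtrancl)
      qed auto
    qed
    have down: "((i, part \<nu> i), (q, part \<nu> q)) \<in> ?E\<^sup>*" if "i \<le> q" "r \<le> i" for i
      using that
    proof (induction rule: inc_induct)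
      case (step n)
      have "(n, part \<nu> n) \<in> ?S" using step row(1)[of n] by (simp add: mem)
      moreover have "(Suc n, part \<nu> n) \<in> ?S"
        using step next_row[of n] part_antimono[OF p(2), of n "Suc n"] by (simp add: mem)
      ultimately have "((n, part \<nu> n), (Suc n, part \<nu> n)) \<in> ?E\<^sup>*"
        by (intro r_into_rtrancl) (auto simp: share_side_def)
      also have "((Suc n, part \<nu> n), (Suc n, part \<nu> (Suc n))) \<in> ?E\<^sup>*"
        using left \<open>(Suc n, part \<nu> n) \<in> ?S\<close> by blast
      also have "((Suc n, part \<nu> (Suc n)), (q, part \<nu> q)) \<in> ?E\<^sup>*" using step by simp
      finally show ?case .
    qed simp
    have to_end: "(c, (q, part \<nu> q)) \<in> ?E\<^sup>*" if "c \<in> ?S" for c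
      using left[of "fst c" "snd c"] down[of "fst c"] that mem[of "fst c" "snd c"]
      by (auto intro: rtrancl_trans)
    then show ?thesis unfolding cells_connected_def
      using sym_rtrancl[OF \<open>sym ?E\<close>] by (meson rtrancl_trans symD)
  qed
  ultimately show ?thesis using p by (simp add: is_ribbon_def)
qed

text \<open>An overlap in one column means \<open>bead \<mu> (Suc k) = bead \<nu> k\<close>, so the
  sum of the row lengths telescopes.\<close>

lemma ribbon_rows_statistics:
  assumes p: "is_partition \<mu>" "is_partition \<nu>" and rr: "ribbon_rows r q (part \<nu>) (part \<mu>)"
  shows "ribbon_height \<mu> \<nu> = q - r" and "int (card (skew \<mu> \<nu>)) = bead \<mu> r - bead \<nu> q"
proof -
  note row = ribbon_rows_row[OF p(1) rr]
  have skew: "skew \<mu> \<nu> = Sigma {r..q} (\<lambda>i. {part \<nu> i..<part \<mu> i})"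
  proof (intro equalityI subsetI)
    fix c assume "c \<in> skew \<mu> \<nu>"
    then show "c \<in> Sigma {r..q} (\<lambda>i. {part \<nu> i..<part \<mu> i})"
      using row(1)[of "fst c"] by (cases c) (auto simp: skew_iff)
  qed (auto simp: skew_iff)
  have "fst ` skew \<mu> \<nu> = {r..q}"
  proof
    show "{r..q} \<subseteq> fst ` skew \<mu> \<nu>"
    proof
      fix i assume "i \<in> {r..q}"
      then have "(i, part \<nu> i) \<in> skew \<mu> \<nu>" using row(1)[of i] by (simp add: skew_iff)
      then show "i \<in> fst ` skew \<mu> \<nu>" by force
    qed
  qed (auto simp: skew)
  then show "ribbon_height \<mu> \<nu> = q - r"
    using rr by (simp add: ribbon_height_def ribbon_rows_def)
  have "r \<le> q" using rr by (simp add: ribbon_rows_def)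
  have "(\<Sum>i=r..k. int (part \<mu> i) - int (part \<nu> i)) = bead \<mu> r - bead \<nu> k"
    if "r \<le> k" "k \<le> q" for k
    using that
  proof (induction k rule: dec_induct)
    case base
    show ?case by (simp add: bead_def)
  next
    case (step k)
    then have "part \<mu> (Suc k) = Suc (part \<nu> k)" using rr by (auto simp: ribbon_rows_def)
    with step show ?case by (simp add: bead_def)
  qed
  from this[of q] show "int (card (skew \<mu> \<nu>)) = bead \<mu> r - bead \<nu> q"
    using \<open>r \<le> q\<close> row(2) by (simp add: skew of_nat_diff)
qed

text \<open>Rows \<open>Suc r\<close> to \<open>q\<close> of \<open>\<mu>\<close> carry the beads of
  rows \<open>r\<close> to \<open>q - 1\<close> of \<open>\<nu>\<close>. As a set, only the bead of
  row \<open>q\<close> disappears and the one of the new row \<open>r\<close> appears; the beads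
  jumped over are those of the \<open>q - r\<close> shifted rows.\<close>

lemma bead_move_if_ribbon_rows:
  assumes p: "is_partition \<mu>" "is_partition \<nu>" and rr: "ribbon_rows r q (part \<nu>) (part \<mu>)"
  shows "bead_move (beads \<nu>) (card (skew \<mu> \<nu>)) (ribbon_height \<mu> \<nu>) (bead \<nu> q) (beads \<mu>)"
proof -
  note st = ribbon_rows_statistics[OF p rr]
  note dec = strictly_decreasing_iff[of "bead \<nu>", OF bead_strict[OF p(2)]]
  note inj = strictly_decreasing_inj[of "bead \<nu>", OF bead_strict[OF p(2)]]
  note dec' = strictly_decreasing_iff[of "bead \<mu>", OF bead_strict[OF p(1)]]
  let ?y = "bead \<mu> r"
  have rq: "r \<le> q" using rr by (simp add: ribbon_rows_def)
  have y: "bead \<nu> q + int (card (skew \<mu> \<nu>)) = ?y" using st by simp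
  have same: "bead \<mu> i = bead \<nu> i" if "i < r \<or> q < i" for i
    using rr that by (auto simp: ribbon_rows_def bead_def)
  have shift: "bead \<mu> (Suc i) = bead \<nu> i" if "r \<le> i" "i < q" for i
    using rr that by (auto simp: ribbon_rows_def bead_def)
  have less: "bead \<nu> i < ?y \<longleftrightarrow> r \<le> i" for i
  proof
    assume "bead \<nu> i < ?y"
    then show "r \<le> i" using same[of i] dec'[of r i] by (cases "i < r") auto
  next
    assume "r \<le> i"
    then have "bead \<nu> i \<le> bead \<nu> r" using dec[of r i] 
      using dec[of i r] by (cases "i = r") auto
    also have "bead \<nu> r < ?y" using ribbon_rows_row(1)[OF p(1) rr, of r] rq by (simp add: bead_def)
    finally show "bead \<nu> i < ?y" .
  qed
  have greater: "?y < bead \<nu> i" if "i < r" for i using same[of i] dec'[of r i] that by auto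
  have notin: "?y \<notin> beads \<nu>"
    using less greater by (auto simp: beads_eq_range) (metis less_irrefl not_le)
  have "beads \<mu> = insert ?y (beads \<nu> - {bead \<nu> q})"
  proof (intro equalityI subsetI)
    fix z assume "z \<in> beads \<mu>"
    then obtain i where i: "z = bead \<mu> i" by (auto simp: beads_eq_range)
    consider "i = r" | "i < r \<or> q < i" | "r < i" "i \<le> q" by linarith
    then show "z \<in> insert ?y (beads \<nu> - {bead \<nu> q})"
    proof cases
      case 2
      then show ?thesis using i same[of i] rq by (auto simp: beads_eq_range inj)
    next
      case 3
      then show ?thesis using i shift[of "i - 1"] by (auto simp: beads_eq_range inj)
    qed (simp add: i)
  next
    fix z assume z: "z \<in> insert ?y (beads \<nu> - {bead \<nu> q})"
    show "z \<in> beads \<mu>"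
    proof (cases "z = ?y")
      case False
      then obtain i where i: "z = bead \<nu> i" "i \<noteq> q" using z by (auto simp: beads_eq_range)
      have "z = bead \<mu> i \<or> z = bead \<mu> (Suc i)"
        using i same[of i] shift[of i] by (cases "i < r \<or> q < i") auto
      then show ?thesis by (auto simp: beads_eq_range)
    qed (simp add: beads_eq_range)
  qed
  moreover have "beads \<nu> \<inter> {bead \<nu> q<..<?y} = bead \<nu> ` {r..<q}"
    by (auto simp: beads_eq_range dec less)
  then have "beads_between (beads \<nu>) (bead \<nu> q) ?y = q - r"
    by (simp add: beads_between_def card_image inj_on_def inj)
  moreover have "bead \<nu> q \<in> beads \<nu>" by (simp add: beads_eq_range)
  ultimately show ?thesis using notin by (simp add: bead_move_def y st(1))
qed

lemma bead_less_eventually: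
  assumes "is_partition p" shows "\<exists>i. bead p i < x"
proof -
  have "bead p (length p + nat \<bar>x\<bar> + 1) < x" by (simp add: bead_def part_def)
  then show ?thesis by blast
qed

text \<open>Any bead move starting from a partition is an added ribbon; this is what makes the bead
  rules meaningful for partitions.\<close>

lemma bead_move_up_realizable:
  assumes p: "is_partition \<nu>" and mv: "bead_move (beads \<nu>) s h x S"
  shows "\<exists>\<mu> r q. is_partition \<mu> \<and> beads \<mu> = S \<and> ribbon_rows r q (part \<nu>) (part \<mu>)"
proof -
  note dec = strictly_decreasing_iff[of "bead \<nu>", OF bead_strict[OF p]]
  define y where "y = x + int s"
  obtain q where q: "x = bead \<nu> q" using mv by (auto simp: bead_move_def beads_eq_range)
  have y: "y \<notin> beads \<nu>" using mv by (simp add: bead_move_def y_def)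
  have "s \<noteq> 0" using mv unfolding bead_move_def by (metis add.right_neutral of_nat_0)
  then have xy: "x < y" by (simp add: y_def)
  define r where "r = (LEAST i. bead \<nu> i < y)"
  have r: "bead \<nu> r < y" unfolding r_def by (rule LeastI[of _ q]) (use q xy in simp)
  have rq: "r \<le> q" unfolding r_def by (rule Least_le) (use q xy in simp)
  have above: "y < bead \<nu> i" if "i < r" for i
  proof -
    have "\<not> bead \<nu> i < y" using that not_less_Least unfolding r_def by blast
    moreover have "bead \<nu> i \<noteq> y" using y by (auto simp: beads_eq_range)
    ultimately show ?thesis by simp
  qed
  \<comment> \<open>Row \<open>r\<close> has to get the bead \<open>y\<close>, hence the length
    \<open>y + int r\<close>. The beads of rows \<open>r\<close> to \<open>q - 1\<close> stay in
    place but move to the next row, which lengthens the row by one cell.\<close>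
  define b where "b i = (if i < r \<or> q < i then part \<nu> i else if i = r then nat (y + int r)
    else Suc (part \<nu> (i - 1)))" for i
  have br: "part \<nu> r < b r" "int (b r) = y + int r" using r rq by (auto simp: b_def bead_def)
  have "b (Suc i) \<le> b i" for i
  proof -
    consider "Suc i < r" | "Suc i = r" | "i = r" "i < q" | "i = r" "i = q" | "r < i" "i < q"
      | "r < i" "i = q" | "q < i" using rq by linarith
    then show ?thesis
    proof cases
      case 2
      then show ?thesis using above[of i] br(2) by (simp add: b_def bead_def)
    next
      case 3
      then show ?thesis using br by (simp add: b_def)
    next
      case 4
      then show ?thesis using br part_antimono[OF p, of i "Suc i"] by (simp add: b_def)
    next
      case 6
      then show ?thesis using part_antimono[OF p, of "q - 1" "Suc q"] by (simp add: b_def le_SucI)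
    qed (use rq part_antimono[OF p, of i "Suc i"] part_antimono[OF p, of "i - 1" i] in \<open>auto simp: b_def\<close>)
  qed
  moreover have "b (length \<nu> + q + 1) = 0" using rq by (simp add: b_def part_def)
  ultimately obtain \<mu> where \<mu>: "is_partition \<mu>" "part \<mu> = b" using partition_with_parts by blast
  have rr: "ribbon_rows r q (part \<nu>) (part \<mu>)"
    using rq br part_antimono[OF p, of "q - 1" q] by (auto simp: ribbon_rows_def \<mu>(2) b_def)
  have "bead \<mu> r = y" using br by (simp add: bead_def \<mu>(2))
  then have "beads \<mu> = S"
    using bead_move_if_ribbon_rows[OF \<mu>(1) p rr] ribbon_rows_statistics(2)[OF \<mu>(1) p rr] mv q
    by (simp add: bead_move_def y_def)
  then show ?thesis using \<mu>(1) rr by blast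
qed

text \<open>The mirror image of the upward case: the bead leaves row \<open>r\<close>, the following
  rows slip up by one index, and the bead at \<open>x\<close> becomes the one of row
  \<open>q\<close>.\<close>

lemma bead_move_down_realizable:
  assumes p: "is_partition \<mu>" and mv: "bead_move S s h x (beads \<mu>)"
  shows "\<exists>\<nu> r q. is_partition \<nu> \<and> beads \<nu> = S \<and> ribbon_rows r q (part \<nu>) (part \<mu>)"
proof -
  note dec = strictly_decreasing_iff[of "bead \<mu>", OF bead_strict[OF p]]
  define y where "y = x + int s"
  have "s \<noteq> 0" using mv unfolding bead_move_def by (metis add.right_neutral of_nat_0)
  then have xy: "x < y" by (simp add: y_def)
  have S: "S = insert x (beads \<mu> - {y})" and x: "x \<notin> beads \<mu>"
    using mv xy by (auto simp: bead_move_def y_def)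
  obtain r where r: "y = bead \<mu> r" using mv by (auto simp: bead_move_def y_def beads_eq_range)
  \<comment> \<open>The first row whose bead lies below \<open>x\<close>; the ribbon ends in the row
    before it, which is called \<open>q\<close> below.\<close>
  define Q where "Q = (LEAST i. bead \<mu> i < x)"
  have Q: "bead \<mu> Q < x" unfolding Q_def using bead_less_eventually[OF p] by (rule LeastI_ex)
  then have "r < Q" using dec[of Q r] r xy by auto
  then obtain q where q: "Q = Suc q" "r \<le> q" by (cases Q) auto
  have "\<not> bead \<mu> q < x" using not_less_Least[of q "\<lambda>i. bead \<mu> i < x"] q by (simp add: Q_def[symmetric])
  then have xq: "x < bead \<mu> q" using x by (metis beads_eq_range linorder_neqE_linordered_idom rangeI)
  have xq': "int (part \<mu> (Suc q)) \<le> x + int q" using Q q by (simp add: bead_def)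
  \<comment> \<open>Rows \<open>r\<close> to \<open>q - 1\<close> take over the beads of the rows
    after them, at a smaller index and therefore with one cell less; the bead \<open>x\<close> in
    row \<open>q\<close> means the length \<open>x + int q\<close>.\<close>
  define a where "a i = (if i < r \<or> q < i then part \<mu> i else if i = q then nat (x + int q)
    else part \<mu> (Suc i) - 1)" for i
  have aq: "a q < part \<mu> q" "int (a q) = x + int q" "part \<mu> (Suc q) \<le> a q"
    using xq xq' q by (auto simp: a_def bead_def)
  \<comment> \<open>In particular the rows of \<open>\<mu>\<close> up to \<open>q\<close> are
    nonempty, so the subtraction of 1 in \<open>a\<close> does not truncate.\<close>
  have pos: "a q < part \<mu> i" if "i \<le> q" for i using part_antimono[OF p that] aq by linarith
  have "a (Suc i) \<le> a i" for i
  proof -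
    consider "Suc i < r" | "Suc i = r" "r < q" | "Suc i = r" "r = q" | "r \<le> i" "Suc i < q"
      | "r \<le> i" "Suc i = q" | "r \<le> i" "i = q" | "q < i" using q by linarith
    then show ?thesis
    proof cases
      case 2
      then show ?thesis using part_antimono[OF p, of i "Suc (Suc i)"] by (simp add: a_def)
    next
      case 3
      then show ?thesis using pos[of i] by (simp add: a_def)
    next
      case 4
      then show ?thesis using part_antimono[OF p, of "Suc i" "Suc (Suc i)"] by (simp add: a_def diff_le_mono)
    next
      case 5
      then show ?thesis using pos[of q] by (simp add: a_def)
    next
      case 6
      then show ?thesis using aq by (simp add: a_def)
    qed (use q part_antimono[OF p, of i "Suc i"] in \<open>auto simp: a_def\<close>)
  qed
  moreover have "a (length \<mu> + q + 1) = 0" by (simp add: a_def part_def)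
  ultimately obtain \<nu> where \<nu>: "is_partition \<nu>" "part \<nu> = a" using partition_with_parts by blast
  have "part \<mu> (Suc i) = Suc (a i)" if "r \<le> i" "i < q" for i
    using that pos[of "Suc i"] by (simp add: a_def)
  then have rr: "ribbon_rows r q (part \<nu>) (part \<mu>)"
    using q aq by (auto simp: ribbon_rows_def \<nu>(2)) (auto simp: a_def)
  have "bead \<nu> q = x" using aq by (simp add: bead_def \<nu>(2))
  then have "beads \<nu> = S"
    using bead_move_if_ribbon_rows[OF p \<nu>(1) rr] ribbon_rows_statistics(2)[OF p \<nu>(1) rr] r S x
    by (auto simp: bead_move_def)
  then show ?thesis using \<nu>(1) rr by blast
qed

lemma bead_move_unique:
  assumes "bead_move S s h x S'" "bead_move S s' h' x' S'"
  shows "s = s'" "h = h'" "x = x'"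
proof -
  have "S - T = {y} \<and> T - S = {y + int k}" if "bead_move S k j y T" for T k j y
    using that unfolding bead_move_def by auto
  from this[OF assms(1)] this[OF assms(2)] have "x = x' \<and> x + int s = x' + int s'"
    by (metis singleton_inject)
  then have "x = x' \<and> s = s'" by simp
  then show "s = s'" "h = h'" "x = x'" using assms by (auto simp: bead_move_def)
qed

lemma ribbon_bead_move:
  assumes "is_ribbon \<mu> \<nu>" and "skew \<mu> \<nu> \<noteq> {}"
  obtains x where "bead_move (beads \<nu>) (card (skew \<mu> \<nu>)) (ribbon_height \<mu> \<nu>) x (beads \<mu>)"
proof -
  obtain r q where "ribbon_rows r q (part \<nu>) (part \<mu>)" using ribbon_rows_if_ribbon[OF assms] by blast
  then show ?thesis
    using bead_move_if_ribbon_rows that assms(1) unfolding is_ribbon_def by blast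
qed

lemma bead_move_ribbon:
  assumes "is_partition \<mu>" "is_partition \<nu>" and mv: "bead_move (beads \<nu>) s h x (beads \<mu>)"
  shows "is_ribbon \<mu> \<nu>" "card (skew \<mu> \<nu>) = s" "ribbon_height \<mu> \<nu> = h"
proof -
  obtain \<mu>' r q where "is_partition \<mu>'" "beads \<mu>' = beads \<mu>" and
    rr: "ribbon_rows r q (part \<nu>) (part \<mu>')"
    using bead_move_up_realizable[OF assms(2) mv] by blast
  then have "\<mu>' = \<mu>" using beads_inject assms by blast
  then show "is_ribbon \<mu> \<nu>" "card (skew \<mu> \<nu>) = s" "ribbon_height \<mu> \<nu> = h"
    using ribbon_if_ribbon_rows[OF assms(1,2)] bead_move_if_ribbon_rows[OF assms(1,2)] rr
      bead_move_unique[OF mv] by metis+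
qed

lemma of_beads_move_up:
  assumes "is_partition \<nu>" "bead_move (beads \<nu>) s h x S"
  shows "is_partition (of_beads S)" "beads (of_beads S) = S"
  using bead_move_up_realizable[OF assms] by (auto simp: of_beads_beads)

lemma of_beads_move_down:
  assumes "is_partition \<mu>" "bead_move S s h x (beads \<mu>)"
  shows "is_partition (of_beads S)" "beads (of_beads S) = S"
  using bead_move_down_realizable[OF assms] by (auto simp: of_beads_beads)

definition ribbon_step :: "nat \<Rightarrow> nat \<Rightarrow> partition \<Rightarrow> partition \<Rightarrow> bool" where
  "ribbon_step s h \<nu> \<mu> \<longleftrightarrow> is_partition \<nu> \<and> is_partition \<mu> \<and> (\<exists>x. bead_move (beads \<nu>) s h x (beads \<mu>))"

lemma bead_move_size_pos: "bead_move S s h x S' \<Longrightarrow> 0 < s"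
  unfolding bead_move_def by (cases s) auto

text \<open>Bridge between the two descriptions. Positivity of \<open>s\<close> expresses that the
  ribbon is nonempty, since \<open>is_ribbon\<close> admits the empty skew shape.\<close>

lemma ribbon_step_iff:
  "ribbon_step s h \<nu> \<mu> \<longleftrightarrow>
     is_ribbon \<mu> \<nu> \<and> 0 < s \<and> card (skew \<mu> \<nu>) = s \<and> ribbon_height \<mu> \<nu> = h"
proof
  assume "ribbon_step s h \<nu> \<mu>"
  then show "is_ribbon \<mu> \<nu> \<and> 0 < s \<and> card (skew \<mu> \<nu>) = s \<and> ribbon_height \<mu> \<nu> = h"
    unfolding ribbon_step_def using bead_move_ribbon bead_move_size_pos by blast
next
  assume *: "is_ribbon \<mu> \<nu> \<and> 0 < s \<and> card (skew \<mu> \<nu>) = s \<and> ribbon_height \<mu> \<nu> = h"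
  then have "skew \<mu> \<nu> \<noteq> {}" by auto
  with * show "ribbon_step s h \<nu> \<mu>"
    using ribbon_bead_move[of \<mu> \<nu>] unfolding ribbon_step_def is_ribbon_def by blast
qed

section \<open>Counting beads in intervals\<close>

lemma beads_between_split:
  "x < t \<Longrightarrow> t < w \<Longrightarrow>
     beads_between S x w = beads_between S x t + (if t \<in> S then 1 else 0) + beads_between S t w"
proof -
  assume "x < t" "t < w"
  then have "S \<inter> {x<..<w} = (S \<inter> {x<..<t}) \<union> (S \<inter> {t}) \<union> (S \<inter> {t<..<w})" by auto
  then show ?thesis
    by (simp only: beads_between_def) (subst card_Un_disjoint; auto simp: card_Un_disjoint)
qed

lemma beads_between_insert:
  "beads_between (insert z S) x y = beads_between S x y + (if z \<notin> S \<and> x < z \<and> z < y then 1 else 0)"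
proof (cases "x < z \<and> z < y")
  case True
  then have "insert z S \<inter> {x<..<y} = insert z (S \<inter> {x<..<y})" by auto
  then show ?thesis using True by (simp add: beads_between_def card_insert_if)
next
  case False
  then have "insert z S \<inter> {x<..<y} = S \<inter> {x<..<y}" by auto
  then show ?thesis using False by (simp add: beads_between_def)
qed

lemma beads_between_remove:
  "beads_between S x y = beads_between (S - {z}) x y + (if z \<in> S \<and> x < z \<and> z < y then 1 else 0)"
proof (cases "z \<in> S")
  case True
  then show ?thesis using beads_between_insert[of z "S - {z}" x y] by (simp add: insert_absorb)
qed simp

lemma beads_between_Compl:
  assumes "0 < s"
  shows "beads_between (- S) x (x + int s) + beads_between S x (x + int s) = s - 1"
proof -
  have "card ((- S \<inter> {x<..<x + int s}) \<union> (S \<inter> {x<..<x + int s})) =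
      card (- S \<inter> {x<..<x + int s}) + card (S \<inter> {x<..<x + int s})"
    by (rule card_Un_disjoint) auto
  moreover have "(- S \<inter> {x<..<x + int s}) \<union> (S \<inter> {x<..<x + int s}) = {x<..<x + int s}" by auto
  ultimately show ?thesis using assms by (simp add: beads_between_def)
qed

text \<open>A move changes only the two ends of the open interval in which the height is
  counted.\<close>

lemma bead_move_height_same:
  assumes "bead_move S s h x S'"
  shows "beads_between S' x (x + int s) = h"
  using assms beads_between_remove[of S x "x + int s" x]
  by (auto simp: bead_move_def beads_between_insert)

text \<open>A bead going up is a gap going down. Of the \<open>s - 1\<close> positions strictly
  inside, the \<open>h\<close> beads become gaps and the others become beads.\<close>

lemma bead_move_Compl:
  assumes mv: "bead_move S s h x S'"
  shows "h < s" "bead_move (- S') s (s - 1 - h) x (- S)"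
proof -
  note pos = bead_move_size_pos[OF mv]
  show "h < s"
    using beads_between_Compl[OF pos, of S' x] bead_move_height_same[OF mv] pos by linarith
  show "bead_move (- S') s (s - 1 - h) x (- S)"
    using beads_between_Compl[OF pos, of S' x] bead_move_height_same[OF mv] mv pos
    by (auto simp: bead_move_def)
qed

section \<open>The interlacing of addable and removable ribbons\<close>

definition downs :: "(int \<Rightarrow> bool) \<Rightarrow> int set" where
  "downs P = {x. P x \<and> \<not> P (x + 1)}"

definition ups :: "(int \<Rightarrow> bool) \<Rightarrow> int set" where
  "ups P = {x. \<not> P x \<and> P (x + 1)}"

context
  fixes P :: "int \<Rightarrow> bool" and lo hi :: int
  assumes low: "\<And>x. x \<le> lo \<Longrightarrow> P x" and high: "\<And>x. hi \<le> x \<Longrightarrow> \<not> P x"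
begin

lemma level_crossing:
  fixes Q :: "int \<Rightarrow> bool"
  assumes "a \<le> b" "Q a" "\<not> Q b"
  shows "\<exists>x. a \<le> x \<and> x < b \<and> Q x \<and> \<not> Q (x + 1)"
  using assms
proof (induction b rule: int_ge_induct)
  case (step i)
  then show ?case by (cases "Q i") (force, fastforce)
qed simp

lemma finite_downs: "finite (downs P)" and finite_ups: "finite (ups P)"
proof -
  have "downs P \<subseteq> {lo..hi}" "ups P \<subseteq> {lo..hi}"
    using low high by (auto simp: downs_def ups_def) (smt (verit))+
  then show "finite (downs P)" "finite (ups P)" using finite_subset by blast+
qed

lemma down_below: assumes "P a" "a \<le> b" "\<not> P b" shows "\<exists>d\<in>downs P. a \<le> d \<and> d < b"
  using level_crossing[of a b P] assms by (auto simp: downs_def)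

lemma up_between: assumes "\<not> P a" "a \<le> b" "P b" shows "\<exists>u\<in>ups P. a \<le> u \<and> u < b"
  using level_crossing[of a b "\<lambda>x. \<not> P x"] assms by (auto simp: ups_def)

lemma downs_nonempty: "downs P \<noteq> {}"
  using down_below[of lo "max lo hi"] low high by auto

text \<open>After an upward crossing \<open>P\<close> holds, but it fails far to the right, so a
  downward crossing follows.\<close>

lemma no_up_above_Max: "u \<in> ups P \<Longrightarrow> \<not> Max (downs P) < u"
proof
  assume u: "u \<in> ups P" "Max (downs P) < u"
  obtain d where "d \<in> downs P" "u + 1 \<le> d"
    using down_below[of "u + 1" "max (u + 1) hi"] u(1) high by (auto simp: ups_def)
  then show False using Max_ge[OF finite_downs] u(2) by fastforce
qed

text \<open>Between two downward crossings there is an upward one, so only the last downward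
  crossing has none above it.\<close>

lemma top_down:
  assumes "d \<in> downs P" "{u \<in> ups P. d < u} = {}" shows "Max (downs P) = d"
proof (rule Max_eqI[OF finite_downs _ assms(1)])
  fix d' assume d': "d' \<in> downs P"
  show "d' \<le> d"
  proof (rule ccontr)
    assume "\<not> d' \<le> d"
    then obtain u where "u \<in> ups P" "d + 1 \<le> u"
      using up_between[of "d + 1" d'] d' assms(1) by (auto simp: downs_def)
    then show False using assms(2) by auto
  qed
qed

text \<open>Pairing an upward crossing with the last downward one below it is reversible: another
  upward crossing in between would be followed by yet another downward one before
  \<open>u\<close>.\<close>

lemma down_below_up:
  assumes "u \<in> ups P"
  shows "{d \<in> downs P. d < u} \<noteq> {}" and "{u' \<in> ups P. Max {d \<in> downs P. d < u} < u'} \<noteq> {}"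
    and "Min {u' \<in> ups P. Max {d \<in> downs P. d < u} < u'} = u"
proof -
  let ?D = "{d \<in> downs P. d < u}"
  have fin: "finite ?D" using finite_downs by simp
  show ne: "?D \<noteq> {}"
    \<comment> \<open>\<open>P\<close> holds at \<open>min lo u\<close>, a point not above
      \<open>u\<close>.\<close>
    using down_below[of "min lo u" u] assms low by (auto simp: ups_def)
  have Max: "Max ?D \<in> ?D" using Max_in[OF fin ne] .
  then show "{u' \<in> ups P. Max ?D < u'} \<noteq> {}" using assms by blast
  show "Min {u' \<in> ups P. Max ?D < u'} = u"
  proof (rule Min_eqI)
    fix u' assume u': "u' \<in> {u' \<in> ups P. Max ?D < u'}"
    show "u \<le> u'"
    proof (rule ccontr)
      assume "\<not> u \<le> u'"
      then obtain d where "d \<in> downs P" "u' + 1 \<le> d" "d < u"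
        using down_below[of "u' + 1" u] u' assms by (auto simp: ups_def)
      then have "d \<le> Max ?D" using fin by auto
      then show False using u' \<open>u' + 1 \<le> d\<close> by auto
    qed
  qed (use Max assms finite_ups in auto)
qed

text \<open>The same pairing read from the side of the downward crossings; only the topmost one is
  left without partner.\<close>

lemma up_above_down:
  assumes "d \<in> downs P" "{u \<in> ups P. d < u} \<noteq> {}"
  shows "Min {u \<in> ups P. d < u} \<in> {u \<in> ups P. d < u}"
    and "Max {d' \<in> downs P. d' < Min {u \<in> ups P. d < u}} = d"
proof -
  let ?U = "{u \<in> ups P. d < u}"
  have fin: "finite ?U" using finite_ups by simp
  show Min: "Min ?U \<in> ?U" using Min_in[OF fin assms(2)] .
  show "Max {d' \<in> downs P. d' < Min ?U} = d"
  proof (rule Max_eqI)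
    fix d' assume d': "d' \<in> {d' \<in> downs P. d' < Min ?U}"
    show "d' \<le> d"
    proof (rule ccontr)
      assume "\<not> d' \<le> d"
      then obtain u where "u \<in> ups P" "d + 1 \<le> u" "u < d'"
        using up_between[of "d + 1" d'] d' assms(1) by (auto simp: downs_def)
      then have "Min ?U \<le> u" using fin by auto
      then show False using d' \<open>u < d'\<close> by auto
    qed
  qed (use Min assms finite_downs in auto)
qed

end

section \<open>Window counts and the insertion rules\<close>

definition window :: "int set \<Rightarrow> nat \<Rightarrow> int \<Rightarrow> nat" where
  "window S s x = card (S \<inter> {x..<x + int s})"

text \<open>The windows starting at \<open>x\<close> and \<open>x + 1\<close> share the positions
  strictly between \<open>x\<close> and \<open>x + int s\<close>. They differ by these two ends, so
  the count drops exactly when a bead at \<open>x\<close> faces a gap at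
  \<open>x + int s\<close>.\<close>

lemma window_eq:
  assumes "0 < s"
  shows "window S s x = beads_between S x (x + int s) + (if x \<in> S then 1 else 0)"
    and "window S s (x + 1) = beads_between S x (x + int s) + (if x + int s \<in> S then 1 else 0)"
proof -
  have "{x..<x + int s} = insert x {x<..<x + int s}" using assms by auto
  then show "window S s x = beads_between S x (x + int s) + (if x \<in> S then 1 else 0)"
    by (simp add: window_def beads_between_def)
  have "{x + 1..<x + 1 + int s} = insert (x + int s) {x<..<x + int s}" using assms by auto
  then show "window S s (x + 1) = beads_between S x (x + int s) + (if x + int s \<in> S then 1 else 0)"
    by (simp add: window_def beads_between_def)
qed

text \<open>As \<open>x\<close> increases, the number of beads in a window of length \<open>s\<close> starting at \<open>x\<close> falls from
  \<open>s\<close> to \<open>0\<close> in steps of at most one; addable and removable ribbons of height \<open>h\<close> are the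
  places where it crosses the level between \<open>h\<close> and \<open>h + 1\<close> downwards and upwards.\<close>

lemma addable_eq_downs:
  "0 < s \<Longrightarrow> addable S s h = downs (\<lambda>x. h < window S s x)"
  unfolding addable_def downs_def using window_eq[of s S] by (intro Collect_cong) auto

lemma removable_eq_ups:
  "0 < s \<Longrightarrow> removable S s h = ups (\<lambda>x. h < window S s x)"
  unfolding removable_def ups_def using window_eq[of s S] by (intro Collect_cong) auto

lemma window_bounds:
  assumes "is_partition p"
  shows "x \<le> - int (length p) - int s \<Longrightarrow> window (beads p) s x = s"
    and "bead p 0 < x \<Longrightarrow> window (beads p) s x = 0"
proof -
  have "y \<in> beads p" if "y \<le> - int (length p)" for y
  proof -
    have "length p \<le> nat (- y)" using that by simp
    then have "y = bead p (nat (- y))" using that by (simp add: bead_def part_def)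
    then show ?thesis by (simp add: beads_eq_range)
  qed
  then show "window (beads p) s x = s" if "x \<le> - int (length p) - int s"
    using that by (auto simp: window_def Int_absorb1 subset_iff)
  have "y \<le> bead p 0" if "y \<in> beads p" for y
    using that part_antimono[OF assms, of 0] by (auto simp: beads_eq_range bead_def) (smt (verit) le0 of_nat_0_le_iff of_nat_mono)
  then show "window (beads p) s x = 0" if "bead p 0 < x"
    using that by (force simp: window_def)
qed

context
  fixes \<kappa> :: partition and s h :: nat
  assumes \<kappa>: "is_partition \<kappa>" and hs: "h < s"
begin

private lemma pos: "0 < s" using hs by simp

private lemma low: "x \<le> - int (length \<kappa>) - int s \<Longrightarrow> h < window (beads \<kappa>) s x"
  using window_bounds(1)[OF \<kappa>] hs by simp

private lemma high: "bead \<kappa> 0 + 1 \<le> x \<Longrightarrow> \<not> h < window (beads \<kappa>) s x"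
  using window_bounds(2)[OF \<kappa>] by simp

private abbreviation (input) "P \<equiv> \<lambda>x. h < window (beads \<kappa>) s x"

text \<open>The third and fourth claims single out the topmost addable ribbon as the one with no
  removable ribbon above it. The fifth to seventh, and the last two, are the two directions of the
  pairing between a removable ribbon and the next addable one below it.\<close>

lemma addable_removable_interlace:
  shows "addable (beads \<kappa>) s h \<noteq> {}" and "finite (addable (beads \<kappa>) s h)"
    and "u \<in> removable (beads \<kappa>) s h \<Longrightarrow> \<not> Max (addable (beads \<kappa>) s h) < u"
    and "d \<in> addable (beads \<kappa>) s h \<Longrightarrow> {u \<in> removable (beads \<kappa>) s h. d < u} = {} \<Longrightarrow>
      Max (addable (beads \<kappa>) s h) = d"
    and "u \<in> removable (beads \<kappa>) s h \<Longrightarrow> {d \<in> addable (beads \<kappa>) s h. d < u} \<noteq> {}"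
    and "u \<in> removable (beads \<kappa>) s h \<Longrightarrow>
      {u' \<in> removable (beads \<kappa>) s h. Max {d \<in> addable (beads \<kappa>) s h. d < u} < u'} \<noteq> {}"
    and "u \<in> removable (beads \<kappa>) s h \<Longrightarrow>
      Min {u' \<in> removable (beads \<kappa>) s h. Max {d \<in> addable (beads \<kappa>) s h. d < u} < u'} = u"
    and "d \<in> addable (beads \<kappa>) s h \<Longrightarrow> {u \<in> removable (beads \<kappa>) s h. d < u} \<noteq> {} \<Longrightarrow>
      Min {u \<in> removable (beads \<kappa>) s h. d < u} \<in> {u \<in> removable (beads \<kappa>) s h. d < u}"
    and "d \<in> addable (beads \<kappa>) s h \<Longrightarrow> {u \<in> removable (beads \<kappa>) s h. d < u} \<noteq> {} \<Longrightarrow>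
      Max {d' \<in> addable (beads \<kappa>) s h. d' < Min {u \<in> removable (beads \<kappa>) s h. d < u}} = d"
  unfolding addable_eq_downs[OF pos] removable_eq_ups[OF pos]
  by (rule downs_nonempty[of _ P, OF low high] finite_downs[of _ P, OF low high]
    no_up_above_Max[of _ P, OF low high] top_down[of _ P, OF low high]
    down_below_up[of _ P, OF low high] up_above_down[of _ P, OF low high]; assumption)+

private lemma addable_move:
  assumes "y \<in> addable (beads \<kappa>) s h"
  shows "ribbon_step s h \<kappa> (add_at (beads \<kappa>) s y)"
    and "the_elem (beads \<kappa> - beads (add_at (beads \<kappa>) s y)) = y"
proof -
  let ?S = "insert (y + int s) (beads \<kappa> - {y})"
  have mv: "bead_move (beads \<kappa>) s h y ?S" using assms by (auto simp: addable_def bead_move_def)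
  show "ribbon_step s h \<kappa> (add_at (beads \<kappa>) s y)"
    using of_beads_move_up[OF \<kappa> mv] mv \<kappa> unfolding ribbon_step_def add_at_def by metis
  have "beads \<kappa> - ?S = {y}" using mv pos by (auto simp: bead_move_def)
  then show "the_elem (beads \<kappa> - beads (add_at (beads \<kappa>) s y)) = y"
    using of_beads_move_up(2)[OF \<kappa> mv] by (simp add: add_at_def)
qed

private lemma removable_move:
  assumes "x \<in> removable (beads \<kappa>) s h"
  shows "ribbon_step s h (remove_at (beads \<kappa>) s x) \<kappa>"
    and "the_elem (beads (remove_at (beads \<kappa>) s x) - beads \<kappa>) = x"
proof -
  let ?S = "insert x (beads \<kappa> - {x + int s})"
  have x: "x \<notin> beads \<kappa>" "x + int s \<in> beads \<kappa>" "beads_between (beads \<kappa>) x (x + int s) = h"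
    using assms by (auto simp: removable_def)
  have "beads_between ?S x (x + int s) = h"
    using x(3) beads_between_remove[of "beads \<kappa>" x "x + int s" "x + int s"]
    by (simp add: beads_between_insert)
  then have mv: "bead_move ?S s h x (beads \<kappa>)" using x pos by (auto simp: bead_move_def)
  show "ribbon_step s h (remove_at (beads \<kappa>) s x) \<kappa>"
    using of_beads_move_down[OF \<kappa> mv] mv \<kappa> unfolding ribbon_step_def remove_at_def by metis
  have "?S - beads \<kappa> = {x}" using x by auto
  then show "the_elem (beads (remove_at (beads \<kappa>) s x) - beads \<kappa>) = x"
    using of_beads_move_down(2)[OF \<kappa> mv] by (simp add: remove_at_def)
qed

private lemma step_addable:
  assumes "ribbon_step s h \<kappa> \<mu>"
  shows "\<exists>y \<in> addable (beads \<kappa>) s h. \<mu> = add_at (beads \<kappa>) s y"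
proof -
  obtain y where y: "bead_move (beads \<kappa>) s h y (beads \<mu>)" "is_partition \<mu>"
    using assms by (auto simp: ribbon_step_def)
  then have "y \<in> addable (beads \<kappa>) s h" "add_at (beads \<kappa>) s y = of_beads (beads \<mu>)"
    by (auto simp: bead_move_def addable_def add_at_def)
  then show ?thesis using of_beads_beads y by auto
qed

private lemma step_removable:
  assumes "ribbon_step s h \<rho> \<kappa>"
  shows "\<exists>x \<in> removable (beads \<kappa>) s h. \<rho> = remove_at (beads \<kappa>) s x"
proof -
  obtain x where x: "bead_move (beads \<rho>) s h x (beads \<kappa>)" "is_partition \<rho>"
    using assms by (auto simp: ribbon_step_def)
  then have *: "x \<in> beads \<rho>" "x + int s \<notin> beads \<rho>"
    "beads \<kappa> = insert (x + int s) (beads \<rho> - {x})" by (auto simp: bead_move_def)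
  then have "insert x (beads \<kappa> - {x + int s}) = beads \<rho>" by auto
  moreover have "x \<in> removable (beads \<kappa>) s h"
    using * bead_move_height_same[OF x(1)] pos by (auto simp: removable_def)
  ultimately show ?thesis
    using of_beads_beads[OF x(2)] unfolding remove_at_def by (metis (no_types))
qed

private lemma step_statistics:
  assumes "ribbon_step s h \<nu> \<mu>" shows "card (skew \<mu> \<nu>) = s" "ribbon_height \<mu> \<nu> = h"
  using assms by (simp_all add: ribbon_step_iff)

lemma hook_statistics:
  "is_hook (hook s h)" "hook_size (hook s h) = s" "hook_height (hook s h) = h"
proof -
  have "cells p = Sigma {..<length p} (\<lambda>i. {..<p ! i})" for p by (auto simp: cells_def)
  then have "card (cells p) = sum_list p" for p
    by (simp add: sum_list_sum_nth atLeast0LessThan)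
  then show "hook_size (hook s h) = s" using hs by (simp add: hook_size_def hook_def sum_list_replicate)
  show "is_hook (hook s h)" using hs by (auto simp: is_hook_def)
qed (simp add: hook_height_def hook_def)

lemma unbump_add_at:
  assumes "y \<in> addable (beads \<kappa>) s h"
  shows "unbump \<kappa> (add_at (beads \<kappa>) s y) =
    (let Y = {u \<in> removable (beads \<kappa>) s h. y < u}
     in if Y = {} then Inl (hook s h) else Inr (remove_at (beads \<kappa>) s (Min Y)))"
  using addable_move[OF assms] step_statistics[OF addable_move(1)[OF assms]]
  by (simp add: unbump_def Let_def)

lemma bump_remove_at:
  assumes "x \<in> removable (beads \<kappa>) s h"
  shows "bump \<kappa> (remove_at (beads \<kappa>) s x) =
    add_at (beads \<kappa>) s (Max {y \<in> addable (beads \<kappa>) s h. y < x})"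
  using removable_move[OF assms] step_statistics[OF removable_move(1)[OF assms]]
  by (simp add: bump_def Let_def)

text \<open>No removable ribbon of this size and height lies above the topmost addable one, and this
  is how the inverse rule recognises that a hook was inserted.\<close>

lemma insert_hook_step:
  "ribbon_step s h \<kappa> (insert_hook \<kappa> (hook s h))"
  "unbump \<kappa> (insert_hook \<kappa> (hook s h)) = Inl (hook s h)"
proof -
  let ?M = "Max (addable (beads \<kappa>) s h)"
  have eq: "insert_hook \<kappa> (hook s h) = add_at (beads \<kappa>) s ?M"
    by (simp add: insert_hook_def hook_statistics Let_def)
  have M: "?M \<in> addable (beads \<kappa>) s h"
    using Max_in addable_removable_interlace(1,2) by blast
  show "ribbon_step s h \<kappa> (insert_hook \<kappa> (hook s h))" using addable_move[OF M] eq by simp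
  show "unbump \<kappa> (insert_hook \<kappa> (hook s h)) = Inl (hook s h)"
    using unbump_add_at[OF M] eq addable_removable_interlace(3) by (auto simp: Let_def)
qed

text \<open>The ribbon from \<open>\<rho>\<close> to \<open>\<kappa>\<close> is removable from
  \<open>\<kappa>\<close>, and its partner in the pairing is added; size and height are
  kept.\<close>

lemma bump_step:
  assumes "ribbon_step s h \<rho> \<kappa>"
  shows "ribbon_step s h \<kappa> (bump \<kappa> \<rho>)" "unbump \<kappa> (bump \<kappa> \<rho>) = Inr \<rho>"
proof -
  obtain x where x: "x \<in> removable (beads \<kappa>) s h" "\<rho> = remove_at (beads \<kappa>) s x"
    using step_removable[OF assms] by blast
  let ?D = "{y \<in> addable (beads \<kappa>) s h. y < x}"
  have "Max ?D \<in> ?D" using addable_removable_interlace(2,5) x(1) by (intro Max_in) auto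
  then have D: "Max ?D \<in> addable (beads \<kappa>) s h" by blast
  show "ribbon_step s h \<kappa> (bump \<kappa> \<rho>)" using addable_move[OF D] bump_remove_at x by simp
  show "unbump \<kappa> (bump \<kappa> \<rho>) = Inr \<rho>"
    using unbump_add_at[OF D] bump_remove_at x addable_removable_interlace(6,7)[OF x(1)]
    by (simp add: Let_def)
qed

lemma unbump_step:
  assumes "ribbon_step s h \<kappa> \<mu>"
  shows "unbump \<kappa> \<mu> = Inl K \<Longrightarrow> K = hook s h \<and> insert_hook \<kappa> K = \<mu>"
    and "unbump \<kappa> \<mu> = Inr \<rho> \<Longrightarrow> ribbon_step s h \<rho> \<kappa> \<and> bump \<kappa> \<rho> = \<mu>"
proof -
  obtain y where y: "y \<in> addable (beads \<kappa>) s h" "\<mu> = add_at (beads \<kappa>) s y"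
    using step_addable[OF assms] by blast
  let ?Y = "{u \<in> removable (beads \<kappa>) s h. y < u}"
  note ub = unbump_add_at[OF y(1), unfolded Let_def]
  show "K = hook s h \<and> insert_hook \<kappa> K = \<mu>" if "unbump \<kappa> \<mu> = Inl K"
  proof -
    have "?Y = {}" "K = hook s h" using ub that y(2) by (auto split: if_splits)
    then show ?thesis
      using addable_removable_interlace(4)[OF y(1)] y(2)
      by (simp add: insert_hook_def hook_statistics Let_def)
  qed
  show "ribbon_step s h \<rho> \<kappa> \<and> bump \<kappa> \<rho> = \<mu>" if "unbump \<kappa> \<mu> = Inr \<rho>"
  proof -
    have Y: "?Y \<noteq> {}" and \<rho>: "\<rho> = remove_at (beads \<kappa>) s (Min ?Y)"
      using ub that y(2) by (auto split: if_splits)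
    have "Min ?Y \<in> removable (beads \<kappa>) s h"
      using addable_removable_interlace(8)[OF y(1) Y] by blast
    then show ?thesis
      using removable_move(1) bump_remove_at addable_removable_interlace(9)[OF y(1) Y] \<rho> y(2)
      by simp
  qed
qed

end

section \<open>The bead rule\<close>

lemma bead_rule_eq:
  assumes "x \<in> R" "t \<notin> R" "y \<in> R" "u \<notin> R"
    "L = insert t (R - {x})" "N = insert u (R - {y})"
  shows "bead_rule L N R =
    (if x \<noteq> y \<and> t \<noteq> u then Inr ((R - {x, y}) \<union> {t, u})
     else if x = y then
       (if t + u - x \<in> R then Inl ((R - {x, t + u - x}) \<union> {t, u})
        else Inr (insert (t + u - x) (R - {x})))
     else
       (if x + y - t \<in> R then Inr (insert t (R - {x + y - t}))
        else Inl ((R - {x, y}) \<union> {x + y - t, t})))"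
proof -
  have "R - L = {x}" "L - R = {t}" "R - N = {y}" "N - R = {u}" using assms by auto
  then show ?thesis by (simp add: bead_rule_def Let_def)
qed

lemma bead_moveI:
  assumes "x \<in> S" "t \<notin> S" "t = x + int s" "S' = insert t (S - {x})"
  shows "bead_move S s (beads_between S x t) x S'"
  using assms by (simp add: bead_move_def)

text \<open>There are two obstructed situations, and the rule exchanges them: moves from a common
  bead whose joint target is occupied, and moves to a common target whose joint source is a gap. The
  ends of the moves seen from \<open>L\<close> and \<open>N\<close> change, but not their
  sizes.\<close>

lemma bead_rule_Inl:
  assumes L: "bead_move R a h x L" and N: "bead_move R b k y N" and "L \<noteq> N"
    and rule: "bead_rule L N R = Inl R'"
  shows "\<exists>h' k' x' y'. bead_move R' a h' x' L \<and> bead_move R' b k' y' N \<and>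
    (even (h' + k') \<longleftrightarrow> odd (h + k)) \<and> bead_rule L N R' = Inl R"
proof -
  define t u where "t = x + int a" and "u = y + int b"
  have xt: "x < t" "y < u" using bead_move_size_pos[OF L] bead_move_size_pos[OF N] by (auto simp: t_def u_def)
  have mem: "x \<in> R" "t \<notin> R" "y \<in> R" "u \<notin> R" and LN: "L = insert t (R - {x})" "N = insert u (R - {y})"
    and hk: "h = beads_between R x t" "k = beads_between R y u"
    using L N by (auto simp: bead_move_def t_def u_def)
  note eq = bead_rule_eq[OF mem LN]
  show ?thesis
  proof (cases "x = y")
    case True
    then have "t \<noteq> u" using LN \<open>L \<noteq> N\<close> by auto
    \<comment> \<open>Performing one move after the other would carry the bead \<open>x\<close> to
      \<open>w\<close>. As \<open>w\<close> is occupied, the beads \<open>x\<close> and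
      \<open>w\<close> are replaced by \<open>t\<close> and \<open>u\<close>, which can both move to
      \<open>w\<close>.\<close>
    define w where "w = t + u - x"
    have w: "w \<in> R" "R' = insert t (insert u (R - {x} - {w}))"
      using eq rule True \<open>t \<noteq> u\<close> by (auto simp: w_def split: if_splits)
    have less: "x < t" "x < u" "t < w" "u < w" using xt True by (auto simp: w_def)
    have mem': "u \<in> R'" "w \<notin> R'" "t \<in> R'" "w \<notin> R'"
      and LN': "L = insert w (R' - {u})" "N = insert w (R' - {t})"
      using w less mem LN True \<open>t \<noteq> u\<close> by auto
    have "bead_rule L N R' = Inl ((R' - {u, t}) \<union> {u + t - w, w})"
      using bead_rule_eq[OF mem' LN'] less mem w(2) \<open>t \<noteq> u\<close> by (simp add: w_def)
    also have "(R' - {u, t}) \<union> {u + t - w, w} = R" using w mem less True by (auto simp: w_def)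
    finally have inv: "bead_rule L N R' = Inl R" .
    have "bead_move R' a (beads_between R' u w) u L" "bead_move R' b (beads_between R' t w) t N"
      using bead_moveI[OF mem'(1,2) _ LN'(1), of a] bead_moveI[OF mem'(3,4) _ LN'(2), of b] True
      by (auto simp: w_def t_def u_def)
    \<comment> \<open>Both height sums have the parity of the number of beads of \<open>R\<close>
      between \<open>t\<close> and \<open>u\<close>, except that in \<open>R'\<close> the longer
      move also jumps over the new bead at the start of the shorter one.\<close>
    moreover have "even (beads_between R' u w + beads_between R' t w) \<longleftrightarrow> odd (h + k)"
    proof (cases "t < u")
      case True
      have "beads_between R' u w = beads_between R u w"
        using less True beads_between_remove[of R u w x] beads_between_remove[of "R - {x}" u w w]
        by (simp add: w(2) beads_between_insert)
      moreover have "beads_between R' t w = beads_between R t w + 1"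
        using less True mem beads_between_remove[of R t w x] beads_between_remove[of "R - {x}" t w w]
        by (simp add: w(2) beads_between_insert)
      moreover have "beads_between R t w = beads_between R t u + beads_between R u w"
        using beads_between_split[of t u w R] less True mem by simp
      moreover have "k = beads_between R x t + beads_between R t u"
        using beads_between_split[of x t u R] less True mem hk \<open>x = y\<close> by simp
      ultimately show ?thesis using hk by simp presburger
    next
      case False
      then have "u < t" using \<open>t \<noteq> u\<close> by simp
      have "beads_between R' t w = beads_between R t w"
        using less \<open>u < t\<close> beads_between_remove[of R t w x] beads_between_remove[of "R - {x}" t w w]
        by (simp add: w(2) beads_between_insert)
      moreover have "beads_between R' u w = beads_between R u w + 1"
        using less \<open>u < t\<close> mem beads_between_remove[of R u w x] beads_between_remove[of "R - {x}" u w w]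
        by (simp add: w(2) beads_between_insert)
      moreover have "beads_between R u w = beads_between R u t + beads_between R t w"
        using beads_between_split[of u t w R] less \<open>u < t\<close> mem by simp
      moreover have "h = beads_between R x u + beads_between R u t"
        using beads_between_split[of x u t R] less \<open>u < t\<close> mem hk \<open>x = y\<close> by simp
      ultimately show ?thesis using hk \<open>x = y\<close> by simp presburger
    qed
    ultimately show ?thesis using inv by blast
  next
    case False
    \<comment> \<open>The place from which a bead could reach \<open>t\<close> by both moves in
      succession, via \<open>x\<close> or via \<open>y\<close>. It is a gap, so the two beads at
      \<open>x\<close> and \<open>y\<close> are replaced by one at \<open>z\<close>, which can move
      to either, and one at \<open>t\<close>.\<close>
    define z where "z = x + y - t"
    have tu: "t = u" using eq rule False by (auto split: if_splits)
    have z: "z \<notin> R" "R' = insert z (insert t (R - {x} - {y}))"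
      using eq rule False tu by (auto simp: z_def split: if_splits)
    have less: "z < x" "z < y" "x < t" "y < t" using xt tu by (auto simp: z_def)
    have mem': "z \<in> R'" "y \<notin> R'" "z \<in> R'" "x \<notin> R'"
      and LN': "L = insert y (R' - {z})" "N = insert x (R' - {z})"
      using z less mem LN tu False by auto
    have "bead_rule L N R' = Inl ((R' - {z, y + x - z}) \<union> {y, x})"
      using bead_rule_eq[OF mem' LN'] less mem z(2) False by (simp add: z_def)
    also have "(R' - {z, y + x - z}) \<union> {y, x} = R" using z mem less by (auto simp: z_def)
    finally have inv: "bead_rule L N R' = Inl R" .
    have "bead_move R' a (beads_between R' z y) z L" "bead_move R' b (beads_between R' z x) z N"
    proof -
      have "y = z + int a" "x = z + int b" using tu by (simp_all add: z_def t_def u_def)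
      then show "bead_move R' a (beads_between R' z y) z L" "bead_move R' b (beads_between R' z x) z N"
        using bead_moveI[OF mem'(1,2) _ LN'(1)] bead_moveI[OF mem'(3,4) _ LN'(2)] by blast+
    qed
    \<comment> \<open>Here the surplus is on the side of \<open>R\<close>: its longer move jumps
      over the source of the shorter one, and this bead is missing in \<open>R'\<close>.\<close>
    moreover have "even (beads_between R' z y + beads_between R' z x) \<longleftrightarrow> odd (h + k)"
    proof (cases "x < y")
      case True
      have "beads_between R z x = beads_between R' z x"
        using less True mem beads_between_remove[of R z x x] beads_between_remove[of "R - {x}" z x y]
        by (simp add: z(2) beads_between_insert)
      moreover have "beads_between R z y = beads_between R' z y + 1"
        using less True mem beads_between_remove[of R z y x] beads_between_remove[of "R - {x}" z y y]
        by (simp add: z(2) beads_between_insert)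
      moreover have "beads_between R z y = beads_between R z x + 1 + beads_between R x y"
        using beads_between_split[of z x y R] less True mem by simp
      moreover have "h = beads_between R x y + 1 + k"
        using beads_between_split[of x y t R] less True mem hk tu by simp
      ultimately show ?thesis by simp presburger
    next
      case False
      then have "y < x" using \<open>x \<noteq> y\<close> by simp
      have "beads_between R z y = beads_between R' z y"
        using less \<open>y < x\<close> mem beads_between_remove[of R z y x] beads_between_remove[of "R - {x}" z y y]
        by (simp add: z(2) beads_between_insert)
      moreover have "beads_between R z x = beads_between R' z x + 1"
        using less \<open>y < x\<close> mem beads_between_remove[of R z x x] beads_between_remove[of "R - {x}" z x y]
        by (simp add: z(2) beads_between_insert)
      moreover have "beads_between R z x = beads_between R z y + 1 + beads_between R y x"
        using beads_between_split[of z y x R] less \<open>y < x\<close> mem by simp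
      moreover have "k = beads_between R y x + 1 + h"
        using beads_between_split[of y x t R] less \<open>y < x\<close> mem hk tu by simp
      ultimately show ?thesis by simp presburger
    qed
    ultimately show ?thesis using inv by blast
  qed
qed

text \<open>Bookkeeping for commuting moves: \<open>i1\<close> to \<open>i4\<close> stand for the
  indicators of an end of one move lying inside the other.\<close>

lemma parity_transfer:
  fixes a b h k i1 i2 i3 i4 :: nat
  assumes "a + i1 = k + i2" "b + i3 = h + i4" "even (i1 + i2 + i3 + i4)"
  shows "even (b + a) \<longleftrightarrow> even (h + k)"
  using assms by presburger

text \<open>For the inverse, complementation turns the sides meeting at \<open>M\<close> into moves
  out of \<open>- M\<close>. Moves with a common source thereby become moves with a common target
  and vice versa, while independent moves stay independent.\<close>

lemma bead_rule_Inr: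
  assumes L: "bead_move R a h x L" and N: "bead_move R b k y N" and "L \<noteq> N"
    and rule: "bead_rule L N R = Inr M"
  shows "\<exists>h' k' x' y'. bead_move L b k' y' M \<and> bead_move N a h' x' M \<and>
    (even (h' + k') \<longleftrightarrow> even (h + k)) \<and> bead_rule (- L) (- N) (- M) = Inr (- R)"
proof -
  define t u where "t = x + int a" and "u = y + int b"
  have xt: "x < t" "y < u" using bead_move_size_pos[OF L] bead_move_size_pos[OF N] by (auto simp: t_def u_def)
  have mem: "x \<in> R" "t \<notin> R" "y \<in> R" "u \<notin> R" and LN: "L = insert t (R - {x})" "N = insert u (R - {y})"
    and hk: "h = beads_between R x t" "k = beads_between R y u"
    using L N by (auto simp: bead_move_def t_def u_def)
  note eq = bead_rule_eq[OF mem LN]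
  have ne: "x \<noteq> u" "y \<noteq> t" using mem by auto
  consider "x \<noteq> y" "t \<noteq> u" | "x = y" "t \<noteq> u" | "x \<noteq> y" "t = u" using LN \<open>L \<noteq> N\<close> by auto
  then show ?thesis
  proof cases
    case 1
    then have M: "M = (R - {x, y}) \<union> {t, u}" using eq rule by simp
    have mem': "y \<in> L" "u \<notin> L" "x \<in> N" "t \<notin> N"
      and LN': "M = insert u (L - {y})" "M = insert t (N - {x})"
      using 1 mem LN M by auto
    have neg: "y \<in> - M" "u \<notin> - M" "x \<in> - M" "t \<notin> - M"
      "- L = insert u (- M - {y})" "- N = insert t (- M - {x})" using mem' LN' by auto
    have "bead_rule (- L) (- N) (- M) = Inr ((- M - {y, x}) \<union> {u, t})"
      using bead_rule_eq[OF neg] 1 by simp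
    also have "(- M - {y, x}) \<union> {u, t} = - R" using M mem by auto
    finally have inv: "bead_rule (- L) (- N) (- M) = Inr (- R)" .
    have "bead_move L b (beads_between L y u) y M" "bead_move N a (beads_between N x t) x M"
      using bead_moveI[OF mem'(1,2) _ LN'(1)] bead_moveI[OF mem'(3,4) _ LN'(2)]
      by (simp_all add: t_def u_def)
    moreover have "beads_between L y u + (if y < x \<and> x < u then 1 else 0) = k + (if y < t \<and> t < u then 1 else 0)"
      using beads_between_remove[of R y u x] hk mem by (simp add: LN(1) beads_between_insert)
    moreover have "beads_between N x t + (if x < y \<and> y < t then 1 else 0) = h + (if x < u \<and> u < t then 1 else 0)"
      using beads_between_remove[of R x t y] hk mem by (simp add: LN(2) beads_between_insert)
    \<comment> \<open>Two intervals with four distinct ends are disjoint, nested or crossing; the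
      number of ends lying inside the other interval is 0 or 2.\<close>
    moreover have "even ((if y < x \<and> x < u then 1 else 0) + (if y < t \<and> t < u then 1 else 0)
        + (if x < y \<and> y < t then 1 else 0) + (if x < u \<and> u < t then 1 else (0::nat)))"
      using xt 1 ne by auto
    ultimately show ?thesis using inv parity_transfer by blast
  next
    case 2
    \<comment> \<open>The position \<open>w\<close> reached by both moves in succession is free, so
      the bead continues from \<open>t\<close> or from \<open>u\<close> to \<open>w\<close>.\<close>
    define w where "w = t + u - x"
    have w: "w \<notin> R" "M = insert w (R - {x})"
      using eq rule 2 by (auto simp: w_def split: if_splits)
    have less: "x < t" "x < u" "t < w" "u < w" using xt 2 by (auto simp: w_def)
    have mem': "t \<in> L" "w \<notin> L" "u \<in> N" "w \<notin> N"
      and LN': "M = insert w (L - {t})" "M = insert w (N - {u})"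
      using 2 mem LN w less by auto
    have neg: "t \<in> - M" "w \<notin> - M" "u \<in> - M" "w \<notin> - M"
      "- L = insert w (- M - {t})" "- N = insert w (- M - {u})" using mem' LN' less by auto
    have "bead_rule (- L) (- N) (- M) = Inr (insert w (- M - {t + u - w}))"
      using bead_rule_eq[OF neg] 2 less mem w(2) by (simp add: w_def)
    also have "insert w (- M - {t + u - w}) = - R" using w mem less by (auto simp: w_def)
    finally have inv: "bead_rule (- L) (- N) (- M) = Inr (- R)" .
    have "bead_move L b (beads_between L t w) t M" "bead_move N a (beads_between N u w) u M"
      using bead_moveI[OF mem'(1,2) _ LN'(1), of b] bead_moveI[OF mem'(3,4) _ LN'(2), of a] 2
      by (auto simp: w_def t_def u_def)
    moreover have "beads_between L t w = beads_between R t w" "beads_between N u w = beads_between R u w"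
      using beads_between_remove[of R t w x] beads_between_remove[of R u w x] less mem 2
      by (auto simp: LN beads_between_insert)
    moreover have "even (beads_between R t w + beads_between R u w) \<longleftrightarrow> even (h + k)"
    proof (cases "t < u")
      case True
      show ?thesis
        using beads_between_split[of t u w R] beads_between_split[of x t u R] True less mem hk 2
        by simp presburger
    next
      case False
      then show ?thesis
        using beads_between_split[of u t w R] beads_between_split[of x u t R] less mem hk 2
        by simp presburger
    qed
    ultimately show ?thesis using inv by (metis add.commute)
  next
    case 3
    \<comment> \<open>The target \<open>t\<close> is taken by the first move, but a bead at
      \<open>z\<close> can fill the place that this move has left, be it \<open>x\<close> or
      \<open>y\<close>.\<close>
    define z where "z = x + y - t"
    have z: "z \<in> R" "M = insert t (R - {z})"
      using eq rule 3 by (auto simp: z_def split: if_splits)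
    have less: "z < x" "z < y" "x < t" "y < t" using xt 3 by (auto simp: z_def)
    have mem': "z \<in> L" "x \<notin> L" "z \<in> N" "y \<notin> N"
      and LN': "M = insert x (L - {z})" "M = insert y (N - {z})"
      using 3 mem LN z less by auto
    have neg: "z \<in> - M" "x \<notin> - M" "z \<in> - M" "y \<notin> - M"
      "- L = insert x (- M - {z})" "- N = insert y (- M - {z})" using mem' LN' less by auto
    have "bead_rule (- L) (- N) (- M) = Inr (insert (x + y - z) (- M - {z}))"
      using bead_rule_eq[OF neg] 3 less mem z(2) by (simp add: z_def)
    also have "insert (x + y - z) (- M - {z}) = - R" using z mem less by (auto simp: z_def)
    finally have inv: "bead_rule (- L) (- N) (- M) = Inr (- R)" .
    have "bead_move L b (beads_between L z x) z M" "bead_move N a (beads_between N z y) z M"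
    proof -
      have "x = z + int b" "y = z + int a" using 3 by (simp_all add: z_def t_def u_def)
      then show "bead_move L b (beads_between L z x) z M" "bead_move N a (beads_between N z y) z M"
        using bead_moveI[OF mem'(1,2) _ LN'(1)] bead_moveI[OF mem'(3,4) _ LN'(2)] by blast+
    qed
    moreover have "beads_between L z x = beads_between R z x" "beads_between N z y = beads_between R z y"
      using beads_between_remove[of R z x x] beads_between_remove[of R z y y] less mem 3
      by (auto simp: LN beads_between_insert)
    moreover have "even (beads_between R z x + beads_between R z y) \<longleftrightarrow> even (h + k)"
    proof (cases "x < y")
      case True
      show ?thesis
        using beads_between_split[of z x y R] beads_between_split[of x y t R] True less mem hk 3
        by simp presburger
    next
      case False
      then show ?thesis
        using beads_between_split[of z y x R] beads_between_split[of y x t R] less mem hk 3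
        by simp presburger
    qed
    ultimately show ?thesis using inv by (metis add.commute)
  qed
qed

lemma is_partition_of_beads_step:
  assumes "ribbon_step a h \<rho> \<kappa>"
  shows "bead_move S s k x (beads \<kappa>) \<Longrightarrow> ribbon_step s k (of_beads S) \<kappa> \<and> beads (of_beads S) = S"
    and "bead_move (beads \<kappa>) s k x S \<Longrightarrow> ribbon_step s k \<kappa> (of_beads S) \<and> beads (of_beads S) = S"
proof -
  have \<kappa>: "is_partition \<kappa>" using assms by (simp add: ribbon_step_def)
  show "bead_move S s k x (beads \<kappa>) \<Longrightarrow> ribbon_step s k (of_beads S) \<kappa> \<and> beads (of_beads S) = S"
    using of_beads_move_down[OF \<kappa>, of S s k x] \<kappa> by (auto simp: ribbon_step_def)
  show "bead_move (beads \<kappa>) s k x S \<Longrightarrow> ribbon_step s k \<kappa> (of_beads S) \<and> beads (of_beads S) = S"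
    using of_beads_move_up[OF \<kappa>, of s k x S] \<kappa> by (auto simp: ribbon_step_def)
qed

text \<open>The sets \<open>R'\<close> and \<open>M\<close> are one bead move away from
  \<open>beads \<kappa>\<close>, hence are bead sets of partitions, and \<open>of_beads\<close>
  loses no information.\<close>

lemma commute_up_step:
  assumes \<kappa>: "ribbon_step a h \<rho> \<kappa>" and \<nu>: "ribbon_step b k \<rho> \<nu>" and "\<kappa> \<noteq> \<nu>"
  shows "commute_up \<kappa> \<nu> \<rho> = Inl \<rho>' \<Longrightarrow>
      (\<exists>h' k'. ribbon_step a h' \<rho>' \<kappa> \<and> ribbon_step b k' \<rho>' \<nu> \<and> (even (h' + k') \<longleftrightarrow> odd (h + k))) \<and>
      commute_up \<kappa> \<nu> \<rho>' = Inl \<rho>"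
    and "commute_up \<kappa> \<nu> \<rho> = Inr \<mu> \<Longrightarrow>
      (\<exists>h' k'. ribbon_step b k' \<kappa> \<mu> \<and> ribbon_step a h' \<nu> \<mu> \<and> (even (h' + k') \<longleftrightarrow> even (h + k))) \<and>
      commute_down \<kappa> \<nu> \<mu> = Inl \<rho>"
proof -
  obtain x y where x: "bead_move (beads \<rho>) a h x (beads \<kappa>)" and y: "bead_move (beads \<rho>) b k y (beads \<nu>)"
    using \<kappa> \<nu> by (auto simp: ribbon_step_def)
  have part: "is_partition \<kappa>" "is_partition \<nu>" "is_partition \<rho>" using \<kappa> \<nu> by (auto simp: ribbon_step_def)
  have ne: "beads \<kappa> \<noteq> beads \<nu>" using beads_inject part \<open>\<kappa> \<noteq> \<nu>\<close> by blast
  {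
    assume "commute_up \<kappa> \<nu> \<rho> = Inl \<rho>'"
    then obtain R' where R': "bead_rule (beads \<kappa>) (beads \<nu>) (beads \<rho>) = Inl R'" "\<rho>' = of_beads R'"
      by (cases "bead_rule (beads \<kappa>) (beads \<nu>) (beads \<rho>)") (auto simp: commute_up_def)
    obtain h' k' x' y' where *: "bead_move R' a h' x' (beads \<kappa>)" "bead_move R' b k' y' (beads \<nu>)"
      "even (h' + k') \<longleftrightarrow> odd (h + k)" "bead_rule (beads \<kappa>) (beads \<nu>) R' = Inl (beads \<rho>)"
      using bead_rule_Inl[OF x y ne R'(1)] by blast
    have "beads \<rho>' = R'" "ribbon_step a h' \<rho>' \<kappa>" "ribbon_step b k' \<rho>' \<nu>"
      using is_partition_of_beads_step(1)[OF \<kappa> *(1)] is_partition_of_beads_step(1)[OF \<nu> *(2)] R'(2) by auto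
    moreover from this have "commute_up \<kappa> \<nu> \<rho>' = Inl \<rho>"
      using *(4) of_beads_beads part by (simp add: commute_up_def)
    ultimately show "(\<exists>h' k'. ribbon_step a h' \<rho>' \<kappa> \<and> ribbon_step b k' \<rho>' \<nu> \<and>
        (even (h' + k') \<longleftrightarrow> odd (h + k))) \<and> commute_up \<kappa> \<nu> \<rho>' = Inl \<rho>"
      using *(3) by blast
  next
    assume "commute_up \<kappa> \<nu> \<rho> = Inr \<mu>"
    then obtain M where M: "bead_rule (beads \<kappa>) (beads \<nu>) (beads \<rho>) = Inr M" "\<mu> = of_beads M"
      by (cases "bead_rule (beads \<kappa>) (beads \<nu>) (beads \<rho>)") (auto simp: commute_up_def)
    obtain h' k' x' y' where *: "bead_move (beads \<kappa>) b k' y' M" "bead_move (beads \<nu>) a h' x' M"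
      "even (h' + k') \<longleftrightarrow> even (h + k)"
      "bead_rule (- beads \<kappa>) (- beads \<nu>) (- M) = Inr (- beads \<rho>)"
      using bead_rule_Inr[OF x y ne M(1)] by blast
    have "beads \<mu> = M" "ribbon_step b k' \<kappa> \<mu>" "ribbon_step a h' \<nu> \<mu>"
      using is_partition_of_beads_step(2)[OF \<kappa> *(1)] is_partition_of_beads_step(2)[OF \<nu> *(2)] M(2) by auto
    moreover from this have "commute_down \<kappa> \<nu> \<mu> = Inl \<rho>"
      using *(4) of_beads_beads part by (simp add: commute_down_def)
    ultimately show "(\<exists>h' k'. ribbon_step b k' \<kappa> \<mu> \<and> ribbon_step a h' \<nu> \<mu> \<and>
        (even (h' + k') \<longleftrightarrow> even (h + k))) \<and> commute_down \<kappa> \<nu> \<mu> = Inl \<rho>"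
      using *(3) by blast
  }
qed

lemma even_complement: "h < a \<Longrightarrow> even (a - 1 - h) \<longleftrightarrow> (even (a - 1) \<longleftrightarrow> even h)" for a h :: nat
  by (auto dest!: less_imp_Suc_add)

text \<open>Complementation replaces the heights \<open>h\<close> and \<open>k\<close> by
  \<open>a - 1 - h\<close> and \<open>b - 1 - k\<close>. The offset depends only on the sizes, so it
  is the same before and after the rule and cancels when parities are compared.\<close>

lemma commute_down_step:
  assumes \<kappa>: "ribbon_step b k \<kappa> \<mu>" and \<nu>: "ribbon_step a h \<nu> \<mu>" and "\<kappa> \<noteq> \<nu>"
  shows "commute_down \<kappa> \<nu> \<mu> = Inr \<mu>' \<Longrightarrow>
      (\<exists>h' k'. ribbon_step b k' \<kappa> \<mu>' \<and> ribbon_step a h' \<nu> \<mu>' \<and> (even (h' + k') \<longleftrightarrow> odd (h + k))) \<and>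
      commute_down \<kappa> \<nu> \<mu>' = Inr \<mu>"
    and "commute_down \<kappa> \<nu> \<mu> = Inl \<rho> \<Longrightarrow>
      (\<exists>h' k'. ribbon_step a h' \<rho> \<kappa> \<and> ribbon_step b k' \<rho> \<nu> \<and> (even (h' + k') \<longleftrightarrow> even (h + k))) \<and>
      commute_up \<kappa> \<nu> \<rho> = Inr \<mu>"
proof -
  obtain x y where x0: "bead_move (beads \<kappa>) b k x (beads \<mu>)" and y0: "bead_move (beads \<nu>) a h y (beads \<mu>)"
    using \<kappa> \<nu> by (auto simp: ribbon_step_def)
  note x = bead_move_Compl[OF x0] and y = bead_move_Compl[OF y0]
  have part: "is_partition \<kappa>" "is_partition \<nu>" "is_partition \<mu>" using \<kappa> \<nu> by (auto simp: ribbon_step_def)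
  have ne: "- beads \<kappa> \<noteq> - beads \<nu>" using beads_inject part \<open>\<kappa> \<noteq> \<nu>\<close> by auto
  {
    assume "commute_down \<kappa> \<nu> \<mu> = Inr \<mu>'"
    then obtain M where M: "bead_rule (- beads \<kappa>) (- beads \<nu>) (- beads \<mu>) = Inl M" "\<mu>' = of_beads (- M)"
      by (cases "bead_rule (- beads \<kappa>) (- beads \<nu>) (- beads \<mu>)") (auto simp: commute_down_def)
    obtain h' k' x' y' where *: "bead_move M b k' x' (- beads \<kappa>)" "bead_move M a h' y' (- beads \<nu>)"
      "even (k' + h') \<longleftrightarrow> odd ((b - 1 - k) + (a - 1 - h))"
      "bead_rule (- beads \<kappa>) (- beads \<nu>) M = Inl (- beads \<mu>)"
      using bead_rule_Inl[OF x(2) y(2) ne M(1)] by blast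
    note c = bead_move_Compl[OF *(1)] bead_move_Compl[OF *(2)]
    have "bead_move (beads \<kappa>) b (b - 1 - k') x' (- M)" "bead_move (beads \<nu>) a (a - 1 - h') y' (- M)"
      using c(2,4) by simp_all
    then have s: "beads \<mu>' = - M" "ribbon_step b (b - 1 - k') \<kappa> \<mu>'" "ribbon_step a (a - 1 - h') \<nu> \<mu>'"
      using of_beads_move_up[OF part(1)] of_beads_move_up[OF part(2)] part M(2)
      unfolding ribbon_step_def by metis+
    moreover have "commute_down \<kappa> \<nu> \<mu>' = Inr \<mu>"
      using *(4) of_beads_beads part s(1) by (simp add: commute_down_def)
    moreover have "even ((a - 1 - h') + (b - 1 - k')) \<longleftrightarrow> odd (h + k)"
      using *(3) c(1,3) x(1) y(1) unfolding even_add by (simp only: even_complement) blast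
    ultimately show "(\<exists>h' k'. ribbon_step b k' \<kappa> \<mu>' \<and> ribbon_step a h' \<nu> \<mu>' \<and>
        (even (h' + k') \<longleftrightarrow> odd (h + k))) \<and> commute_down \<kappa> \<nu> \<mu>' = Inr \<mu>"
      by blast
  next
    assume "commute_down \<kappa> \<nu> \<mu> = Inl \<rho>"
    then obtain R where R: "bead_rule (- beads \<kappa>) (- beads \<nu>) (- beads \<mu>) = Inr R" "\<rho> = of_beads (- R)"
      by (cases "bead_rule (- beads \<kappa>) (- beads \<nu>) (- beads \<mu>)") (auto simp: commute_down_def)
    obtain h' k' x' y' where *: "bead_move (- beads \<kappa>) a h' y' R" "bead_move (- beads \<nu>) b k' x' R"
      "even (k' + h') \<longleftrightarrow> even ((b - 1 - k) + (a - 1 - h))"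
      "bead_rule (- (- beads \<kappa>)) (- (- beads \<nu>)) (- R) = Inr (- (- beads \<mu>))"
      using bead_rule_Inr[OF x(2) y(2) ne R(1)] by blast
    note c = bead_move_Compl[OF *(1)] bead_move_Compl[OF *(2)]
    have "bead_move (- R) a (a - 1 - h') y' (beads \<kappa>)" "bead_move (- R) b (b - 1 - k') x' (beads \<nu>)"
      using c(2,4) by simp_all
    then have s: "beads \<rho> = - R" "ribbon_step a (a - 1 - h') \<rho> \<kappa>" "ribbon_step b (b - 1 - k') \<rho> \<nu>"
      using of_beads_move_down[OF part(1)] of_beads_move_down[OF part(2)] part R(2)
      unfolding ribbon_step_def by metis+
    moreover have "commute_up \<kappa> \<nu> \<rho> = Inr \<mu>"
      using *(4) of_beads_beads part s(1) by (simp add: commute_up_def)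
    moreover have "even ((a - 1 - h') + (b - 1 - k')) \<longleftrightarrow> even (h + k)"
      using *(3) c(1,3) x(1) y(1) unfolding even_add by (simp only: even_complement) blast
    ultimately show "(\<exists>h' k'. ribbon_step a h' \<rho> \<kappa> \<and> ribbon_step b k' \<rho> \<nu> \<and>
        (even (h' + k') \<longleftrightarrow> even (h + k))) \<and> commute_up \<kappa> \<nu> \<rho> = Inr \<mu>"
      by blast
  }
qed

section \<open>Configurations\<close>

text \<open>The border is read along edges that go up and edges that go down. The factor in the
  wrong direction belongs to an empty skew shape, whose height is 0 by truncated subtraction, and so
  equals 1.\<close>

definition edge_sign :: "partition \<Rightarrow> partition \<Rightarrow> int" where
  "edge_sign p q = ribbon_sign p q * ribbon_sign q p"

lemma edge_sign_commute: "edge_sign p q = edge_sign q p"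
  by (simp add: edge_sign_def)

lemma edge_sign_refl [simp]: "edge_sign p p = 1"
  by (simp add: edge_sign_def ribbon_sign_def ribbon_height_def skew_def)

lemma edge_sign_ribbon: "is_ribbon q p \<Longrightarrow> edge_sign p q = ribbon_sign q p"
  unfolding edge_sign_def is_ribbon_def
  by (simp add: ribbon_sign_def ribbon_height_def[of p q] skew_def[of p q] Diff_eq_empty_iff[THEN iffD2])

lemma edge_sign_step:
  assumes "ribbon_step s h p q"
  shows "edge_sign p q = (-1) ^ h" "edge_sign q p = (-1) ^ h"
  using assms edge_sign_ribbon[of q p] edge_sign_commute[of p q]
  by (simp_all add: ribbon_step_iff ribbon_sign_def)

lemma ribbon_step_irrefl: "\<not> ribbon_step s h p p"
  by (auto simp: ribbon_step_iff skew_def)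

lemma ribbon_step_size_unique: "ribbon_step s h p q \<Longrightarrow> ribbon_step s' h' p q \<Longrightarrow> s = s' \<and> h = h'"
  by (simp add: ribbon_step_iff)

lemma ribbon_step_height_less: "ribbon_step s h p q \<Longrightarrow> h < s"
  using bead_move_Compl(1) unfolding ribbon_step_def by blast

definition edge :: "nat \<Rightarrow> partition \<Rightarrow> partition \<Rightarrow> bool" where
  "edge s p q \<longleftrightarrow> (if s = 0 then is_partition p \<and> p = q else (\<exists>h. ribbon_step s h p q))"

lemma edge_0 [simp]: "edge 0 p q \<longleftrightarrow> is_partition p \<and> p = q"
  by (simp add: edge_def)

lemma edge_partition: "edge s p q \<Longrightarrow> is_partition p \<and> is_partition q"
  by (auto simp: edge_def ribbon_step_def split: if_splits)

lemma edge_refl_iff [simp]: "edge s p p \<longleftrightarrow> s = 0 \<and> is_partition p"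
  by (auto simp: edge_def ribbon_step_irrefl)

lemma edge_step: "edge s p q \<Longrightarrow> p \<noteq> q \<Longrightarrow> 0 < s \<and> (\<exists>h. ribbon_step s h p q)"
  by (auto simp: edge_def split: if_splits)

lemma step_edge: "ribbon_step s h p q \<Longrightarrow> edge s p q"
  by (auto simp: edge_def ribbon_step_iff)

lemma involution_permutes_iff:
  "\<sigma> permutes S \<and> \<sigma> \<circ> \<sigma> = id \<longleftrightarrow> (\<forall>x. \<sigma> (\<sigma> x) = x) \<and> (\<forall>x. x \<notin> S \<longrightarrow> \<sigma> x = x)"
  unfolding permutes_def fun_eq_iff by simp metis

text \<open>\<open>R\<close> is the set of cells not yet treated. Tying the hook sizes to
  \<open>m\<close> gives the two lines through an occupied cell equal sizes, and lets a line
  remember its size once its hook is gone.\<close>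

definition partial_involutions :: "nat \<Rightarrow> (nat \<Rightarrow> nat) \<Rightarrow> (nat \<times> nat) set \<Rightarrow> hook_perm set" where
  "partial_involutions l m R = {(H, \<sigma>). length H = l \<and> \<sigma> permutes {..<l} \<and> \<sigma> \<circ> \<sigma> = id \<and>
     (\<forall>i<l. H ! \<sigma> i = H ! i \<and> (H ! i = [] \<longrightarrow> \<sigma> i = i) \<and>
       (H ! i \<noteq> [] \<longrightarrow> is_hook (H ! i) \<and> hook_size (H ! i) = m i \<and> (i \<le> \<sigma> i \<longrightarrow> (i, \<sigma> i) \<in> R)))}"

lemma partial_involutions_iff:
  "(H, \<sigma>) \<in> partial_involutions l m R \<longleftrightarrow> length H = l \<and>
     (\<forall>x. \<sigma> (\<sigma> x) = x) \<and> (\<forall>x. x \<notin> {..<l} \<longrightarrow> \<sigma> x = x) \<and>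
     (\<forall>i<l. H ! \<sigma> i = H ! i \<and> (H ! i = [] \<longrightarrow> \<sigma> i = i) \<and>
       (H ! i \<noteq> [] \<longrightarrow> is_hook (H ! i) \<and> hook_size (H ! i) = m i \<and> (i \<le> \<sigma> i \<longrightarrow> (i, \<sigma> i) \<in> R)))"
  unfolding partial_involutions_def using involution_permutes_iff[of \<sigma> "{..<l}"] by blast

lemma is_hook_nonempty: "is_hook K \<Longrightarrow> K \<noteq> []"
  by (auto simp: is_hook_def hook_def)

lemma take_hook_partial:
  assumes I: "(H, \<sigma>) \<in> partial_involutions l m R" and ij: "i \<le> j" "j < l" "\<sigma> i = j"
    and ne: "H ! i \<noteq> []"
  shows "take_hook i j (H, \<sigma>) \<in> partial_involutions l m (R - {(i, j)})"
    and "put_hook i j (H ! i) (take_hook i j (H, \<sigma>)) = (H, \<sigma>)"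
    and "H ! j = H ! i" "is_hook (H ! i)" "hook_size (H ! i) = m i" "m j = m i"
proof -
  have len: "length H = l" and inv: "\<And>x. \<sigma> (\<sigma> x) = x" and out: "\<And>x. \<not> x < l \<Longrightarrow> \<sigma> x = x"
    and H: "\<And>k. k < l \<Longrightarrow> H ! \<sigma> k = H ! k \<and> (H ! k = [] \<longrightarrow> \<sigma> k = k) \<and>
       (H ! k \<noteq> [] \<longrightarrow> is_hook (H ! k) \<and> hook_size (H ! k) = m k \<and> (k \<le> \<sigma> k \<longrightarrow> (k, \<sigma> k) \<in> R))"
    using I by (auto simp: partial_involutions_iff)
  have \<sigma>j: "\<sigma> j = i" using inv ij by metis
  have other: "\<sigma> k \<noteq> i \<and> \<sigma> k \<noteq> j" if "k \<noteq> i" "k \<noteq> j" for k using inv ij \<sigma>j that by metis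
  show same: "H ! j = H ! i" "is_hook (H ! i)" "hook_size (H ! i) = m i" "m j = m i"
    using H[of i] H[of j] ij ne by auto
  show "put_hook i j (H ! i) (take_hook i j (H, \<sigma>)) = (H, \<sigma>)"
    using same(1) len ij \<sigma>j
    by (auto simp: put_hook_def take_hook_def fun_eq_iff nth_list_update intro!: nth_equalityI)
  have "(H[i := [], j := []]) ! (\<sigma>(i := i, j := j)) k = H[i := [], j := []] ! k \<and>
      (H[i := [], j := []] ! k = [] \<longrightarrow> (\<sigma>(i := i, j := j)) k = k) \<and>
      (H[i := [], j := []] ! k \<noteq> [] \<longrightarrow> is_hook (H[i := [], j := []] ! k) \<and>
        hook_size (H[i := [], j := []] ! k) = m k \<and>
        (k \<le> (\<sigma>(i := i, j := j)) k \<longrightarrow> (k, (\<sigma>(i := i, j := j)) k) \<in> R - {(i, j)}))"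
    if "k < l" for k
    using H[OF that] other[of k] that ij len by (auto simp: nth_list_update)
  moreover have "(\<sigma>(i := i, j := j)) ((\<sigma>(i := i, j := j)) k) = k" for k
    using other[of k] inv by auto
  moreover have "(\<sigma>(i := i, j := j)) k = k" if "k \<notin> {..<l}" for k
    using out that ij by auto
  ultimately show "take_hook i j (H, \<sigma>) \<in> partial_involutions l m (R - {(i, j)})"
    unfolding take_hook_def case_prod_conv partial_involutions_iff using len by simp
qed

lemma put_hook_partial:
  assumes I: "(H, \<sigma>) \<in> partial_involutions l m (R - {(i, j)})" and ij: "i \<le> j" "j < l" "(i, j) \<in> R"
    and empty: "H ! i = []" "H ! j = []" and K: "is_hook K" "hook_size K = m i" "m j = m i"
  shows "put_hook i j K (H, \<sigma>) \<in> partial_involutions l m R"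
    and "take_hook i j (put_hook i j K (H, \<sigma>)) = (H, \<sigma>)"
proof -
  have len: "length H = l" and inv: "\<And>x. \<sigma> (\<sigma> x) = x" and out: "\<And>x. \<not> x < l \<Longrightarrow> \<sigma> x = x"
    and H: "\<And>k. k < l \<Longrightarrow> H ! \<sigma> k = H ! k \<and> (H ! k = [] \<longrightarrow> \<sigma> k = k) \<and>
       (H ! k \<noteq> [] \<longrightarrow> is_hook (H ! k) \<and> hook_size (H ! k) = m k \<and>
         (k \<le> \<sigma> k \<longrightarrow> (k, \<sigma> k) \<in> R - {(i, j)}))"
    using I unfolding partial_involutions_iff by auto
  have fix_ij: "\<sigma> i = i" "\<sigma> j = j" using H[of i] H[of j] ij empty by auto
  have other: "\<sigma> k \<noteq> i \<and> \<sigma> k \<noteq> j" if "k \<noteq> i" "k \<noteq> j" for k using inv fix_ij that by metis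
  show "take_hook i j (put_hook i j K (H, \<sigma>)) = (H, \<sigma>)"
    using empty len ij fix_ij
    by (auto simp: put_hook_def take_hook_def fun_eq_iff nth_list_update intro!: nth_equalityI)
  have "(H[i := K, j := K]) ! (\<sigma>(i := j, j := i)) k = H[i := K, j := K] ! k \<and>
      (H[i := K, j := K] ! k = [] \<longrightarrow> (\<sigma>(i := j, j := i)) k = k) \<and>
      (H[i := K, j := K] ! k \<noteq> [] \<longrightarrow> is_hook (H[i := K, j := K] ! k) \<and>
        hook_size (H[i := K, j := K] ! k) = m k \<and>
        (k \<le> (\<sigma>(i := j, j := i)) k \<longrightarrow> (k, (\<sigma>(i := j, j := i)) k) \<in> R))"
    if "k < l" for k
    using H[OF that] other[of k] that ij len K is_hook_nonempty[OF K(1)]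
    by (auto simp: nth_list_update)
  moreover have "(\<sigma>(i := j, j := i)) ((\<sigma>(i := j, j := i)) k) = k" for k
    using other[of k] inv by auto
  moreover have "(\<sigma>(i := j, j := i)) k = k" if "k \<notin> {..<l}" for k
    using out that ij by auto
  ultimately show "put_hook i j K (H, \<sigma>) \<in> partial_involutions l m R"
    unfolding put_hook_def case_prod_conv partial_involutions_iff using len by simp
qed

lemma partial_involutions_remove:
  "(H, \<sigma>) \<in> partial_involutions l m R \<Longrightarrow> \<sigma> i \<noteq> j \<or> H ! i = [] \<Longrightarrow>
     (H, \<sigma>) \<in> partial_involutions l m (R - {(i, j)})"
  unfolding partial_involutions_iff by blast

lemma partial_involutions_mono:
  "(H, \<sigma>) \<in> partial_involutions l m R \<Longrightarrow> R \<subseteq> R' \<Longrightarrow> (H, \<sigma>) \<in> partial_involutions l m R'"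
  unfolding partial_involutions_iff by blast

lemma partial_involutions_not_in:
  "(H, \<sigma>) \<in> partial_involutions l m (R - {(i, j)}) \<Longrightarrow> i \<le> j \<Longrightarrow> i < l \<Longrightarrow> H ! i \<noteq> [] \<Longrightarrow> \<sigma> i \<noteq> j"
  unfolding partial_involutions_iff by blast

text \<open>The emptied positions become fixed points, but \<open>[]\<close> has height 0 by
  truncated subtraction and thus sign 1; only a hook on the diagonal was counted before.\<close>

lemma involution_sign_take_hook:
  assumes I: "(H, \<sigma>) \<in> partial_involutions l m R" and ij: "i \<le> j" "j < l" "\<sigma> i = j"
  shows "involution_sign (H, \<sigma>) =
    (if i = j then hook_sign (H ! j) else 1) * involution_sign (take_hook i j (H, \<sigma>))"
proof -
  have len: "length H = l" and inv: "\<And>x. \<sigma> (\<sigma> x) = x" using I by (auto simp: partial_involutions_iff)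
  have \<sigma>j: "\<sigma> j = i" using inv ij by metis
  define F where "F = {k. k < l \<and> \<sigma> k = k} - {i, j}"
  have "involution_sign (take_hook i j (H, \<sigma>)) =
      (\<Prod>k \<in> F \<union> {i, j}. hook_sign (H[i := [], j := []] ! k))"
    unfolding involution_sign_def take_hook_def case_prod_conv using ij len
    by (intro prod.cong) (auto simp: F_def)
  also have "\<dots> = (\<Prod>k \<in> F. hook_sign (H[i := [], j := []] ! k)) *
      (\<Prod>k \<in> {i, j}. hook_sign (H[i := [], j := []] ! k))"
    by (rule prod.union_disjoint) (auto simp: F_def)
  also have "(\<Prod>k \<in> {i, j}. hook_sign (H[i := [], j := []] ! k)) = 1"
    using ij len by (intro prod.neutral) (auto simp: nth_list_update hook_sign_def hook_height_def)
  also have "(\<Prod>k \<in> F. hook_sign (H[i := [], j := []] ! k)) = (\<Prod>k \<in> F. hook_sign (H ! k))"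
    by (intro prod.cong) (auto simp: F_def)
  finally have taken: "involution_sign (take_hook i j (H, \<sigma>)) = (\<Prod>k \<in> F. hook_sign (H ! k))" by simp
  show ?thesis
  proof (cases "i = j")
    case True
    then have "{k. k < length H \<and> \<sigma> k = k} = insert j F" using ij \<sigma>j len by (auto simp: F_def)
    moreover have "finite F" "j \<notin> F" by (auto simp: F_def)
    ultimately show ?thesis using taken True by (simp add: involution_sign_def)
  next
    case False
    then have "{k. k < length H \<and> \<sigma> k = k} = F" using ij \<sigma>j len by (auto simp: F_def)
    then show ?thesis using taken False by (simp add: involution_sign_def)
  qed
qed

text \<open>A border step \<open>(True, j)\<close> goes down along row \<open>j\<close>, a step \<open>(False, i)\<close> goes right along
  column \<open>i\<close>. Each of the \<open>l\<close> lines has a fixed size \<open>m\<close>; a line whose hook has not been used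
  yet has empty edges.\<close>

definition line_size :: "(nat \<Rightarrow> nat) \<Rightarrow> partition list \<Rightarrow> nat \<Rightarrow> nat" where
  "line_size m H i = (if H ! i = [] then m i else 0)"

definition border_step ::
    "(nat \<Rightarrow> nat) \<Rightarrow> partition list \<Rightarrow> bool \<times> nat \<Rightarrow> partition \<Rightarrow> partition \<Rightarrow> bool" where
  "border_step m H = (\<lambda>(down, i) p q.
     if down then edge (line_size m H i) q p else edge (line_size m H i) p q)"

definition configs ::
    "nat \<Rightarrow> (nat \<Rightarrow> nat) \<Rightarrow> (nat \<Rightarrow> bool \<times> nat) \<Rightarrow> (nat \<times> nat) set \<Rightarrow> config set" where
  "configs l m d R = {(w, I). length w = Suc l \<and> w ! 0 = [] \<and>
     (\<forall>k<l. border_step m (fst I) (d k) (w ! k) (w ! Suc k)) \<and> I \<in> partial_involutions l m R}"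

text \<open>Interpolates between \<open>involution_sign\<close>, when all edges are empty, and
  \<open>tableau_sign\<close>, when no hook is left.\<close>

definition config_sign :: "config \<Rightarrow> int" where
  "config_sign = (\<lambda>(w, I).
     (\<Prod>k<length w - 1. edge_sign (w ! k) (w ! Suc k)) * involution_sign I)"

lemma sign_square: "(-1) ^ h * (-1) ^ h = (1::int)"
  by (simp flip: power_add)

lemma sign_parity:
  "(even (h' + k') \<longleftrightarrow> even (h + k)) \<Longrightarrow> (-1) ^ h' * (-1) ^ k' = (-1) ^ h * ((-1) ^ k :: int)"
  "(even (h' + k') \<longleftrightarrow> odd (h + k)) \<Longrightarrow> (-1) ^ h' * (-1) ^ k' = - ((-1) ^ h * ((-1) ^ k :: int))"
  by (cases "even h"; cases "even k"; cases "even h'"; cases "even k'"; simp)+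

lemma in_Plus_iff [simp]: "Inl a \<in> A <+> B \<longleftrightarrow> a \<in> A" "Inr b \<in> A <+> B \<longleftrightarrow> b \<in> B"
  by auto

section \<open>The local rule in an inner cell\<close>

context
  fixes l i j p :: nat and m :: "nat \<Rightarrow> nat" and d :: "nat \<Rightarrow> bool \<times> nat" and R :: "(nat \<times> nat) set"
  assumes ij: "i < j" "j < l" and p: "0 < p" "p < l"
    and dp: "d (p - 1) = (True, j)" "d p = (False, i)"
    and inj: "inj_on (snd \<circ> d) {..<l}" and R: "(i, j) \<in> R"
begin

private abbreviation (input) "A \<equiv> configs l m d R"
private abbreviation (input) "B \<equiv> configs l m (d(p - 1 := (False, i), p := (True, j))) (R - {(i, j)})"

private definition frame :: "partition list \<Rightarrow> partition list \<Rightarrow> bool" where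
  "frame w H \<longleftrightarrow> length w = Suc l \<and> w ! 0 = [] \<and>
  (\<forall>k<l. k \<noteq> p - 1 \<and> k \<noteq> p \<longrightarrow> border_step m H (d k) (w ! k) (w ! Suc k))"

private lemma all_split: "(\<forall>k<l. Q k) \<longleftrightarrow> (\<forall>k<l. k \<noteq> p - 1 \<and> k \<noteq> p \<longrightarrow> Q k) \<and> Q (p - 1) \<and> Q p"
  using p by (metis less_imp_diff_less)

private lemma A_iff: "(w, H, \<sigma>) \<in> A \<longleftrightarrow> frame w H \<and>
    edge (line_size m H j) (w ! p) (w ! (p - 1)) \<and> edge (line_size m H i) (w ! p) (w ! (p + 1)) \<and>
    (H, \<sigma>) \<in> partial_involutions l m R"
  using p dp unfolding configs_def frame_def
  by (subst all_split) (auto simp: border_step_def)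

private lemma B_iff: "(w, H, \<sigma>) \<in> B \<longleftrightarrow> frame w H \<and>
    edge (line_size m H i) (w ! (p - 1)) (w ! p) \<and> edge (line_size m H j) (w ! (p + 1)) (w ! p) \<and>
    (H, \<sigma>) \<in> partial_involutions l m (R - {(i, j)})"
  using p dp unfolding configs_def frame_def
  by (subst all_split) (auto simp: border_step_def)

private lemma frame_update [simp]: "frame (w[p := x]) H \<longleftrightarrow> frame w H"
  using p unfolding frame_def by (auto simp: nth_list_update)

text \<open>Different border steps lie on different lines, so the content of positions
  \<open>i\<close> and \<open>j\<close> affects only the two edges at the corner
  \<open>p\<close>.\<close>

private lemma frame_hooks: "frame w (H[i := a, j := b]) \<longleftrightarrow> frame w H"
proof -
  have sz: "line_size m (H[i := a, j := b]) (snd (d k)) = line_size m H (snd (d k))"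
    if "k < l" "k \<noteq> p - 1" "k \<noteq> p" for k
  proof -
    have "snd (d k) \<noteq> j" "snd (d k) \<noteq> i"
      using inj_onD[OF inj, of k "p - 1"] inj_onD[OF inj, of k p] that p dp less_imp_diff_less[OF p(2), of 1]
      by auto
    then show ?thesis by (simp add: line_size_def)
  qed
  have "border_step m (H[i := a, j := b]) (d k) = border_step m H (d k)"
    if "k < l" "k \<noteq> p - 1" "k \<noteq> p" for k
    using sz[OF that] by (cases "d k") (auto simp: border_step_def fun_eq_iff)
  then show ?thesis unfolding frame_def by simp
qed

private lemma nths [simp]:
  assumes "frame w H"
  shows "w[p := x] ! p = x" "w[p := x] ! (p - Suc 0) = w ! (p - 1)" "w[p := x] ! Suc p = w ! Suc p"
  using p assms by (auto simp: frame_def)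

private lemma restore: "w ! p = x \<Longrightarrow> w[p := x] = w" by auto

private definition rest :: "partition list \<Rightarrow> int" where
  "rest w = (\<Prod>k \<in> {..<l} - {p - 1, p}. edge_sign (w ! k) (w ! Suc k))"

private lemma rest_update [simp]: "rest (w[p := x]) = rest w"
  unfolding rest_def using p by (intro prod.cong) (auto simp: nth_list_update)

private lemma config_sign_eq:
  assumes "frame w H"
  shows "config_sign (w, I) =
    rest w * (edge_sign (w ! (p - 1)) (w ! p) * edge_sign (w ! p) (w ! (p + 1))) * involution_sign I"
proof -
  let ?f = "\<lambda>k. edge_sign (w ! k) (w ! Suc k)"
  have "{..<l} = insert (p - 1) (insert p ({..<l} - {p - 1, p}))" using p by auto
  then have "prod ?f {..<l} = prod ?f (insert (p - 1) (insert p ({..<l} - {p - 1, p})))" by simp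
  also have "\<dots> = ?f (p - 1) * prod ?f (insert p ({..<l} - {p - 1, p}))"
    using p by (intro prod.insert) auto
  also have "prod ?f (insert p ({..<l} - {p - 1, p})) = ?f p * rest w"
    unfolding rest_def by (intro prod.insert) auto
  finally have "prod ?f {..<l} = ?f (p - 1) * (?f p * rest w)" .
  then show ?thesis using assms p by (simp add: config_sign_def frame_def)
qed

private lemma line_sizes:
  assumes "0 < line_size m H i" shows "H ! i = []" "line_size m H i = m i"
  using assms by (auto simp: line_size_def split: if_splits)

private lemma line_sizes':
  assumes "0 < line_size m H j" shows "H ! j = []" "line_size m H j = m j"
  using assms by (auto simp: line_size_def split: if_splits)

text \<open>The case distinction is the one made by \<open>inner_cell\<close>. Whenever one of the
  two edges at the corner is empty, the other is carried to the opposite side of the cell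
  unchanged.\<close>

private lemma inner_cell_up:
  assumes c: "(w, H, \<sigma>) \<in> A"
  defines "z \<equiv> inner_cell p i j (Inl (w, H, \<sigma>))"
  shows "z \<in> A <+> B \<and> inner_cell p i j z = Inl (w, H, \<sigma>) \<and>
    case_sum config_sign (\<lambda>c. - config_sign c) z = - config_sign (w, H, \<sigma>)"
proof -
  let ?\<kappa> = "w ! (p - 1)" and ?\<rho> = "w ! p" and ?\<nu> = "w ! (p + 1)"
  have fr: "frame w H" and ej: "edge (line_size m H j) ?\<rho> ?\<kappa>" and ei: "edge (line_size m H i) ?\<rho> ?\<nu>"
    and I: "(H, \<sigma>) \<in> partial_involutions l m R" using c unfolding A_iff by auto
  have part: "is_partition ?\<kappa>" "is_partition ?\<rho>" "is_partition ?\<nu>"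
    using edge_partition[OF ej] edge_partition[OF ei] by auto
  note nth = nths[OF fr]
  have len: "length H = l" using I by (simp add: partial_involutions_iff)
  show ?thesis
  proof (cases "\<sigma> i = j")
    case True
    then have ne: "H ! i \<noteq> []" using I ij unfolding partial_involutions_iff by (metis less_irrefl less_trans)
    note tk = take_hook_partial[OF I less_imp_le[OF ij(1)] ij(2) True ne]
    \<comment> \<open>While the cell holds a hook, both lines through it have empty edges, so its
      three known corners coincide.\<close>
    have eq: "?\<rho> = ?\<kappa>" "?\<nu> = ?\<kappa>" using ei ej ne tk(3) by (auto simp: line_size_def)
    obtain s h where hs: "h < s" "H ! i = hook s h" using tk(4) by (auto simp: is_hook_def)
    then have s: "s = m i" using tk(5) hook_statistics[OF part(1) hs(1)] by simp
    let ?\<mu> = "insert_hook ?\<kappa> (H ! i)"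
    let ?I = "(H[i := [], j := []], \<sigma>(i := i, j := j))"
    note st = insert_hook_step[OF part(1) hs(1), folded hs(2)]
    have ne': "?\<mu> \<noteq> ?\<kappa>" using st(1) ribbon_step_irrefl by metis
    have z: "z = Inr (w[p := ?\<mu>], ?I)" using True by (simp add: z_def take_hook_def Let_def)
    have "(w[p := ?\<mu>], ?I) \<in> B"
      unfolding B_iff using tk(1) fr st(1) eq nth len ij s tk(6)
      by (auto simp: frame_hooks take_hook_def line_size_def step_edge)
    moreover have "inner_cell p i j z = Inl (w, H, \<sigma>)"
      using z ne' eq st(2) tk(2) nth hs(2) restore[OF eq(1)] by (simp add: take_hook_def Let_def)
    \<comment> \<open>Both new edges carry the ribbon from \<open>\<kappa>\<close> to the new
      corner, so their signs cancel; the hook taken away is not at a fixed point and contributed no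
      sign.\<close>
    moreover have "config_sign (w[p := ?\<mu>], ?I) = config_sign (w, H, \<sigma>)"
      using config_sign_eq[of "w[p := ?\<mu>]" H ?I] config_sign_eq[OF fr, of "(H, \<sigma>)"] fr nth eq
        edge_sign_step[OF st(1)] involution_sign_take_hook[OF I _ ij(2) True] ij
      by (simp add: take_hook_def sign_square)
    ultimately show ?thesis using z by (simp del: inner_cell.simps)
  next
    case False
    have I': "(H, \<sigma>) \<in> partial_involutions l m (R - {(i, j)})"
      using partial_involutions_remove[OF I] False by blast
    show ?thesis
    proof (cases "?\<rho> = ?\<kappa>")
      case r: True
      have z: "z = Inr (w[p := ?\<nu>], H, \<sigma>)" using False r by (simp add: z_def Let_def)
      have "(w[p := ?\<nu>], H, \<sigma>) \<in> B" unfolding B_iff using I' fr nth ej ei r part by auto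
      moreover have "inner_cell p i j z = Inl (w, H, \<sigma>)"
        using z nth r restore[OF r] by (simp add: Let_def)
      moreover have "config_sign (w[p := ?\<nu>], H, \<sigma>) = config_sign (w, H, \<sigma>)"
        using config_sign_eq[of "w[p := ?\<nu>]" H] config_sign_eq[OF fr] fr nth r by simp
      ultimately show ?thesis using z by (simp del: inner_cell.simps)
    next
      case r: False
      obtain h where h: "ribbon_step (m j) h ?\<rho> ?\<kappa>" "H ! j = []" "line_size m H j = m j"
        using edge_step[OF ej r] line_sizes'[OF edge_step[OF ej r, THEN conjunct1]] by auto
      show ?thesis
      proof (cases "?\<rho> = ?\<nu>")
        case r': True
        have z: "z = Inr (w[p := ?\<kappa>], H, \<sigma>)" using False r r' by (simp add: z_def Let_def)
        have "(w[p := ?\<kappa>], H, \<sigma>) \<in> B" unfolding B_iff using I' fr nth ej ei r' part by auto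
        moreover have "inner_cell p i j z = Inl (w, H, \<sigma>)"
          using z nth r r' restore[OF r'] by (simp add: Let_def)
        moreover have "config_sign (w[p := ?\<kappa>], H, \<sigma>) = config_sign (w, H, \<sigma>)"
          using config_sign_eq[of "w[p := ?\<kappa>]" H] config_sign_eq[OF fr] fr nth r' by simp
        ultimately show ?thesis using z by (simp del: inner_cell.simps)
      next
        case r': False
        obtain k where k: "ribbon_step (m i) k ?\<rho> ?\<nu>" "H ! i = []" "line_size m H i = m i"
          using edge_step[OF ei r'] line_sizes[OF edge_step[OF ei r', THEN conjunct1]] by auto
        show ?thesis
        proof (cases "?\<kappa> = ?\<nu>")
          case True
          let ?\<mu> = "bump ?\<kappa> ?\<rho>"
          \<comment> \<open>With equal neighbours both edges carry the same ribbon, which yields the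
            equal sizes and heights that \<open>bump\<close> relies on.\<close>
          have same: "m i = m j" "k = h" using ribbon_step_size_unique h(1) k(1) True by metis+
          note st = bump_step[OF part(1) ribbon_step_height_less[OF h(1)] h(1)]
          have ne': "?\<mu> \<noteq> ?\<kappa>" using st(1) ribbon_step_irrefl by metis
          have z: "z = Inr (w[p := ?\<mu>], H, \<sigma>)" using False r r' True by (simp add: z_def Let_def)
          have "(w[p := ?\<mu>], H, \<sigma>) \<in> B"
            unfolding B_iff using I' fr nth st(1) h k True same by (auto intro: step_edge)
          moreover have "inner_cell p i j z = Inl (w, H, \<sigma>)"
            using z nth st(2) ne' True by (simp add: Let_def)
          moreover have "config_sign (w[p := ?\<mu>], H, \<sigma>) = config_sign (w, H, \<sigma>)"
            using config_sign_eq[of "w[p := ?\<mu>]" H] config_sign_eq[OF fr] fr nth True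
              edge_sign_step[OF st(1)] edge_sign_step[OF h(1)]
            by (simp add: sign_square)
          ultimately show ?thesis using z by (simp del: inner_cell.simps)
        next
          case ne: False
          note up = commute_up_step[OF h(1) k(1) ne]
          show ?thesis
          proof (cases "commute_up ?\<kappa> ?\<nu> ?\<rho>")
            case (Inl \<rho>')
            then obtain h' k' where st: "ribbon_step (m j) h' \<rho>' ?\<kappa>" "ribbon_step (m i) k' \<rho>' ?\<nu>"
              "even (h' + k') \<longleftrightarrow> odd (h + k)" "commute_up ?\<kappa> ?\<nu> \<rho>' = Inl ?\<rho>"
              using up(1) by blast
            have ne': "\<rho>' \<noteq> ?\<kappa>" "\<rho>' \<noteq> ?\<nu>" using st(1,2) ribbon_step_irrefl by metis+
            have z: "z = Inl (w[p := \<rho>'], H, \<sigma>)" using False r r' ne Inl by (simp add: z_def Let_def)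
            have "(w[p := \<rho>'], H, \<sigma>) \<in> A"
              unfolding A_iff using I fr nth st(1,2) h k by (auto intro: step_edge)
            moreover have "inner_cell p i j z = Inl (w, H, \<sigma>)"
              using z nth st(4) ne ne' False by (simp add: Let_def)
            \<comment> \<open>The result stays on the same side of the matching, so here the sign
              has to change.\<close>
            moreover have "config_sign (w[p := \<rho>'], H, \<sigma>) = - config_sign (w, H, \<sigma>)"
              using config_sign_eq[of "w[p := \<rho>']" H] config_sign_eq[OF fr] fr nth
                edge_sign_step[OF st(1)] edge_sign_step[OF st(2)] edge_sign_step[OF h(1)]
                edge_sign_step[OF k(1)] sign_parity(2)[OF st(3)]
              by simp
            ultimately show ?thesis using z by (simp del: inner_cell.simps)
          next
            case (Inr \<mu>)
            then obtain h' k' where st: "ribbon_step (m i) k' ?\<kappa> \<mu>" "ribbon_step (m j) h' ?\<nu> \<mu>"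
              "even (h' + k') \<longleftrightarrow> even (h + k)" "commute_down ?\<kappa> ?\<nu> \<mu> = Inl ?\<rho>"
              using up(2) by blast
            have ne': "\<mu> \<noteq> ?\<kappa>" "\<mu> \<noteq> ?\<nu>" using st(1,2) ribbon_step_irrefl by metis+
            have z: "z = Inr (w[p := \<mu>], H, \<sigma>)" using False r r' ne Inr by (simp add: z_def Let_def)
            have "(w[p := \<mu>], H, \<sigma>) \<in> B"
              unfolding B_iff using I' fr nth st(1,2) h k by (auto intro: step_edge)
            moreover have "inner_cell p i j z = Inl (w, H, \<sigma>)"
              using z nth st(4) ne ne' by (simp add: Let_def)
            moreover have "config_sign (w[p := \<mu>], H, \<sigma>) = config_sign (w, H, \<sigma>)"
              using config_sign_eq[of "w[p := \<mu>]" H] config_sign_eq[OF fr] fr nth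
                edge_sign_step[OF st(1)] edge_sign_step[OF st(2)] edge_sign_step[OF h(1)]
                edge_sign_step[OF k(1)] sign_parity(1)[OF st(3)]
              by (simp add: mult.commute)
            ultimately show ?thesis using z by (simp del: inner_cell.simps)
          qed
        qed
      qed
    qed
  qed
qed

private lemma inner_cell_down:
  assumes c: "(w, H, \<sigma>) \<in> B"
  defines "z \<equiv> inner_cell p i j (Inr (w, H, \<sigma>))"
  shows "z \<in> A <+> B \<and> inner_cell p i j z = Inr (w, H, \<sigma>) \<and>
    case_sum config_sign (\<lambda>c. - config_sign c) z = config_sign (w, H, \<sigma>)"
proof -
  let ?\<kappa> = "w ! (p - 1)" and ?\<mu> = "w ! p" and ?\<nu> = "w ! (p + 1)"
  have fr: "frame w H" and ei: "edge (line_size m H i) ?\<kappa> ?\<mu>" and ej: "edge (line_size m H j) ?\<nu> ?\<mu>"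
    and I': "(H, \<sigma>) \<in> partial_involutions l m (R - {(i, j)})" using c unfolding B_iff by auto
  have I: "(H, \<sigma>) \<in> partial_involutions l m R" using partial_involutions_mono[OF I'] by blast
  have part: "is_partition ?\<kappa>" "is_partition ?\<mu>" "is_partition ?\<nu>"
    using edge_partition[OF ej] edge_partition[OF ei] by auto
  note nth = nths[OF fr]
  have len: "length H = l" using I by (simp add: partial_involutions_iff)
  \<comment> \<open>The cell has been treated and can hold no hook, so the first branch of the
    upward rule does not interfere with the inversion.\<close>
  have \<sigma>: "\<sigma> i \<noteq> j"
  proof
    assume "\<sigma> i = j"
    moreover from this have "H ! i \<noteq> []" using I ij unfolding partial_involutions_iff by (metis less_irrefl less_trans)
    ultimately show False using partial_involutions_not_in[OF I'] ij by simp
  qed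
  show ?thesis
  proof (cases "?\<mu> = ?\<nu>")
    case r: True
    have z: "z = Inl (w[p := ?\<kappa>], H, \<sigma>)" using r by (simp add: z_def Let_def)
    have "(w[p := ?\<kappa>], H, \<sigma>) \<in> A" unfolding A_iff using I fr nth ej ei r part by auto
    moreover have "inner_cell p i j z = Inr (w, H, \<sigma>)"
      using z nth r \<sigma> restore[OF r] by (simp add: Let_def)
    moreover have "config_sign (w[p := ?\<kappa>], H, \<sigma>) = config_sign (w, H, \<sigma>)"
      using config_sign_eq[of "w[p := ?\<kappa>]" H] config_sign_eq[OF fr] fr nth r by simp
    ultimately show ?thesis using z by (simp del: inner_cell.simps)
  next
    case r: False
    obtain h where h: "ribbon_step (m j) h ?\<nu> ?\<mu>" "H ! j = []" "line_size m H j = m j"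
      using edge_step[OF ej not_sym[OF r]] line_sizes'[OF edge_step[OF ej not_sym[OF r], THEN conjunct1]] by auto
    show ?thesis
    proof (cases "?\<mu> = ?\<kappa>")
      case r': True
      have z: "z = Inl (w[p := ?\<nu>], H, \<sigma>)" using r r' by (simp add: z_def Let_def)
      have "(w[p := ?\<nu>], H, \<sigma>) \<in> A" unfolding A_iff using I fr nth ej ei r' part by auto
      moreover have "inner_cell p i j z = Inr (w, H, \<sigma>)"
        using z nth r r' \<sigma> restore[OF r'] by (simp add: Let_def)
      moreover have "config_sign (w[p := ?\<nu>], H, \<sigma>) = config_sign (w, H, \<sigma>)"
        using config_sign_eq[of "w[p := ?\<nu>]" H] config_sign_eq[OF fr] fr nth r' by simp
      ultimately show ?thesis using z by (simp del: inner_cell.simps)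
    next
      case r': False
      obtain k where k: "ribbon_step (m i) k ?\<kappa> ?\<mu>" "H ! i = []" "line_size m H i = m i"
        using edge_step[OF ei not_sym[OF r']] line_sizes[OF edge_step[OF ei not_sym[OF r'], THEN conjunct1]] by auto
      show ?thesis
      proof (cases "?\<kappa> = ?\<nu>")
        case True
        \<comment> \<open>Equal sizes of the two lines also ensure that a hook returned by
          \<open>unbump\<close> fits both positions \<open>i\<close> and \<open>j\<close>.\<close>
        have same: "m i = m j" "k = h" using ribbon_step_size_unique h(1) k(1) True by metis+
        have hs: "k < m i" using ribbon_step_height_less[OF k(1)] .
        note ub = unbump_step[OF part(1) hs k(1)]
        show ?thesis
        proof (cases "unbump ?\<kappa> ?\<mu>")
          case (Inl K)
          have K: "K = hook (m i) k" "insert_hook ?\<kappa> K = ?\<mu>" using ub(1)[OF Inl] by auto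
          then have hook: "is_hook K" "hook_size K = m i" using hook_statistics[OF part(1) hs] by auto
          let ?I = "(H[i := K, j := K], \<sigma>(i := j, j := i))"
          have z: "z = Inl (w[p := ?\<kappa>], ?I)" using r r' True Inl by (simp add: z_def put_hook_def Let_def)
          note pt = put_hook_partial[OF I' less_imp_le[OF ij(1)] ij(2) R k(2) h(2) hook same(1)[symmetric]]
          have P: "?I \<in> partial_involutions l m R" using pt(1) by (simp add: put_hook_def)
          have "(w[p := ?\<kappa>], ?I) \<in> A"
            unfolding A_iff using P fr nth len ij is_hook_nonempty[OF hook(1)] True part
            by (auto simp: frame_hooks line_size_def)
          moreover have "inner_cell p i j z = Inr (w, H, \<sigma>)"
            using z nth K(2) pt(2) ij len by (simp add: Let_def put_hook_def)
          moreover have "config_sign (w[p := ?\<kappa>], ?I) = config_sign (w, H, \<sigma>)"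
            using config_sign_eq[of "w[p := ?\<kappa>]" H ?I] config_sign_eq[OF fr, of "(H, \<sigma>)"] fr nth True
              edge_sign_step[OF k(1)] pt(2) ij
              involution_sign_take_hook[OF P less_imp_le[OF ij(1)] ij(2)]
            by (simp add: put_hook_def sign_square)
          ultimately show ?thesis using z by (simp del: inner_cell.simps)
        next
          case (Inr \<rho>)
          have st: "ribbon_step (m i) k \<rho> ?\<kappa>" "bump ?\<kappa> \<rho> = ?\<mu>" using ub(2)[OF Inr] by auto
          have ne': "\<rho> \<noteq> ?\<kappa>" using st(1) ribbon_step_irrefl by metis
          have z: "z = Inl (w[p := \<rho>], H, \<sigma>)" using r r' True Inr by (simp add: z_def Let_def)
          have "(w[p := \<rho>], H, \<sigma>) \<in> A"
            unfolding A_iff using I fr nth st(1) h k True same by (auto intro: step_edge)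
          moreover have "inner_cell p i j z = Inr (w, H, \<sigma>)"
            using z nth st(2) ne' True \<sigma> by (simp add: Let_def)
          moreover have "config_sign (w[p := \<rho>], H, \<sigma>) = config_sign (w, H, \<sigma>)"
            using config_sign_eq[of "w[p := \<rho>]" H] config_sign_eq[OF fr] fr nth True
              edge_sign_step[OF st(1)] edge_sign_step[OF k(1)]
            by (simp add: sign_square)
          ultimately show ?thesis using z by (simp del: inner_cell.simps)
        qed
      next
        case ne: False
        note down = commute_down_step[OF k(1) h(1) ne]
        show ?thesis
        proof (cases "commute_down ?\<kappa> ?\<nu> ?\<mu>")
          case (Inr \<mu>')
          then obtain h' k' where st: "ribbon_step (m i) k' ?\<kappa> \<mu>'" "ribbon_step (m j) h' ?\<nu> \<mu>'"
            "even (h' + k') \<longleftrightarrow> odd (h + k)" "commute_down ?\<kappa> ?\<nu> \<mu>' = Inr ?\<mu>"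
            using down(1) by blast
          have ne': "\<mu>' \<noteq> ?\<kappa>" "\<mu>' \<noteq> ?\<nu>" using st(1,2) ribbon_step_irrefl by metis+
          have z: "z = Inr (w[p := \<mu>'], H, \<sigma>)" using r r' ne Inr by (simp add: z_def Let_def)
          have "(w[p := \<mu>'], H, \<sigma>) \<in> B"
            unfolding B_iff using I' fr nth st(1,2) h k by (auto intro: step_edge)
          moreover have "inner_cell p i j z = Inr (w, H, \<sigma>)"
            using z nth st(4) ne ne' by (simp add: Let_def)
          moreover have "config_sign (w[p := \<mu>'], H, \<sigma>) = - config_sign (w, H, \<sigma>)"
            using config_sign_eq[of "w[p := \<mu>']" H] config_sign_eq[OF fr] fr nth
              edge_sign_step[OF st(1)] edge_sign_step[OF st(2)] edge_sign_step[OF h(1)]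
              edge_sign_step[OF k(1)] sign_parity(2)[OF st(3)]
            by (simp add: mult.commute)
          ultimately show ?thesis using z by (simp del: inner_cell.simps)
        next
          case (Inl \<rho>)
          then obtain h' k' where st: "ribbon_step (m j) h' \<rho> ?\<kappa>" "ribbon_step (m i) k' \<rho> ?\<nu>"
            "even (h' + k') \<longleftrightarrow> even (h + k)" "commute_up ?\<kappa> ?\<nu> \<rho> = Inr ?\<mu>"
            using down(2) by blast
          have ne': "\<rho> \<noteq> ?\<kappa>" "\<rho> \<noteq> ?\<nu>" using st(1,2) ribbon_step_irrefl by metis+
          have z: "z = Inl (w[p := \<rho>], H, \<sigma>)" using r r' ne Inl by (simp add: z_def Let_def)
          have "(w[p := \<rho>], H, \<sigma>) \<in> A"
            unfolding A_iff using I fr nth st(1,2) h k by (auto intro: step_edge)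
          moreover have "inner_cell p i j z = Inr (w, H, \<sigma>)"
            using z nth st(4) ne ne' \<sigma> by (simp add: Let_def)
          moreover have "config_sign (w[p := \<rho>], H, \<sigma>) = config_sign (w, H, \<sigma>)"
            using config_sign_eq[of "w[p := \<rho>]" H] config_sign_eq[OF fr] fr nth
              edge_sign_step[OF st(1)] edge_sign_step[OF st(2)] edge_sign_step[OF h(1)]
              edge_sign_step[OF k(1)] sign_parity(1)[OF st(3)]
            by (simp add: mult.commute)
          ultimately show ?thesis using z by (simp del: inner_cell.simps)
        qed
      qed
    qed
  qed
qed

lemma inner_cell_sign_matching: "sign_matching A config_sign B config_sign (inner_cell p i j)"
  unfolding sign_matching_def
proof
  fix z assume "z \<in> A <+> B"
  then consider w H \<sigma> where "z = Inl (w, H, \<sigma>)" "(w, H, \<sigma>) \<in> A"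
    | w H \<sigma> where "z = Inr (w, H, \<sigma>)" "(w, H, \<sigma>) \<in> B" by (cases z) auto
  then show "inner_cell p i j z \<in> A <+> B \<and> inner_cell p i j (inner_cell p i j z) = z \<and>
      case_sum config_sign (\<lambda>b. - config_sign b) (inner_cell p i j z) =
      - case_sum config_sign (\<lambda>b. - config_sign b) z"
  proof cases
    case 1
    then show ?thesis using inner_cell_up by simp
  next
    case 2
    then show ?thesis using inner_cell_down by simp
  qed
qed

end

section \<open>The local rule in a diagonal cell\<close>

context
  fixes l j :: nat and m :: "nat \<Rightarrow> nat" and d :: "nat \<Rightarrow> bool \<times> nat" and R :: "(nat \<times> nat) set"
  assumes j: "j < l" and dl: "d (l - 1) = (True, j)"
    and inj: "inj_on (snd \<circ> d) {..<l}" and R: "(j, j) \<in> R"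
begin

private abbreviation (input) "diag_A \<equiv> configs l m d R"
private abbreviation (input) "diag_B \<equiv> configs l m (d(l - 1 := (False, j))) (R - {(j, j)})"

private definition diag_frame :: "partition list \<Rightarrow> partition list \<Rightarrow> bool" where
  "diag_frame w H \<longleftrightarrow> length w = Suc l \<and> w ! 0 = [] \<and>
    (\<forall>k<l. k \<noteq> l - 1 \<longrightarrow> border_step m H (d k) (w ! k) (w ! Suc k))"

private lemma diag_all_split: "(\<forall>k<l. Q k) \<longleftrightarrow> (\<forall>k<l. k \<noteq> l - 1 \<longrightarrow> Q k) \<and> Q (l - 1)"
  using j by (metis less_imp_diff_less zero_less_one diff_less gr_implies_not0 neq0_conv)

private lemma diag_A_iff: "(w, H, \<sigma>) \<in> diag_A \<longleftrightarrow> diag_frame w H \<and>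
    edge (line_size m H j) (w ! l) (w ! (l - 1)) \<and> (H, \<sigma>) \<in> partial_involutions l m R"
  using j dl unfolding configs_def diag_frame_def
  by (subst diag_all_split) (auto simp: border_step_def)

private lemma diag_B_iff: "(w, H, \<sigma>) \<in> diag_B \<longleftrightarrow> diag_frame w H \<and>
    edge (line_size m H j) (w ! (l - 1)) (w ! l) \<and>
    (H, \<sigma>) \<in> partial_involutions l m (R - {(j, j)})"
  using j dl unfolding configs_def diag_frame_def
  by (subst diag_all_split) (auto simp: border_step_def)

private lemma diag_frame_update [simp]: "diag_frame (w[l := x]) H \<longleftrightarrow> diag_frame w H"
  using j unfolding diag_frame_def by (auto simp: nth_list_update)

private lemma diag_frame_hooks: "diag_frame w (H[j := a]) \<longleftrightarrow> diag_frame w H"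
proof -
  have sz: "line_size m (H[j := a]) (snd (d k)) = line_size m H (snd (d k))"
    if "k < l" "k \<noteq> l - 1" for k
  proof -
    have "snd (d k) \<noteq> j"
      using inj_onD[OF inj, of k "l - 1"] that j dl by auto
    then show ?thesis by (simp add: line_size_def)
  qed
  have "border_step m (H[j := a]) (d k) = border_step m H (d k)" if "k < l" "k \<noteq> l - 1" for k
    using sz[OF that] by (cases "d k") (auto simp: border_step_def fun_eq_iff)
  then show ?thesis unfolding diag_frame_def by simp
qed

private lemma diag_nths [simp]:
  assumes "diag_frame w H"
  shows "w[l := x] ! l = x" "w[l := x] ! (l - Suc 0) = w ! (l - 1)"
  using j assms by (auto simp: diag_frame_def)

private lemma diag_restore: "w ! l = x \<Longrightarrow> w[l := x] = w" by auto

private definition diag_rest :: "partition list \<Rightarrow> int" where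
  "diag_rest w = (\<Prod>k \<in> {..<l} - {l - 1}. edge_sign (w ! k) (w ! Suc k))"

private lemma diag_rest_update [simp]: "diag_rest (w[l := x]) = diag_rest w"
  unfolding diag_rest_def using j by (intro prod.cong) (auto simp: nth_list_update)

private lemma diag_config_sign_eq:
  assumes "diag_frame w H"
  shows "config_sign (w, I) = diag_rest w * edge_sign (w ! (l - 1)) (w ! l) * involution_sign I"
proof -
  let ?f = "\<lambda>k. edge_sign (w ! k) (w ! Suc k)"
  have "{..<l} = insert (l - 1) ({..<l} - {l - 1})" using j by auto
  then have "prod ?f {..<l} = prod ?f (insert (l - 1) ({..<l} - {l - 1}))" by simp
  also have "\<dots> = ?f (l - 1) * diag_rest w" unfolding diag_rest_def by (intro prod.insert) auto
  finally have "prod ?f {..<l} = ?f (l - 1) * diag_rest w" .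
  then show ?thesis using assms j by (simp add: config_sign_def diag_frame_def)
qed

private lemma diag_line_sizes:
  assumes "0 < line_size m H j" shows "H ! j = []" "line_size m H j = m j"
  using assms by (auto simp: line_size_def split: if_splits)

text \<open>Line \<open>j\<close> turns here from a row into a column, and the border has only one
  edge at the cell. An inserted hook sits at a fixed point of the involution, and its sign passes to
  that edge; bumping keeps the height and thus the sign.\<close>

private lemma diagonal_cell_up:
  assumes c: "(w, H, \<sigma>) \<in> diag_A"
  defines "z \<equiv> diagonal_cell l j (Inl (w, H, \<sigma>))"
  shows "z \<in> diag_A <+> diag_B \<and> diagonal_cell l j z = Inl (w, H, \<sigma>) \<and>
    case_sum config_sign (\<lambda>c. - config_sign c) z = - config_sign (w, H, \<sigma>)"
proof -
  let ?\<kappa> = "w ! (l - 1)" and ?\<rho> = "w ! l"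
  have fr: "diag_frame w H" and ej: "edge (line_size m H j) ?\<rho> ?\<kappa>"
    and I: "(H, \<sigma>) \<in> partial_involutions l m R" using c unfolding diag_A_iff by auto
  have part: "is_partition ?\<kappa>" "is_partition ?\<rho>" using edge_partition[OF ej] by auto
  note nth = diag_nths[OF fr]
  have len: "length H = l" using I by (simp add: partial_involutions_iff)
  show ?thesis
  proof (cases "\<sigma> j = j \<and> H ! j \<noteq> []")
    case True
    then have \<sigma>: "\<sigma> j = j" and ne: "H ! j \<noteq> []" by auto
    note tk = take_hook_partial[OF I order.refl j \<sigma> ne]
    have eq: "?\<rho> = ?\<kappa>" using ej ne by (auto simp: line_size_def)
    obtain s h where hs: "h < s" "H ! j = hook s h" using tk(4) by (auto simp: is_hook_def)
    then have s: "s = m j" and hh: "hook_height (H ! j) = h"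
      using tk(5) hook_statistics[OF part(1) hs(1)] by simp_all
    let ?\<mu> = "insert_hook ?\<kappa> (H ! j)"
    let ?I = "(H[j := []], \<sigma>(j := j))"
    note st = insert_hook_step[OF part(1) hs(1), folded hs(2)]
    have ne': "?\<mu> \<noteq> ?\<kappa>" using st(1) ribbon_step_irrefl by metis
    have z: "z = Inr (w[l := ?\<mu>], ?I)" using True by (simp add: z_def take_hook_def Let_def)
    have "(w[l := ?\<mu>], ?I) \<in> diag_B"
      unfolding diag_B_iff using tk(1) fr st(1) eq nth len j s
      by (auto simp: diag_frame_hooks take_hook_def line_size_def step_edge)
    moreover have "diagonal_cell l j z = Inl (w, H, \<sigma>)"
      using z ne' eq st(2) tk(2) nth hs(2) diag_restore[OF eq] by (simp add: take_hook_def Let_def)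
    moreover have "config_sign (w[l := ?\<mu>], ?I) = config_sign (w, H, \<sigma>)"
      using diag_config_sign_eq[of "w[l := ?\<mu>]" H ?I] diag_config_sign_eq[OF fr, of "(H, \<sigma>)"] fr nth eq
        edge_sign_step[OF st(1)] involution_sign_take_hook[OF I order.refl j \<sigma>] hh
      by (simp add: take_hook_def hook_sign_def)
    ultimately show ?thesis using z by (simp del: diagonal_cell.simps)
  next
    case False
    have I': "(H, \<sigma>) \<in> partial_involutions l m (R - {(j, j)})"
      using partial_involutions_remove[OF I] False by blast
    show ?thesis
    proof (cases "?\<rho> = ?\<kappa>")
      case r: True
      have z: "z = Inr (w, H, \<sigma>)" using False r by (auto simp: z_def Let_def)
      have "(w, H, \<sigma>) \<in> diag_B" unfolding diag_B_iff using I' fr ej r part by auto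
      moreover have "diagonal_cell l j z = Inl (w, H, \<sigma>)" using z r by (simp add: Let_def)
      ultimately show ?thesis using z by (simp del: diagonal_cell.simps)
    next
      case r: False
      obtain h where h: "ribbon_step (m j) h ?\<rho> ?\<kappa>" "H ! j = []" "line_size m H j = m j"
        using edge_step[OF ej r] diag_line_sizes[OF edge_step[OF ej r, THEN conjunct1]] by auto
      let ?\<mu> = "bump ?\<kappa> ?\<rho>"
      note st = bump_step[OF part(1) ribbon_step_height_less[OF h(1)] h(1)]
      have ne': "?\<mu> \<noteq> ?\<kappa>" using st(1) ribbon_step_irrefl by metis
      have z: "z = Inr (w[l := ?\<mu>], H, \<sigma>)" using r h(2) by (simp add: z_def Let_def)
      have "(w[l := ?\<mu>], H, \<sigma>) \<in> diag_B"
        unfolding diag_B_iff using I' fr nth st(1) h by (auto intro: step_edge)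
      moreover have "diagonal_cell l j z = Inl (w, H, \<sigma>)"
        using z nth st(2) ne' by (simp add: Let_def)
      moreover have "config_sign (w[l := ?\<mu>], H, \<sigma>) = config_sign (w, H, \<sigma>)"
        using diag_config_sign_eq[of "w[l := ?\<mu>]" H] diag_config_sign_eq[OF fr] fr nth
          edge_sign_step[OF st(1)] edge_sign_step[OF h(1)] by simp
      ultimately show ?thesis using z by (simp del: diagonal_cell.simps)
    qed
  qed
qed

private lemma diagonal_cell_down:
  assumes c: "(w, H, \<sigma>) \<in> diag_B"
  defines "z \<equiv> diagonal_cell l j (Inr (w, H, \<sigma>))"
  shows "z \<in> diag_A <+> diag_B \<and> diagonal_cell l j z = Inr (w, H, \<sigma>) \<and>
    case_sum config_sign (\<lambda>c. - config_sign c) z = config_sign (w, H, \<sigma>)"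
proof -
  let ?\<kappa> = "w ! (l - 1)" and ?\<mu> = "w ! l"
  have fr: "diag_frame w H" and ej: "edge (line_size m H j) ?\<kappa> ?\<mu>"
    and I': "(H, \<sigma>) \<in> partial_involutions l m (R - {(j, j)})" using c unfolding diag_B_iff by auto
  have I: "(H, \<sigma>) \<in> partial_involutions l m R" using partial_involutions_mono[OF I'] by blast
  have part: "is_partition ?\<kappa>" "is_partition ?\<mu>" using edge_partition[OF ej] by auto
  note nth = diag_nths[OF fr]
  have len: "length H = l" using I by (simp add: partial_involutions_iff)
  have \<sigma>: "\<not> (\<sigma> j = j \<and> H ! j \<noteq> [])" using partial_involutions_not_in[OF I'] j by auto
  show ?thesis
  proof (cases "?\<mu> = ?\<kappa>")
    case r: True
    have z: "z = Inl (w, H, \<sigma>)" using r by (simp add: z_def Let_def)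
    have "(w, H, \<sigma>) \<in> diag_A" unfolding diag_A_iff using I fr ej r part by auto
    moreover have "diagonal_cell l j z = Inr (w, H, \<sigma>)" using z r \<sigma> by (auto simp: Let_def)
    ultimately show ?thesis using z by (simp del: diagonal_cell.simps)
  next
    case r: False
    obtain k where k: "ribbon_step (m j) k ?\<kappa> ?\<mu>" "H ! j = []" "line_size m H j = m j"
      using edge_step[OF ej not_sym[OF r]] diag_line_sizes[OF edge_step[OF ej not_sym[OF r], THEN conjunct1]]
      by auto
    have hs: "k < m j" using ribbon_step_height_less[OF k(1)] .
    note ub = unbump_step[OF part(1) hs k(1)]
    show ?thesis
    proof (cases "unbump ?\<kappa> ?\<mu>")
      case (Inl K)
      have K: "K = hook (m j) k" "insert_hook ?\<kappa> K = ?\<mu>" using ub(1)[OF Inl] by auto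
      then have hook: "is_hook K" "hook_size K = m j" "hook_height K = k"
        using hook_statistics[OF part(1) hs] by auto
      let ?I = "(H[j := K], \<sigma>(j := j))"
      have z: "z = Inl (w[l := ?\<kappa>], ?I)" using r Inl by (simp add: z_def put_hook_def Let_def)
      note pt = put_hook_partial[OF I' order.refl j R k(2) k(2) hook(1,2) refl]
      have P: "?I \<in> partial_involutions l m R" using pt(1) by (simp add: put_hook_def)
      have "(w[l := ?\<kappa>], ?I) \<in> diag_A"
        unfolding diag_A_iff using P fr nth len j is_hook_nonempty[OF hook(1)] part
        by (auto simp: diag_frame_hooks line_size_def)
      moreover have "diagonal_cell l j z = Inr (w, H, \<sigma>)"
        using z nth K(2) pt(2) j len is_hook_nonempty[OF hook(1)] by (simp add: Let_def put_hook_def)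
      moreover have "config_sign (w[l := ?\<kappa>], ?I) = config_sign (w, H, \<sigma>)"
        using diag_config_sign_eq[of "w[l := ?\<kappa>]" H ?I] diag_config_sign_eq[OF fr, of "(H, \<sigma>)"] fr nth
          edge_sign_step[OF k(1)] pt(2) j len hook(3)
          involution_sign_take_hook[OF P order.refl j]
        by (simp add: put_hook_def hook_sign_def)
      ultimately show ?thesis using z by (simp del: diagonal_cell.simps)
    next
      case (Inr \<rho>)
      have st: "ribbon_step (m j) k \<rho> ?\<kappa>" "bump ?\<kappa> \<rho> = ?\<mu>" using ub(2)[OF Inr] by auto
      have ne': "\<rho> \<noteq> ?\<kappa>" using st(1) ribbon_step_irrefl by metis
      have z: "z = Inl (w[l := \<rho>], H, \<sigma>)" using r Inr by (simp add: z_def Let_def)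
      have "(w[l := \<rho>], H, \<sigma>) \<in> diag_A"
        unfolding diag_A_iff using I fr nth st(1) k by (auto intro: step_edge)
      moreover have "diagonal_cell l j z = Inr (w, H, \<sigma>)"
        using z nth st(2) ne' k(2) by (simp add: Let_def)
      moreover have "config_sign (w[l := \<rho>], H, \<sigma>) = config_sign (w, H, \<sigma>)"
        using diag_config_sign_eq[of "w[l := \<rho>]" H] diag_config_sign_eq[OF fr] fr nth
          edge_sign_step[OF st(1)] edge_sign_step[OF k(1)] by simp
      ultimately show ?thesis using z by (simp del: diagonal_cell.simps)
    qed
  qed
qed

lemma diagonal_cell_sign_matching: "sign_matching diag_A config_sign diag_B config_sign (diagonal_cell l j)"
  unfolding sign_matching_def
proof
  fix z assume "z \<in> diag_A <+> diag_B"
  then consider w H \<sigma> where "z = Inl (w, H, \<sigma>)" "(w, H, \<sigma>) \<in> diag_A"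
    | w H \<sigma> where "z = Inr (w, H, \<sigma>)" "(w, H, \<sigma>) \<in> diag_B" by (cases z) auto
  then show "diagonal_cell l j z \<in> diag_A <+> diag_B \<and> diagonal_cell l j (diagonal_cell l j z) = z \<and>
      case_sum config_sign (\<lambda>b. - config_sign b) (diagonal_cell l j z) =
      - case_sum config_sign (\<lambda>b. - config_sign b) z"
  proof cases
    case 1
    then show ?thesis using diagonal_cell_up by (simp del: diagonal_cell.simps)
  next
    case 2
    then show ?thesis using diagonal_cell_down by (simp del: diagonal_cell.simps)
  qed
qed

end

section \<open>Growth on the half grid\<close>

lemma card_cells_ribbon: "is_ribbon q p \<Longrightarrow> card (cells q) = card (cells p) + card (skew q p)"
  unfolding is_ribbon_def skew_def
  by (metis card_Diff_subset card_mono finite_cells le_add_diff_inverse)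

lemma card_cells_edge: "edge s p q \<Longrightarrow> card (cells q) = card (cells p) + s"
  using card_cells_ribbon[of q p] by (auto simp: edge_def ribbon_step_iff split: if_splits)

lemma finite_partitions: "finite {p. is_partition p \<and> card (cells p) \<le> N}"
proof (rule finite_subset)
  show "{p. is_partition p \<and> card (cells p) \<le> N} \<subseteq> {p. set p \<subseteq> {..N} \<and> length p \<le> N}"
  proof
    fix p assume p: "p \<in> {p. is_partition p \<and> card (cells p) \<le> N}"
    have "(\<lambda>i. (i, 0)) ` {..<length p} \<subseteq> cells p"
      using p part_pos_iff by (auto simp: cells_iff)
    then have "card ((\<lambda>i. (i, 0 :: nat)) ` {..<length p}) \<le> card (cells p)"
      by (rule card_mono[OF finite_cells])
    then have "length p \<le> N" using p by (simp add: card_image inj_on_def)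
    moreover have "set p \<subseteq> {..N}"
    proof
      fix x assume "x \<in> set p"
      then obtain i where i: "i < length p" "x = p ! i" by (auto simp: in_set_conv_nth)
      then have "(\<lambda>j. (i, j)) ` {..<x} \<subseteq> cells p" by (auto simp: cells_def)
      then have "card ((\<lambda>j. (i, j)) ` {..<x}) \<le> card (cells p)" by (rule card_mono[OF finite_cells])
      then show "x \<in> {..N}" using p by (simp add: card_image inj_on_def)
    qed
    ultimately show "p \<in> {p. set p \<subseteq> {..N} \<and> length p \<le> N}" by simp
  qed
qed (rule finite_lists_length_le, simp)

lemma finite_hooks: "finite {K. is_hook K \<and> hook_size K \<le> N}"
proof (rule finite_subset)
  show "{K. is_hook K \<and> hook_size K \<le> N} \<subseteq> (\<lambda>(s, h). hook s h) ` ({..N} \<times> {..N})"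
  proof
    fix K assume K: "K \<in> {K. is_hook K \<and> hook_size K \<le> N}"
    then obtain s h where sh: "h < s" "K = hook s h" by (auto simp: is_hook_def)
    have "is_partition []" by (simp add: is_partition_def)
    then have "s \<le> N" using K sh hook_statistics by auto
    then show "K \<in> (\<lambda>(s, h). hook s h) ` ({..N} \<times> {..N})" using sh by force
  qed
qed simp

text \<open>The border starts at the empty partition and each step changes the number of cells by a
  bounded amount, so the partitions on it have bounded size. This supplies the finite intermediate
  sets for the composition.\<close>

lemma finite_configs: "finite (configs l m d R)"
proof -
  \<comment> \<open>\<open>M\<close> bounds the size of every edge and \<open>N\<close> that of
    every hook; sums serve as convenient upper bounds.\<close>
  define M where "M = (\<Sum>k<l. m (snd (d k)))"
  define N where "N = (\<Sum>k<l. m k)"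
  let ?W = "{w. set w \<subseteq> {p. is_partition p \<and> card (cells p) \<le> l * M} \<and> length w = Suc l}"
  let ?H = "{H. set H \<subseteq> insert [] {K. is_hook K \<and> hook_size K \<le> N} \<and> length H = l}"
  have "configs l m d R \<subseteq> ?W \<times> ?H \<times> {\<sigma>. \<sigma> permutes {..<l}}"
  proof
    fix c assume "c \<in> configs l m d R"
    then obtain w H \<sigma> where c: "c = (w, H, \<sigma>)" "length w = Suc l" "w ! 0 = []"
      "\<And>k. k < l \<Longrightarrow> border_step m H (d k) (w ! k) (w ! Suc k)"
      and I: "(H, \<sigma>) \<in> partial_involutions l m R"
      by (auto simp: configs_def)
    have "is_partition (w ! k) \<and> card (cells (w ! k)) \<le> k * M" if "k \<le> l" for k
      using that
    proof (induction k)
      case 0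
      then show ?case using c(3) by (simp add: is_partition_def cells_def)
    next
      case (Suc k)
      obtain v i where d: "d k = (v, i)" by force
      have "m (snd (d k)) \<le> M" unfolding M_def using Suc by (intro member_le_sum) auto
      then have "line_size m H i \<le> M" using d by (simp add: line_size_def)
      moreover have "edge (line_size m H i) (w ! k) (w ! Suc k) \<or>
          edge (line_size m H i) (w ! Suc k) (w ! k)"
        using c(4)[of k] Suc d by (auto simp: border_step_def split: if_splits)
      ultimately show ?case using Suc card_cells_edge edge_partition by fastforce
    qed
    moreover have "k * M \<le> l * M" if "k \<le> l" for k using that by simp
    ultimately have "is_partition (w ! k) \<and> card (cells (w ! k)) \<le> l * M" if "k \<le> l" for k
      using that order_trans by blast
    then have "w \<in> ?W" using c(2) by (auto simp: in_set_conv_nth less_Suc_eq_le)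
    moreover have "H \<in> ?H"
    proof -
      have "H ! i \<in> insert [] {K. is_hook K \<and> hook_size K \<le> N}" if "i < l" for i
      proof -
        have "m i \<le> N" unfolding N_def using that by (intro member_le_sum) auto
        then show ?thesis using I that by (auto simp: partial_involutions_def)
      qed
      then show ?thesis using I by (force simp: partial_involutions_def in_set_conv_nth)
    qed
    ultimately show "c \<in> ?W \<times> ?H \<times> {\<sigma>. \<sigma> permutes {..<l}}"
      using c(1) I by (auto simp: partial_involutions_def)
  qed
  then show ?thesis
    by (rule finite_subset)
      (intro finite_cartesian_product finite_lists_length_eq finite_partitions
        finite_permutations finite_insert[THEN iffD2] finite_hooks finite_lessThan)
qed

text \<open>The border before the treatment of the cell \<open>(i, j)\<close>; at \<open>i = 0\<close>, \<open>j = l\<close> it is the upper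
  side of the half grid.\<close>

definition border :: "nat \<Rightarrow> nat \<Rightarrow> nat \<Rightarrow> nat \<Rightarrow> bool \<times> nat" where
  "border l i j k =
    (if k + j + 1 < l then (True, l - 1 - k)
     else if k + j + 1 < l + i then (False, k + j + 1 - l)
     else if k + j + 1 = l + i then (True, j)
     else (False, k + j - l))"

definition remaining :: "nat \<Rightarrow> nat \<Rightarrow> nat \<Rightarrow> (nat \<times> nat) set" where
  "remaining l i j = {(a, b). a \<le> b \<and> b < l \<and> (j < b \<or> b = j \<and> i \<le> a)}"

section \<open>The sweep over the half grid\<close>

lemma configs_cong: "(\<And>k. k < l \<Longrightarrow> d k = d' k) \<Longrightarrow> configs l m d R = configs l m d' R"
  by (simp add: configs_def)

text \<open>Along the border the labels are the rows from \<open>l - 1\<close> down to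
  \<open>j + 1\<close>, the columns \<open>0\<close> to \<open>i - 1\<close>, the row
  \<open>j\<close>, and the columns \<open>i\<close> to \<open>j - 1\<close>: each line is met
  once.\<close>

lemma border_inj: "i \<le> j \<Longrightarrow> j < l \<Longrightarrow> inj_on (snd \<circ> border l i j) {..<l}"
  by (rule inj_onI) (auto simp: border_def split: if_splits)

lemma remaining_Suc: "remaining l (Suc i) j = remaining l i j - {(i, j)}"
  by (auto simp: remaining_def)

text \<open>The end of row \<open>j\<close>, past its diagonal cell, and the beginning of row
  \<open>j + 1\<close> are two descriptions of the same border.\<close>

lemma configs_next_row:
  "configs l m (border l (Suc j) j) (remaining l (Suc j) j) =
    configs l m (border l 0 (Suc j)) (remaining l 0 (Suc j))"
proof -
  have "remaining l (Suc j) j = remaining l 0 (Suc j)" by (auto simp: remaining_def)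
  then show ?thesis by (auto simp: border_def intro!: configs_cong)
qed

text \<open>Treating an inner cell swaps the row step and the column step that meet at its corner;
  treating a diagonal cell turns the last step of the border from row \<open>j\<close> into column
  \<open>j\<close>.\<close>

lemma cell_rule_sign_matching:
  assumes ij: "i \<le> j" "j < l"
  shows "sign_matching (configs l m (border l i j) (remaining l i j)) config_sign
    (configs l m (border l (Suc i) j) (remaining l (Suc i) j)) config_sign (cell_rule l (i, j))"
proof (cases "i = j")
  case True
  have "configs l m (border l (Suc j) j) (remaining l (Suc j) j) =
      configs l m ((border l j j)(l - 1 := (False, j))) (remaining l j j - {(j, j)})"
    unfolding remaining_Suc using ij by (intro configs_cong) (auto simp: border_def)
  moreover have "border l j j (l - 1) = (True, j)" "(j, j) \<in> remaining l j j"
    using ij by (auto simp: border_def remaining_def)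
  ultimately show ?thesis
    using diagonal_cell_sign_matching[OF ij(2) _ border_inj[OF order.refl ij(2)]] True
    by (simp add: cell_rule_def)
next
  case False
  let ?p = "l - j + i"
  have "configs l m (border l (Suc i) j) (remaining l (Suc i) j) =
      configs l m ((border l i j)(?p - 1 := (False, i), ?p := (True, j))) (remaining l i j - {(i, j)})"
    unfolding remaining_Suc using ij False by (intro configs_cong) (auto simp: border_def)
  moreover have "border l i j (?p - 1) = (True, j)" "border l i j ?p = (False, i)"
    "(i, j) \<in> remaining l i j" "0 < ?p" "?p < l" "i < j"
    using ij False by (auto simp: border_def remaining_def)
  ultimately show ?thesis
    using inner_cell_sign_matching[of i j l ?p "border l i j" "remaining l i j" m] ij
      border_inj[OF ij]
    by (simp add: cell_rule_def)
qed

text \<open>\<open>foldr\<close> makes the first cell outermost, so each cell is composed with the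
  matching of all later ones, and both inductions, over rows and within a row, run
  backwards.\<close>

lemma growth_sign_matching:
  "sign_matching (configs l m (border l 0 0) (remaining l 0 0)) config_sign
    (configs l m (border l 0 l) (remaining l 0 l)) config_sign (growth l)"
proof -
  define C where "C i j = configs l m (border l i j) (remaining l i j)" for i j
  let ?comp = "foldr (\<lambda>c t. compose (cell_rule l c) t)"
  have row: "sign_matching (C i j) config_sign (C 0 l) config_sign (?comp (map (\<lambda>i. (i, j)) [i..<Suc j]) t)"
    if "sign_matching (C (Suc j) j) config_sign (C 0 l) config_sign t" "i \<le> Suc j" "j < l" for i j t
    using that(2)
  proof (induction rule: inc_induct)
    case base
    show ?case using that(1) by simp
  next
    case (step i)
    have "sign_matching (C i j) config_sign (C (Suc i) j) config_sign (cell_rule l (i, j))"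
      unfolding C_def using cell_rule_sign_matching[of i j l m] step that by simp
    then show ?case
      using sign_matching_compose[OF _ step(3)] step(2) finite_configs
      by (simp add: upt_conv_Cons C_def del: upt_Suc)
  qed
  have "sign_matching (C 0 j) config_sign (C 0 l) config_sign
      (?comp (concat (map (\<lambda>j. map (\<lambda>i. (i, j)) [0..<Suc j]) [j..<l])) trivial_matching)"
    if "j \<le> l" for j
    using that
  proof (induction rule: inc_induct)
    case base
    show ?case by (simp add: sign_matching_trivial)
  next
    case (step j)
    have "C (Suc j) j = C 0 (Suc j)" unfolding C_def by (rule configs_next_row)
    then show ?case
      using row[of j _ 0] step by (simp add: upt_conv_Cons del: upt_Suc)
  qed
  from this[of 0] show ?thesis by (simp add: C_def growth_def half_grid_def)
qed

section \<open>Configurations at both ends of the sweep\<close>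

text \<open>The compositions of \<open>n\<close> into \<open>l\<close> positive parts. Fixing the
  value 0 outside makes the set of functions finite.\<close>

definition line_sizes :: "nat \<Rightarrow> nat \<Rightarrow> (nat \<Rightarrow> nat) set" where
  "line_sizes n l = {m. (\<forall>i. (i < l \<longrightarrow> 0 < m i) \<and> (\<not> i < l \<longrightarrow> m i = 0)) \<and> (\<Sum>i<l. m i) = n}"

lemma finite_line_sizes: "finite (line_sizes n l)"
proof (rule finite_subset)
  show "line_sizes n l \<subseteq> {m. \<forall>i. (i \<in> {..<l} \<longrightarrow> m i \<in> {..n}) \<and> (i \<notin> {..<l} \<longrightarrow> m i = 0)}"
    unfolding line_sizes_def by (auto intro!: member_le_sum)
  show "finite {m. \<forall>i. (i \<in> {..<l} \<longrightarrow> m i \<in> {..n}) \<and> (i \<notin> {..<l} \<longrightarrow> m i = (0::nat))}"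
    by (rule finite_set_of_finite_funs) auto
qed

lemma is_partition_Nil [simp]: "is_partition []"
  by (simp add: is_partition_def)

lemma edge_to_Nil:
  assumes "edge s p []" shows "p = []" "s = 0"
proof -
  have "card (cells []) = 0" by (simp add: cells_def)
  then have "card (cells p) = 0" and s: "s = 0" using card_cells_edge[OF assms] by simp_all
  then show "p = []" "s = 0" using assms by auto
qed

lemma initial_config_in:
  assumes I: "I \<in> hook_involutions n l"
  shows "\<exists>m \<in> line_sizes n l. initial_config I \<in> configs l m (border l 0 0) (remaining l 0 0)"
proof -
  obtain H \<sigma> where I': "I = (H, \<sigma>)" by force
  have H: "length H = l" "\<And>i. i < l \<Longrightarrow> is_hook (H ! i)" "\<sigma> permutes {..<l}" "\<sigma> \<circ> \<sigma> = id"
    "(\<Sum>i<l. hook_size (H ! i)) = n" "\<And>i. i < l \<Longrightarrow> H ! i = H ! \<sigma> i"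
    using I I' by (auto simp: hook_involutions_def hook_permutations_def)
  \<comment> \<open>The line sizes are dictated by the hooks; \<open>\<sigma>\<close> joins only
    positions with the same hook, so they are consistent.\<close>
  define m where "m i = (if i < l then hook_size (H ! i) else 0)" for i
  have "0 < hook_size (H ! i)" if "i < l" for i
    using H(2)[OF that] hook_statistics(2)[OF is_partition_Nil] by (auto simp: is_hook_def)
  then have "m \<in> line_sizes n l" using H(5) by (simp add: line_sizes_def m_def)
  moreover have "(H, \<sigma>) \<in> partial_involutions l m (remaining l 0 0)"
  proof -
    have "\<sigma> i < l" if "i < l" for i using permutes_in_image[OF H(3), of i] that by simp
    then show ?thesis
      using H(1-4) H(6)[symmetric] is_hook_nonempty
      by (auto simp: partial_involutions_def m_def remaining_def)
  qed
  moreover have "border_step m H (border l 0 0 k) [] []" if "k < l" for k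
  proof -
    have "border l 0 0 k = (True, l - 1 - k)" using that by (auto simp: border_def)
    moreover have "H ! (l - 1 - k) \<noteq> []" using H(2) is_hook_nonempty that by simp
    ultimately show ?thesis by (simp add: border_step_def line_size_def)
  qed
  ultimately show ?thesis using H(1) I'
    by (auto simp: initial_config_def configs_def nth_Cons' intro!: bexI[of _ m])
qed

text \<open>The initial border starts at the empty partition and only descends, so all its
  partitions are empty. Every line then has an empty edge although its size is positive, which means
  that its hook is still in place.\<close>

lemma in_initial_configs:
  assumes m: "m \<in> line_sizes n l" and c: "(w, I) \<in> configs l m (border l 0 0) (remaining l 0 0)"
  shows "I \<in> hook_involutions n l" "w = fst (initial_config I)"
proof -
  obtain H \<sigma> where I: "I = (H, \<sigma>)" by force
  have w: "length w = Suc l" "w ! 0 = []"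
    and step: "\<And>k. k < l \<Longrightarrow> border_step m H (border l 0 0 k) (w ! k) (w ! Suc k)"
    and P: "(H, \<sigma>) \<in> partial_involutions l m (remaining l 0 0)"
    using c I by (auto simp: configs_def)
  have edge: "edge (line_size m H (l - 1 - k)) (w ! Suc k) (w ! k)" if "k < l" for k
    using step[OF that] that by (auto simp: border_step_def border_def split: if_splits)
  have Nil: "w ! k = []" if "k \<le> l" for k
    using that
  proof (induction k)
    case (Suc k)
    then show ?case using edge[of k] edge_to_Nil(1) by simp
  qed (simp add: w)
  have len: "length H = l" using P by (simp add: partial_involutions_def)
  show "w = fst (initial_config I)"
    using w(1) Nil len I by (intro nth_equalityI) (auto simp: initial_config_def simp del: replicate_Suc)
  have "H ! i \<noteq> []" if "i < l" for i
  proof -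
    have "line_size m H i = 0"
      using edge[of "l - 1 - i"] that Nil[of "l - 1 - i"] edge_to_Nil(2) by simp
    then show ?thesis using m that by (auto simp: line_size_def line_sizes_def)
  qed
  then show "I \<in> hook_involutions n l"
    using P m I by (auto simp: hook_involutions_def hook_permutations_def partial_involutions_def line_sizes_def)
qed

lemma config_sign_initial: "config_sign (initial_config I) = involution_sign I"
proof -
  have "(\<Prod>k<length (fst I). edge_sign (replicate (Suc (length (fst I))) [] ! k)
      (replicate (Suc (length (fst I))) [] ! Suc k)) = 1"
    by (intro prod.neutral) (auto simp del: replicate_Suc)
  then show ?thesis by (simp add: config_sign_def initial_config_def del: replicate_Suc)
qed

lemma border_final: "k < l \<Longrightarrow> border l 0 l k = (False, k)"
  by (simp add: border_def)

lemma card_cells_tableau: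
  assumes "P ! 0 = []" "\<And>i. i < l \<Longrightarrow> is_ribbon (P ! Suc i) (P ! i)" "k \<le> l"
  shows "card (cells (P ! k)) = (\<Sum>i<k. card (skew (P ! Suc i) (P ! i)))"
  using assms(3)
proof (induction k)
  case 0
  show ?case using assms(1) by (simp add: cells_def)
next
  case (Suc k)
  then show ?case using card_cells_ribbon[OF assms(2)[of k]] by simp
qed

lemma final_config_in:
  assumes P: "P \<in> ribbon_tableaux n l"
  shows "\<exists>m \<in> line_sizes n l. final_config P \<in> configs l m (border l 0 l) (remaining l 0 l)"
proof -
  have len: "length P = Suc l" "P ! 0 = []" and rib: "\<And>i. i < l \<Longrightarrow> is_ribbon (P ! Suc i) (P ! i)"
    and ne: "\<And>i. i < l \<Longrightarrow> skew (P ! Suc i) (P ! i) \<noteq> {}" and n: "card (cells (P ! l)) = n"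
    using P by (auto simp: ribbon_tableaux_def)
  define m where "m i = (if i < l then card (skew (P ! Suc i) (P ! i)) else 0)" for i
  have pos: "0 < m i" if "i < l" for i
    using ne[OF that] finite_cells that by (simp add: m_def card_gt_0_iff skew_def)
  then have "m \<in> line_sizes n l"
    using card_cells_tableau[OF len(2) rib order.refl] n by (simp add: line_sizes_def m_def)
  moreover have "border_step m (replicate l []) (border l 0 l k) (P ! k) (P ! Suc k)" if "k < l" for k
    using that pos[OF that] rib[OF that]
    by (auto simp: border_final border_step_def line_size_def edge_def ribbon_step_iff m_def)
  moreover have "(replicate l [], id) \<in> partial_involutions l m (remaining l 0 l)"
    by (simp add: partial_involutions_def permutes_id)
  ultimately show ?thesis using len
    by (auto simp: final_config_def configs_def intro!: bexI[of _ m])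
qed

text \<open>With no cell left there is no room for a hook, so every line shows its full positive
  size, and the border is an increasing chain of nonempty ribbons.\<close>

lemma in_final_configs:
  assumes m: "m \<in> line_sizes n l" and c: "(w, I) \<in> configs l m (border l 0 l) (remaining l 0 l)"
  shows "w \<in> ribbon_tableaux n l" "(w, I) = final_config w"
proof -
  obtain H \<sigma> where I: "I = (H, \<sigma>)" by force
  have w: "length w = Suc l" "w ! 0 = []"
    and step: "\<And>k. k < l \<Longrightarrow> border_step m H (border l 0 l k) (w ! k) (w ! Suc k)"
    and P: "(H, \<sigma>) \<in> partial_involutions l m (remaining l 0 l)"
    using c I by (auto simp: configs_def)
  have none: "remaining l 0 l = {}" by (auto simp: remaining_def)
  have H: "length H = l" "\<And>x. \<sigma> (\<sigma> x) = x" "\<And>x. \<not> x < l \<Longrightarrow> \<sigma> x = x" "\<And>i. i < l \<Longrightarrow> H ! \<sigma> i = H ! i"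
    "\<And>i. i < l \<Longrightarrow> H ! i = [] \<Longrightarrow> \<sigma> i = i" "\<And>i. i < l \<Longrightarrow> i \<le> \<sigma> i \<Longrightarrow> H ! i = []"
    using P unfolding none partial_involutions_iff by auto
  have Nil: "H ! i = []" if "i < l" for i
  \<comment> \<open>A hook is registered only at the smaller of its two positions; at the larger
    one, the equal entry at \<open>\<sigma> i\<close> is used.\<close>
  proof (cases "i \<le> \<sigma> i")
    case False
    then show ?thesis using H(2)[of i] H(4)[OF that] H(6)[of "\<sigma> i"] that by simp
  qed (use H(6)[OF that] in simp)
  have "\<sigma> = id" using H(3,5) Nil by (metis eq_id_iff)
  moreover have "H = replicate l []" using H(1) Nil by (intro nth_equalityI) auto
  ultimately show "(w, I) = final_config w" using I w by (simp add: final_config_def)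
  have edge: "edge (m k) (w ! k) (w ! Suc k)" if "k < l" for k
    using step[OF that] that Nil by (simp add: border_final border_step_def line_size_def)
  have pos: "0 < m k" if "k < l" for k using m that by (simp add: line_sizes_def)
  have rib: "is_ribbon (w ! Suc k) (w ! k)" "card (skew (w ! Suc k) (w ! k)) = m k" if "k < l" for k
    using edge[OF that] pos[OF that] by (auto simp: edge_def ribbon_step_iff)
  have "skew (w ! Suc k) (w ! k) \<noteq> {}" if "k < l" for k
    using rib(2)[OF that] pos[OF that] by auto
  moreover have "card (cells (w ! l)) = n"
    using card_cells_tableau[OF w(2) rib(1) order.refl] rib(2) m by (simp add: line_sizes_def)
  ultimately show "w \<in> ribbon_tableaux n l" using w rib(1) by (simp add: ribbon_tableaux_def)
qed

lemma config_sign_final: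
  assumes "P \<in> ribbon_tableaux n l"
  shows "config_sign (final_config P) = tableau_sign P"
proof -
  have "(\<Prod>k<length P - 1. edge_sign (P ! k) (P ! Suc k)) = tableau_sign P"
    unfolding tableau_sign_def using assms
    by (intro prod.cong) (auto simp: ribbon_tableaux_def edge_sign_ribbon)
  moreover have "involution_sign (replicate (length P - 1) [], id) = 1"
    unfolding involution_sign_def by (auto intro!: prod.neutral simp: hook_sign_def hook_height_def)
  ultimately show ?thesis by (simp add: config_sign_def final_config_def)
qed

lemma prod_sign: "(\<And>x. x \<in> A \<Longrightarrow> f x \<in> {1, -1 :: int}) \<Longrightarrow> prod f A \<in> {1, -1}"
proof (induction A rule: infinite_finite_induct)
  case (insert x F)
  have "f x = 1 \<or> f x = -1" using insert.prems[of x] by simp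
  moreover have "prod f F = 1 \<or> prod f F = -1" using insert.IH insert.prems by blast
  ultimately show ?case using insert.hyps by (elim disjE) simp_all
qed auto

text \<open>Finiteness is inherited from the configurations: there are finitely many choices of line
  sizes, and each gives a finite set.\<close>

lemma signed_set_hook_involutions: "signed_set (hook_involutions n l) involution_sign"
proof -
  have "hook_involutions n l \<subseteq> snd ` (\<Union>m \<in> line_sizes n l. configs l m (border l 0 0) (remaining l 0 0))"
    using initial_config_in by (force simp: initial_config_def image_iff)
  then have "finite (hook_involutions n l)"
    by (rule finite_subset) (simp add: finite_line_sizes finite_configs)
  moreover have "involution_sign I \<in> {1, -1}" for I
    unfolding involution_sign_def hook_sign_def
    by (cases I) (auto intro!: prod_sign simp: minus_one_power_iff simp del: insert_iff)
  ultimately show ?thesis by (simp add: signed_set_def)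
qed

lemma signed_set_ribbon_tableaux: "signed_set (ribbon_tableaux n l) tableau_sign"
proof -
  have "ribbon_tableaux n l \<subseteq> fst ` (\<Union>m \<in> line_sizes n l. configs l m (border l 0 l) (remaining l 0 l))"
    using final_config_in by (force simp: final_config_def image_iff)
  then have "finite (ribbon_tableaux n l)"
    by (rule finite_subset) (simp add: finite_line_sizes finite_configs)
  moreover have "tableau_sign P \<in> {1, -1}" for P
    unfolding tableau_sign_def ribbon_sign_def
    by (rule prod_sign) (simp add: minus_one_power_iff)
  ultimately show ?thesis by (simp add: signed_set_def)
qed

section \<open>From the matching to the signed bijection\<close>

text \<open>The line sizes are chosen for the given \<open>I\<close>, and \<open>growth l\<close>
  stays within the configurations with these sizes. The two outcomes are a partner of opposite sign
  on the same side and a partner of equal sign on the other side.\<close>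

lemma growth_hooks:
  assumes I: "I \<in> hook_involutions n l"
  obtains
    (hooks) I' where "I' \<in> hook_involutions n l" "growth l (Inl (initial_config I)) = Inl (initial_config I')"
      "growth l (Inl (initial_config I')) = Inl (initial_config I)"
      "involution_sign I' = - involution_sign I"
  | (tableau) P where "P \<in> ribbon_tableaux n l" "growth l (Inl (initial_config I)) = Inr (final_config P)"
      "growth l (Inr (final_config P)) = Inl (initial_config I)" "tableau_sign P = involution_sign I"
proof -
  obtain m where m: "m \<in> line_sizes n l"
    and c: "initial_config I \<in> configs l m (border l 0 0) (remaining l 0 0)"
    using initial_config_in[OF I] by blast
  note ok = bspec[OF growth_sign_matching[unfolded sign_matching_def] InlI[OF c], simplified]
  show ?thesis
  proof (cases "growth l (Inl (initial_config I))")
    case (Inl c')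
    obtain w I' where c': "c' = (w, I')" by (cases c')
    have "(w, I') \<in> configs l m (border l 0 0) (remaining l 0 0)" using ok Inl c' by simp
    note * = in_initial_configs[OF m this]
    then have "c' = initial_config I'" using c' by (simp add: initial_config_def)
    then show ?thesis using hooks[of I'] ok Inl *(1) by (simp add: config_sign_initial)
  next
    case (Inr c')
    obtain w I' where c': "c' = (w, I')" by (cases c')
    have "(w, I') \<in> configs l m (border l 0 l) (remaining l 0 l)" using ok Inr c' by simp
    note * = in_final_configs[OF m this]
    then show ?thesis
      using tableau[of w] ok Inr c' config_sign_final[OF *(1)] by (simp add: config_sign_initial)
  qed
qed

lemma growth_tableaux:
  assumes P: "P \<in> ribbon_tableaux n l"
  obtains
    (tableau) P' where "P' \<in> ribbon_tableaux n l" "growth l (Inr (final_config P)) = Inr (final_config P')"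
      "growth l (Inr (final_config P')) = Inr (final_config P)" "tableau_sign P' = - tableau_sign P"
  | (hooks) I where "I \<in> hook_involutions n l" "growth l (Inr (final_config P)) = Inl (initial_config I)"
      "growth l (Inl (initial_config I)) = Inr (final_config P)" "involution_sign I = tableau_sign P"
proof -
  obtain m where m: "m \<in> line_sizes n l"
    and c: "final_config P \<in> configs l m (border l 0 l) (remaining l 0 l)"
    using final_config_in[OF P] by blast
  note ok = bspec[OF growth_sign_matching[unfolded sign_matching_def] InrI[OF c], simplified]
  show ?thesis
  proof (cases "growth l (Inr (final_config P))")
    case (Inl c')
    obtain w I where c': "c' = (w, I)" by (cases c')
    have "(w, I) \<in> configs l m (border l 0 0) (remaining l 0 0)" using ok Inl c' by simp
    note * = in_initial_configs[OF m this]
    then have "c' = initial_config I" using c' by (simp add: initial_config_def)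
    then show ?thesis
      using hooks[of I] ok Inl *(1) config_sign_final[OF P] by (simp add: config_sign_initial)
  next
    case (Inr c')
    obtain w I where c': "c' = (w, I)" by (cases c')
    have "(w, I) \<in> configs l m (border l 0 l) (remaining l 0 l)" using ok Inr c' by simp
    note * = in_final_configs[OF m this]
    then show ?thesis
      using tableau[of w] ok Inr c' config_sign_final[OF *(1)] config_sign_final[OF P] by simp
  qed
qed

text \<open>Since signs are nonzero, an element with a partner on its own side is truly moved, and
  so is not mistaken for a fixed point.\<close>

lemma sign_neq_uminus: "signed_set A s \<Longrightarrow> a \<in> A \<Longrightarrow> s b = - s a \<Longrightarrow> b \<noteq> a"
  by (auto simp: signed_set_def)

theorem theorem12:
  fixes n l :: nat
  assumes "0 < n" and "0 < l"
  shows "signed_bijection (hook_involutions n l) involution_sign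
           (ribbon_tableaux n l) tableau_sign (growth_signed_bijection l)"
proof -
  let ?X = "hook_involutions n l" and ?Y = "ribbon_tableaux n l"
  let ?iX = "growth_involution_hooks l" and ?iY = "growth_involution_tableaux l"
  let ?g = "growth_tableau l"
  note X = signed_set_hook_involutions[of n l] and Y = signed_set_ribbon_tableaux[of n l]
  \<comment> \<open>When \<open>growth\<close> leads to the other side, the default branch of the
    involution returns \<open>I\<close> itself. The inequality in the first alternative ensures that
    fixed points arise in no other way.\<close>
  have hooks_cases: "?iX I \<in> ?X \<and> ?iX (?iX I) = I \<and> involution_sign (?iX I) = - involution_sign I \<and> ?iX I \<noteq> I \<or>
      ?iX I = I \<and> ?g I \<in> ?Y \<and> ?iY (?g I) = ?g I \<and> tableau_sign (?g I) = involution_sign I \<and>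
      growth l (Inr (final_config (?g I))) = Inl (initial_config I)" if "I \<in> ?X" for I
    using that
  proof (cases rule: growth_hooks)
    case (hooks I')
    then show ?thesis using sign_neq_uminus[OF X that, of I']
      by (simp add: growth_involution_hooks_def initial_config_def)
  next
    case (tableau P)
    then have "?g I = P" by (simp add: growth_tableau_def final_config_def)
    then show ?thesis using tableau
      by (simp add: growth_involution_hooks_def growth_involution_tableaux_def)
  qed
  have tableaux_cases: "?iY P \<in> ?Y \<and> ?iY (?iY P) = P \<and> tableau_sign (?iY P) = - tableau_sign P \<and> ?iY P \<noteq> P \<or>
      ?iY P = P \<and> (\<exists>I \<in> ?X. ?iX I = I \<and> ?g I = P)" if "P \<in> ?Y" for P
    using that
  proof (cases rule: growth_tableaux)
    case (tableau P')
    then show ?thesis using sign_neq_uminus[OF Y that, of P']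
      by (simp add: growth_involution_tableaux_def final_config_def)
  next
    case (hooks I)
    then have "?g I = P" "?iX I = I" "?iY P = P"
      by (simp_all add: growth_tableau_def final_config_def growth_involution_hooks_def
          growth_involution_tableaux_def)
    then show ?thesis using hooks(1) by blast
  qed
  have "sign_reversing_involution ?X involution_sign ?iX"
    unfolding sign_reversing_involution_def using hooks_cases by metis
  moreover have "sign_reversing_involution ?Y tableau_sign ?iY"
    unfolding sign_reversing_involution_def using tableaux_cases by metis
  moreover have "bij_betw ?g (fixed_points ?X ?iX) (fixed_points ?Y ?iY)"
  proof (rule bij_betw_imageI)
    show "inj_on ?g (fixed_points ?X ?iX)"
    proof (rule inj_onI)
      fix I J assume "I \<in> fixed_points ?X ?iX" "J \<in> fixed_points ?X ?iX" "?g I = ?g J"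
      \<comment> \<open>Running \<open>growth\<close> back from the common tableau recovers the
        configuration it came from.\<close>
      then have "initial_config I = initial_config J"
        using hooks_cases[of I] hooks_cases[of J] by (auto simp: fixed_points_def)
      then show "I = J" by (simp add: initial_config_def)
    qed
    show "?g ` fixed_points ?X ?iX = fixed_points ?Y ?iY"
    proof
      show "?g ` fixed_points ?X ?iX \<subseteq> fixed_points ?Y ?iY"
        using hooks_cases by (auto simp: fixed_points_def)
      show "fixed_points ?Y ?iY \<subseteq> ?g ` fixed_points ?X ?iX"
      proof
        fix P assume "P \<in> fixed_points ?Y ?iY"
        then obtain I where "I \<in> ?X" "?iX I = I" "?g I = P"
          using tableaux_cases[of P] by (auto simp: fixed_points_def)
        then show "P \<in> ?g ` fixed_points ?X ?iX" by (auto simp: fixed_points_def)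
      qed
    qed
  qed
  moreover have "\<forall>I \<in> fixed_points ?X ?iX. tableau_sign (?g I) = involution_sign I"
    using hooks_cases by (auto simp: fixed_points_def)
  ultimately show ?thesis
    using X Y by (simp add: signed_bijection_def growth_signed_bijection_def)
qed

end
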